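(* Let $n \ge 1$, let $\Omega \subset \mathbb{C}^n$ be a lattice of rank $2n$ (the subgroup generated by $2n$ vectors of $\mathbb{C}^n$ that are linearly independent over $\mathbb{R}$), and let $\varphi_1,\dots,\varphi_n$ be $n$ analytically independent abelian functions on $\mathbb{C}^n$ belonging to the period lattice $\Omega$. Then $\varphi_1,\dots,\varphi_n$ satisfy an algebraic addition theorem; that is, there exist $n$ polynomials $G_1,\dots,G_n$ in $2n+1$ complex variables with complex coefficients, none of them the zero polynomial, such that for each $k = 1,\dots,n$ the equation $$ G_k\bigl[\varphi_k(\mathbf{u}+\mathbf{v});\, \varphi_1(\mathbf{u}),\dots,\varphi_n(\mathbf{u});\, \varphi_1(\mathbf{v}),\dots,\varphi_n(\mathbf{v})\bigr] = 0 $$ holds identically for all $\mathbf{u} = (u_1,\dots,u_n) \in \mathbb{C}^n$ and $\mathbf{v} = (v_1,\dots,v_n) \in \mathbb{C}^n$ for which the functions occurring in it are defined.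
   Context: An abelian function belonging to the period lattice $\Omega \subset \mathbb{C}^n$ is a meromorphic function $\varphi$ on $\mathbb{C}^n$ with $\varphi(\mathbf{u}+\omega) = \varphi(\mathbf{u})$ for all $\omega \in \Omega$ (as meromorphic functions of $\mathbf{u}$); equivalently, $\varphi$ is induced by a meromorphic function on the complex torus $\mathbb{C}^n/\Omega$. Meromorphic functions $\varphi_1,\dots,\varphi_n$ on $\mathbb{C}^n$ are analytically independent if their Jacobian determinant $\det\bigl(\partial \varphi_i/\partial u_j\bigr)_{1\le i,j\le n}$ is not identically zero. A meromorphic function is "defined" at a point if it is holomorphic there (the point lies outside its polar and indeterminacy set). Thus the equation for index $k$ is required at all pairs $(\mathbf{u},\mathbf{v})$ such that $\varphi_k$ is defined at $\mathbf{u}+\mathbf{v}$ and all of $\varphi_1,\dots,\varphi_n$ are defined at $\mathbf{u}$ and at $\mathbf{v}$. *)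

theory Defs
  imports "HOL-Analysis.Analysis" "HOL-Library.Poly_Mapping"
begin

text \<open>
  Holomorphic functions of several variables: real differentiable with complex-linear derivative.
\<close>

definition holo_on :: "(complex ^ 'n \<Rightarrow> complex) \<Rightarrow> (complex ^ 'n) set \<Rightarrow> bool" where
  "holo_on f U \<longleftrightarrow>
     (\<forall>z\<in>U. \<exists>D. (f has_derivative D) (at z) \<and> (\<forall>c x. D (c *s x) = c * D x))"

definition defined_at :: "(complex ^ 'n \<Rightarrow> complex) \<Rightarrow> complex ^ 'n \<Rightarrow> bool" where
  "defined_at f z \<longleftrightarrow> (\<exists>U. open U \<and> z \<in> U \<and> holo_on f U)"

text \<open>
  A meromorphic function on \<open>\<complex>\<^sup>n\<close> is locally a quotient of two holomorphic functions whose
  denominator does not vanish identically (the neighbourhood being connected). It is represented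
  by a total function whose values are arbitrary on the polar and indeterminacy set. The second
  clause demands that removable singularities have been removed: if \<open>f\<close> agrees with a holomorphic
  \<open>g\<close> wherever \<open>f\<close> is holomorphic in \<open>V\<close> (a dense subset of \<open>V\<close> by the first clause), then it
  agrees with \<open>g\<close> on all of \<open>V\<close>. Thus \<^term>\<open>defined_at f z\<close> holds exactly at the points where the
  meromorphic function represented by \<open>f\<close> is holomorphic, and there \<^term>\<open>f z\<close> is its value.
\<close>

definition meromorphic_fun :: "(complex ^ 'n \<Rightarrow> complex) \<Rightarrow> bool" where
  "meromorphic_fun f \<longleftrightarrow>
     (\<forall>z. \<exists>U g h. open U \<and> connected U \<and> z \<in> U \<and> holo_on g U \<and> holo_on h U \<and>
        (\<exists>w\<in>U. h w \<noteq> 0) \<and> (\<forall>w\<in>U. h w \<noteq> 0 \<longrightarrow> f w = g w / h w)) \<and>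
     (\<forall>V g. open V \<and> holo_on g V \<and> (\<forall>w\<in>V. defined_at f w \<longrightarrow> f w = g w) \<longrightarrow>
        (\<forall>w\<in>V. f w = g w))"

definition full_lattice :: "(complex ^ 'n) set \<Rightarrow> bool" where
  "full_lattice \<Omega> \<longleftrightarrow>
     (\<exists>B. independent B \<and> card B = 2 * CARD('n) \<and>
        \<Omega> = range (\<lambda>k :: complex ^ 'n \<Rightarrow> int. \<Sum>b\<in>B. of_int (k b) *\<^sub>R b))"

text \<open>
  Periodicity is equality of meromorphic functions, so values at points where either side is
  undefined play no role.
\<close>

definition abelian_fun :: "(complex ^ 'n) set \<Rightarrow> (complex ^ 'n \<Rightarrow> complex) \<Rightarrow> bool" where
  "abelian_fun \<Omega> f \<longleftrightarrow> meromorphic_fun f \<and>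
     (\<forall>\<omega>\<in>\<Omega>. \<forall>u. defined_at f (u + \<omega>) \<and> defined_at f u \<longrightarrow> f (u + \<omega>) = f u)"

definition partial_deriv :: "'n \<Rightarrow> (complex ^ 'n \<Rightarrow> complex) \<Rightarrow> complex ^ 'n \<Rightarrow> complex" where
  "partial_deriv j f z = deriv (\<lambda>t. f (z + axis j t)) 0"

definition analytically_independent :: "('n \<Rightarrow> complex ^ 'n \<Rightarrow> complex) \<Rightarrow> bool" where
  "analytically_independent \<phi> \<longleftrightarrow>
     (\<exists>z. (\<forall>i. defined_at (\<phi> i) z) \<and> det (\<chi> i j. partial_deriv j (\<phi> i) z) \<noteq> 0)"

text \<open>
  Polynomials with variables from \<open>'x\<close>: finitely supported maps from exponent vectors to
  coefficients. The variables of an addition theorem stand for \<open>\<phi>\<^sub>k(u + v)\<close>, the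
  \<open>\<phi>\<^sub>i(u)\<close> and the \<open>\<phi>\<^sub>i(v)\<close>, which makes \<open>2n + 1\<close> of them.
\<close>

type_synonym 'x cpoly = "('x \<Rightarrow>\<^sub>0 nat) \<Rightarrow>\<^sub>0 complex"

definition cpoly_eval :: "'x cpoly \<Rightarrow> ('x \<Rightarrow> complex) \<Rightarrow> complex" where
  "cpoly_eval p a =
     (\<Sum>m\<in>Poly_Mapping.keys p. Poly_Mapping.lookup p m *
        (\<Prod>x\<in>Poly_Mapping.keys m. a x ^ Poly_Mapping.lookup m x))"

datatype 'n add_var = Var_Sum | Var_Fst 'n | Var_Snd 'n

end

theory Submission
  imports Defs "HOL-Complex_Analysis.Conformal_Mappings"
begin

text \<open>
  For a fixed \<open>k\<close>, the functions \<open>\<phi>\<^sub>k(u + v)\<close>, \<open>\<phi>\<^sub>i(u)\<close> and \<open>\<phi>\<^sub>i(v)\<close> of the pair \<open>(u, v)\<close> are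
  \<open>2n + 1\<close> meromorphic functions on the torus \<open>\<complex>\<^sup>2\<^sup>n / (\<Omega> \<times> \<Omega>)\<close>, whose complex dimension is \<open>2n\<close>. On a
  torus of dimension \<open>N\<close> any family of more than \<open>N\<close> meromorphic functions \<open>f\<^sub>i\<close> is algebraically
  dependent (\<open>algebraic_dependence\<close>), and a polynomial relation between these functions is the
  addition theorem.

  The dependence is proved by counting, in the manner of Siegel: a polynomial \<open>P\<close> of degree at most
  \<open>d\<close> in each variable has at least \<open>(d + 1)\<^sup>N\<^sup>+\<^sup>1\<close> coefficients, so they can be chosen, not all zero, with
  \<open>P(f)\<close> vanishing at the \<open>m\<^sup>N\<close> points of a grid around a regular point \<open>x\<close>, where \<open>m\<close> is large
  compared with \<open>d\<close>. Interpolation at roots of unity, one coordinate after the other, then shows that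
  \<open>|P(f)|\<close> near \<open>x\<close> is at most \<open>exp (- \<gamma> m)\<close> times its maximum over a polydisc about \<open>x\<close>
  (\<open>vanishing_on_grid_small\<close>). It remains to show that \<open>ln |P(f)|\<close> cannot vary that much.

  Siegel compares the local numerators of \<open>P(f)\<close> on overlapping neighbourhoods, which requires coprime
  numerators and denominators, hence unique factorisation of germs. Integral averages avoid this. Let
  \<open>h = ln\<^sup>+ (|P(f)| / \<delta>)\<close>. Near each point \<open>f\<^sub>i = p\<^sub>i / q\<^sub>i\<close> with \<open>|p\<^sub>i|, |q\<^sub>i| \<le> 1\<close>, and multiplying by
  \<open>\<Prod>\<^sub>i q\<^sub>i\<^sup>d\<close> makes \<open>P(f)\<close> holomorphic; so the mean value inequality for \<open>ln\<^sup>+ |F|\<close>, \<open>F\<close> holomorphic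
  (\<open>ln_norm_le_ball_integral\<close>), gives \<open>h \<le> A h + d \<kappa>\<close>, where \<open>A\<close> is the mean over a ball of small
  radius and \<open>\<kappa>\<close> is a sum of terms \<open>- ln |q\<^sub>i|\<close>, integrable over a fundamental domain
  (\<open>log_level_defect\<close>). Since \<open>A\<close> preserves the integral over the torus, the integral of \<open>|A h - h|\<close> is
  at most a constant times \<open>d\<close>. Hence \<open>A h\<close> is, up to \<open>O(d)\<close>, a harmonic function on the torus, and a
  Harnack chain shows that it oscillates by at most \<open>C d\<close>, with \<open>C\<close> independent of \<open>P\<close> and \<open>\<delta>\<close>
  (\<open>ball_mean_oscillation\<close>).

  For \<open>m\<close> large compared with \<open>d\<close> this contradicts the smallness near \<open>x\<close> unless \<open>P(f) = 0\<close> on a ball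
  about \<open>x\<close>. In that case \<open>A h = 0\<close> at \<open>x\<close> for every \<open>\<delta>\<close>, hence \<open>A h \<le> C d\<close> everywhere for every \<open>\<delta>\<close>,
  and letting \<open>\<delta>\<close> tend to \<open>0\<close> forces \<open>P(f) = 0\<close> wherever it is defined.
\<close>

section \<open>Lebesgue measure and rotations\<close>

lemma nn_integral_lborel_shift:
  fixes f :: "'a::euclidean_space \<Rightarrow> ennreal"
  assumes [measurable]: "f \<in> borel_measurable borel"
  shows "(\<integral>\<^sup>+x. f (a + x) \<partial>lborel) = (\<integral>\<^sup>+x. f x \<partial>lborel)"
proof -
  have "(\<integral>\<^sup>+x. f x \<partial>lborel) = (\<integral>\<^sup>+x. f x \<partial>(distr lborel borel ((+) a)))"
    by (simp add: lborel_distr_plus)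
  also have "\<dots> = (\<integral>\<^sup>+x. f (a + x) \<partial>lborel)"
    by (subst nn_integral_distr) auto
  finally show ?thesis by simp
qed

lemma emeasure_lborel_ball_pos: "0 < r \<Longrightarrow> 0 < emeasure lborel (ball (a::'a::euclidean_space) r)"
  by (simp add: emeasure_ball unit_ball_vol_pos ennreal_zero_less_mult_iff)

lemma emeasure_lborel_ball_finite: "emeasure lborel (ball (a::'a::euclidean_space) r) < \<infinity>"
  using bounded_ball emeasure_bounded_finite by blast

lemma emeasure_lborel_ball_center:
  "emeasure lborel (ball (a::'a::euclidean_space) r) = emeasure lborel (ball (b::'a) r)"
proof (cases "0 \<le> r")
  case True then show ?thesis by (simp add: emeasure_ball)
next
  case False
  then have "ball x r = {}" for x :: 'a by simp
  then show ?thesis by metis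
qed

text \<open>
  Integrate the indicator of the pairs \<open>(x, y)\<close> with \<open>y \<in> A\<close> and \<open>|y - R x| < 1\<close> in both orders. Doing
  \<open>x\<close> first gives the volume of \<open>A\<close> times that of the unit ball, because \<open>R\<close> preserves balls. Shifting
  \<open>y\<close> by \<open>R x\<close> beforehand gives the volume of the preimage of \<open>A\<close> times that of the unit ball.
\<close>

lemma distr_lborel_orthogonal_transformation:
  fixes R :: "'a::euclidean_space \<Rightarrow> 'a"
  assumes R: "orthogonal_transformation R"
  shows "distr lborel borel R = lborel"
proof -
  define B where "B = ball (0::'a) 1"
  have lin: "linear R" and nR: "\<And>v. norm (R v) = norm v"
    using R by (auto simp: orthogonal_transformation)
  have [measurable]: "R \<in> borel_measurable borel"
    using lin by (intro borel_measurable_continuous_onI linear_continuous_on)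
      (auto simp: linear_conv_bounded_linear)
  have surj: "surj R" using R by (rule orthogonal_transformation_surj)
  have [measurable]: "B \<in> sets borel" by (simp add: B_def)
  have Bpos: "emeasure lborel B \<noteq> 0" "emeasure lborel B \<noteq> \<infinity>"
    using emeasure_lborel_ball_pos[of 1 "0::'a"] emeasure_lborel_ball_finite[of "0::'a" 1]
    by (auto simp: B_def)
  show ?thesis
  proof (rule measure_eqI)
    fix A assume "A \<in> sets (distr lborel borel R)"
    then have [measurable]: "A \<in> sets borel" by simp
    let ?S = "\<integral>\<^sup>+x. \<integral>\<^sup>+y. indicator A y * indicator B (y - R x) \<partial>lborel \<partial>lborel"
    have "?S = (\<integral>\<^sup>+y. \<integral>\<^sup>+x. indicator A y * indicator B (y - R x) \<partial>lborel \<partial>lborel)"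
      by (rule lborel_pair.Fubini') measurable
    also have "\<dots> = (\<integral>\<^sup>+y. indicator A y * emeasure lborel B \<partial>lborel)"
    proof (rule nn_integral_cong)
      fix y
      obtain y' where y': "y = R y'" using surj by (metis surjD)
      have "B = ball 0 1" by (simp add: B_def)
      have "indicator B (y - R x) = (indicator (ball y' 1) x :: ennreal)" for x
        using nR[of "y' - x"]
        by (auto simp: B_def y' linear_diff[OF lin] indicator_def dist_norm norm_minus_commute)
      then have "(\<integral>\<^sup>+x. indicator A y * indicator B (y - R x) \<partial>lborel)
        = indicator A y * emeasure lborel (ball y' 1)"
        by simp (subst nn_integral_cmult_indicator, auto)
      then show "(\<integral>\<^sup>+x. indicator A y * indicator B (y - R x) \<partial>lborel)
        = indicator A y * emeasure lborel B"
        by (simp add: B_def emeasure_lborel_ball_center[of y' 1 0])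
    qed
    also have "\<dots> = emeasure lborel A * emeasure lborel B"
      by (subst nn_integral_multc) auto
    finally have S1: "?S = emeasure lborel A * emeasure lborel B" .
    have "?S = (\<integral>\<^sup>+x. \<integral>\<^sup>+y. indicator A (R x + y) * indicator B y \<partial>lborel \<partial>lborel)"
    proof (rule nn_integral_cong)
      fix x
      show "(\<integral>\<^sup>+y. indicator A y * indicator B (y - R x) \<partial>lborel)
        = (\<integral>\<^sup>+y. indicator A (R x + y) * indicator B y \<partial>lborel)"
        using nn_integral_lborel_shift[of "\<lambda>y. indicator A y * indicator B (y - R x)" "R x"] by simp
    qed
    also have "\<dots> = (\<integral>\<^sup>+y. \<integral>\<^sup>+x. indicator A (R x + y) * indicator B y \<partial>lborel \<partial>lborel)"
      by (rule lborel_pair.Fubini') measurable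
    also have "\<dots> = (\<integral>\<^sup>+y. emeasure (distr lborel borel R) A * indicator B y \<partial>lborel)"
    proof (rule nn_integral_cong)
      fix y
      obtain y' where y': "y = R y'" using surj by (metis surjD)
      have "(\<integral>\<^sup>+x. indicator A (R x + y) * indicator B y \<partial>lborel)
        = (\<integral>\<^sup>+x. indicator A (R x + y) \<partial>lborel) * indicator B y"
        by (rule nn_integral_multc) measurable
      also have "(\<integral>\<^sup>+x. indicator A (R x + y) \<partial>lborel) = (\<integral>\<^sup>+x. indicator A (R (y' + x)) \<partial>lborel)"
        by (simp add: y' linear_add[OF lin] add.commute)
      also have "\<dots> = (\<integral>\<^sup>+x. indicator A (R x) \<partial>lborel)"
        using nn_integral_lborel_shift[of "\<lambda>x. indicator A (R x)" y'] by simp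
      also have "\<dots> = (\<integral>\<^sup>+x. indicator A x \<partial>(distr lborel borel R))"
        by (subst nn_integral_distr) auto
      also have "\<dots> = emeasure (distr lborel borel R) A"
        by (subst nn_integral_indicator) auto
      finally show "(\<integral>\<^sup>+x. indicator A (R x + y) * indicator B y \<partial>lborel)
        = emeasure (distr lborel borel R) A * indicator B y" .
    qed
    also have "\<dots> = emeasure (distr lborel borel R) A * emeasure lborel B"
      by (subst nn_integral_cmult) auto
    finally have "emeasure (distr lborel borel R) A * emeasure lborel B
      = emeasure lborel A * emeasure lborel B" using S1 by simp
    then show "emeasure (distr lborel borel R) A = emeasure lborel A"
      using Bpos by (simp add: mult.commute[of _ "emeasure lborel B"] ennreal_mult_cancel_left)
  qed simp
qed

lemma norm_vector_scalar_mult: "norm (c *s (x::complex ^ 'n)) = norm c * norm x"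
  by (simp add: norm_vec_def L2_set_def norm_mult power_mult_distrib real_sqrt_mult
      flip: sum_distrib_left)

lemma linear_vector_scalar_mult: "linear (\<lambda>x::complex ^ 'n. c *s x)"
  by (intro linearI) (auto simp: vec_eq_iff algebra_simps)

lemma bounded_linear_scalar_mult_left: "bounded_linear (\<lambda>t::complex. t *s (w::complex ^ 'n))"
  unfolding linear_conv_bounded_linear[symmetric]
  by (intro linearI) (auto simp: vec_eq_iff algebra_simps)

text \<open>
  This symmetry turns means over circles in complex lines through a point into means over balls.
\<close>

lemma nn_integral_lborel_rotate:
  fixes f :: "complex ^ 'n \<Rightarrow> ennreal"
  assumes [measurable]: "f \<in> borel_measurable borel" and c: "norm c = 1"
  shows "(\<integral>\<^sup>+x. f (c *s x) \<partial>lborel) = (\<integral>\<^sup>+x. f x \<partial>lborel)"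
proof -
  have "orthogonal_transformation (\<lambda>x::complex ^ 'n. c *s x)"
    by (simp add: orthogonal_transformation linear_vector_scalar_mult norm_vector_scalar_mult c)
  then have *: "distr lborel borel (\<lambda>x::complex ^ 'n. c *s x) = lborel"
    by (rule distr_lborel_orthogonal_transformation)
  have [measurable]: "(\<lambda>x::complex ^ 'n. c *s x) \<in> borel_measurable borel"
    by (intro borel_measurable_continuous_onI linear_continuous_on)
      (use linear_vector_scalar_mult in \<open>auto simp: linear_conv_bounded_linear\<close>)
  have "(\<integral>\<^sup>+x. f x \<partial>lborel) = (\<integral>\<^sup>+x. f x \<partial>(distr lborel borel (\<lambda>x. c *s x)))"
    by (simp add: *)
  also have "\<dots> = (\<integral>\<^sup>+x. f (c *s x) \<partial>lborel)" by (subst nn_integral_distr) auto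
  finally show ?thesis by simp
qed

section \<open>Holomorphic functions of several variables\<close>

lemma holo_on_subset: "holo_on f U \<Longrightarrow> V \<subseteq> U \<Longrightarrow> holo_on f V"
  by (auto simp: holo_on_def)

lemma holo_on_continuous_on: "holo_on f U \<Longrightarrow> continuous_on U f"
  unfolding holo_on_def
  by (metis continuous_at_imp_continuous_on has_derivative_continuous)

lemma holo_on_const: "holo_on (\<lambda>z. c) U"
  unfolding holo_on_def by (auto intro!: exI[of _ "\<lambda>_. 0"])

lemma holo_on_add: "holo_on f U \<Longrightarrow> holo_on g U \<Longrightarrow> holo_on (\<lambda>z. f z + g z) U"
  unfolding holo_on_def
proof
  fix z assume f: "\<forall>z\<in>U. \<exists>D. (f has_derivative D) (at z) \<and> (\<forall>c x. D (c *s x) = c * D x)"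
    and g: "\<forall>z\<in>U. \<exists>D. (g has_derivative D) (at z) \<and> (\<forall>c x. D (c *s x) = c * D x)" and z: "z \<in> U"
  obtain D where D: "(f has_derivative D) (at z)" "\<forall>c x. D (c *s x) = c * D x" using f z by blast
  obtain E where E: "(g has_derivative E) (at z)" "\<forall>c x. E (c *s x) = c * E x" using g z by blast
  show "\<exists>D. ((\<lambda>z. f z + g z) has_derivative D) (at z) \<and> (\<forall>c x. D (c *s x) = c * D x)"
    by (rule exI[of _ "\<lambda>x. D x + E x"])
      (auto intro!: has_derivative_add D E simp: D(2) E(2) algebra_simps)
qed

lemma holo_on_mult: "holo_on f U \<Longrightarrow> holo_on g U \<Longrightarrow> holo_on (\<lambda>z. f z * g z) U"
  unfolding holo_on_def
proof
  fix z assume f: "\<forall>z\<in>U. \<exists>D. (f has_derivative D) (at z) \<and> (\<forall>c x. D (c *s x) = c * D x)"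
    and g: "\<forall>z\<in>U. \<exists>D. (g has_derivative D) (at z) \<and> (\<forall>c x. D (c *s x) = c * D x)" and z: "z \<in> U"
  obtain D where D: "(f has_derivative D) (at z)" "\<forall>c x. D (c *s x) = c * D x" using f z by blast
  obtain E where E: "(g has_derivative E) (at z)" "\<forall>c x. E (c *s x) = c * E x" using g z by blast
  show "\<exists>D. ((\<lambda>z. f z * g z) has_derivative D) (at z) \<and> (\<forall>c x. D (c *s x) = c * D x)"
    by (rule exI[of _ "\<lambda>x. f z * E x + D x * g z"], intro conjI)
      (rule has_derivative_mult[OF D(1) E(1)], simp add: D(2) E(2) algebra_simps)
qed

lemma holo_on_power: "holo_on f U \<Longrightarrow> holo_on (\<lambda>z. f z ^ k) U"
  by (induction k) (auto intro: holo_on_const holo_on_mult)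

lemma holo_on_sum: "(\<And>i. i \<in> I \<Longrightarrow> holo_on (f i) U) \<Longrightarrow> holo_on (\<lambda>z. \<Sum>i\<in>I. f i z) U"
  by (induction I rule: infinite_finite_induct) (auto intro: holo_on_const holo_on_add)

lemma holo_on_prod: "(\<And>i. i \<in> I \<Longrightarrow> holo_on (f i) U) \<Longrightarrow> holo_on (\<lambda>z. \<Prod>i\<in>I. f i z) U"
  by (induction I rule: infinite_finite_induct) (auto intro: holo_on_const holo_on_mult)

lemma holo_on_compose_affine:
  fixes L :: "complex ^ 'm \<Rightarrow> complex ^ 'n"
  assumes f: "holo_on f U" and L: "linear L" "\<And>c x. L (c *s x) = c *s L x"
  shows "holo_on (\<lambda>z. f (a + L z)) {z. a + L z \<in> U}"
  unfolding holo_on_def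
proof
  fix z assume "z \<in> {z. a + L z \<in> U}"
  then obtain D where D: "(f has_derivative D) (at (a + L z))" "\<forall>c x. D (c *s x) = c * D x"
    using f unfolding holo_on_def by blast
  have "((\<lambda>z. a + L z) has_derivative L) (at z)"
    using L(1) linear_conv_bounded_linear
    by (auto intro!: derivative_eq_intros bounded_linear_imp_has_derivative)
  from diff_chain_at[OF this D(1)]
  show "\<exists>D. ((\<lambda>z. f (a + L z)) has_derivative D) (at z) \<and> (\<forall>c x. D (c *s x) = c * D x)"
    by (intro exI[of _ "D \<circ> L"]) (auto simp: o_def L(2) D(2))
qed

text \<open>
  Continuity and the restrictions to complex lines are all that the estimates below use of a
  holomorphic function, so that the theory of one variable suffices.
\<close>

lemma holo_on_line:
  assumes f: "holo_on f U"
  shows "(\<lambda>t. f (z + t *s w)) holomorphic_on {t. z + t *s w \<in> U}"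
  unfolding holomorphic_on_def
proof
  fix t assume "t \<in> {t. z + t *s w \<in> U}"
  then obtain D where D: "(f has_derivative D) (at (z + t *s w))" "\<forall>c x. D (c *s x) = c * D x"
    using f unfolding holo_on_def by blast
  have "((\<lambda>t. z + t *s w) has_derivative (\<lambda>t. t *s w)) (at t)"
    using bounded_linear_scalar_mult_left
    by (auto intro!: derivative_eq_intros bounded_linear_imp_has_derivative)
  from diff_chain_at[OF this D(1)]
  have "((\<lambda>t. f (z + t *s w)) has_derivative (*) (D w)) (at t)"
    unfolding o_def D(2)[rule_format] mult.commute[of _ "D w"] .
  then have "((\<lambda>t. f (z + t *s w)) has_field_derivative D w) (at t)"
    by (simp add: has_field_derivative_def)
  then show "(\<lambda>t. f (z + t *s w)) field_differentiable at t within {t. z + t *s w \<in> U}"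
    using field_differentiable_at_within field_differentiable_def by blast
qed

section \<open>The mean value inequality for the logarithm of a modulus\<close>

text \<open>
  Holomorphic functions are given on open sets only, hence the indicator.
\<close>

lemma borel_measurable_compose_continuous_on:
  fixes q :: "'a::euclidean_space \<Rightarrow> complex" and h :: "complex \<Rightarrow> ennreal"
  assumes B: "B \<in> sets borel" and q: "continuous_on B q" and h[measurable]: "h \<in> borel_measurable borel"
  shows "(\<lambda>w. h (q w) * indicator B w) \<in> borel_measurable borel"
proof -
  have [measurable]: "(\<lambda>w. indicator B w *\<^sub>R q w) \<in> borel_measurable borel"
    using borel_measurable_continuous_on_indicator[OF B q] by simp
  have "(\<lambda>w. h (q w) * indicator B w) = (\<lambda>w. h (indicator B w *\<^sub>R q w) * indicator B w)"
    by (auto simp: fun_eq_iff indicator_def)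
  also have "\<dots> \<in> borel_measurable borel" using B by measurable
  finally show ?thesis .
qed

text \<open>
  A discrete form of Jensen's inequality: the product over the \<open>k\<close> rotated copies of \<open>f\<close> plays the role
  of the exponential of \<open>k\<close> times the mean of \<open>ln |f|\<close> over the unit circle. It is holomorphic, so its
  maximum over the circle dominates its value at \<open>0\<close>; and it is invariant under rotation by \<open>2\<pi>/k\<close>, so
  the maximum is attained at a point \<open>cis \<alpha>\<close> with \<open>\<alpha> \<le> 2\<pi>/k\<close>, which is close to \<open>1\<close> for large \<open>k\<close>.
\<close>

lemma maximum_modulus_rotations:
  assumes f: "f holomorphic_on S" "open S" "cball 0 1 \<subseteq> S" and k: "0 < k"
  obtains \<alpha> where "0 \<le> \<alpha>" "\<alpha> \<le> 2 * pi / k"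
    "norm (f 0) ^ k \<le> (\<Prod>j<k. norm (f (cis (2 * pi * real j / real k) * cis \<alpha>)))"
proof -
  define \<omega> where "\<omega> = cis (2 * pi / k)"
  define \<Phi> where "\<Phi> z = (\<Prod>j<k. f (\<omega> ^ j * z))" for z
  have \<omega>k: "\<omega> ^ k = 1" 
  proof -
    have "\<omega> ^ k = cis (real k * (2 * pi / real k))" by (simp only: \<omega>_def Complex.DeMoivre)
    also have "real k * (2 * pi / real k) = 2 * pi" using k by simp
    finally show ?thesis by simp
  qed
  have n\<omega>: "norm \<omega> = 1" by (simp add: \<omega>_def)
  have \<omega>j: "\<omega> ^ j = cis (2 * pi * real j / real k)" for j
    by (simp add: \<omega>_def Complex.DeMoivre algebra_simps)
  have hol: "\<Phi> holomorphic_on cball 0 1"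
    unfolding \<Phi>_def
  proof (rule holomorphic_on_prod)
    fix j
    have "f holomorphic_on cball 0 1" using f holomorphic_on_subset by blast
    moreover have "(\<lambda>z. \<omega> ^ j * z) ` cball 0 1 \<subseteq> cball 0 1"
      using n\<omega> by (auto simp: norm_mult norm_power)
    ultimately have "(f \<circ> (\<lambda>z. \<omega> ^ j * z)) holomorphic_on cball 0 1"
      by (intro holomorphic_on_compose_gen[of _ _ f "cball 0 1"] holomorphic_intros)
    then show "(\<lambda>z. f (\<omega> ^ j * z)) holomorphic_on cball 0 1" by (simp add: o_def)
  qed
  have shift: "\<Phi> (\<omega> * z) = \<Phi> z" for z
  proof -
    obtain k' where k': "k = Suc k'" using k by (cases k) auto
    have "\<Phi> (\<omega> * z) = (\<Prod>j<k'. f (\<omega> ^ Suc j * z)) * f (\<omega> ^ k * z)"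
      by (simp add: \<Phi>_def k' mult_ac)
    also have "\<dots> = \<Phi> z"
      unfolding \<omega>k unfolding \<Phi>_def k' prod.lessThan_Suc_shift by (simp add: mult_ac)
    finally show ?thesis .
  qed
  have shiftn: "\<Phi> (\<omega> ^ n * z) = \<Phi> z" for n z
    by (induction n) (auto simp: shift mult.assoc)
  have "\<exists>z\<in>frontier (ball 0 1). norm (\<Phi> 0) \<le> norm (\<Phi> z)"
  proof (rule ccontr)
    assume neg: "\<not> ?thesis"
    have cont: "continuous_on (sphere 0 1) (\<lambda>z. norm (\<Phi> z))"
      using hol holomorphic_on_imp_continuous_on
      by (intro continuous_intros) (meson continuous_on_subset sphere_cball)
    obtain m where m: "m \<in> sphere 0 1" "\<And>z. z \<in> sphere 0 1 \<Longrightarrow> norm (\<Phi> z) \<le> norm (\<Phi> m)"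
      using continuous_attains_sup[OF _ _ cont] by auto
    have "norm (\<Phi> 0) \<le> norm (\<Phi> m)"
    proof (rule maximum_modulus_frontier[of \<Phi> "ball 0 1"])
      show "\<Phi> holomorphic_on interior (ball 0 1)"
        using hol holomorphic_on_subset[of \<Phi> "cball 0 1" "ball 0 1"] by auto
      show "continuous_on (closure (ball 0 1)) \<Phi>"
        using hol holomorphic_on_imp_continuous_on by simp
    qed (use m in auto)
    then show False using neg m by auto
  qed
  then obtain z where z: "norm z = 1" "norm (\<Phi> 0) \<le> norm (\<Phi> z)" by auto
  obtain \<theta> where \<theta>: "z = cis \<theta>" "0 \<le> \<theta>" "\<theta> < 2 * pi"
    using z(1) by (metis Arg2pi_eq Arg2pi_ge_0 Arg2pi_lt_2pi cis_conv_exp mult_1 of_real_1)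
  define n where "n = nat \<lfloor>\<theta> * k / (2 * pi)\<rfloor>"
  define \<alpha> where "\<alpha> = \<theta> - 2 * pi * n / k"
  have n: "real n \<le> \<theta> * k / (2 * pi)" "\<theta> * k / (2 * pi) < real n + 1"
    using \<theta> k by (auto simp: n_def)
  have a1: "0 \<le> \<alpha>" using n(1) k by (auto simp: \<alpha>_def field_simps)
  have "\<alpha> = 2 * pi / k * (\<theta> * k / (2 * pi) - n)" using k by (simp add: \<alpha>_def field_simps)
  also have "\<dots> \<le> 2 * pi / k * 1" using n(2) by (intro mult_left_mono) auto
  finally have a2: "\<alpha> \<le> 2 * pi / k" by simp
  have "z = \<omega> ^ n * cis \<alpha>" by (simp add: \<omega>j \<theta> cis_mult \<alpha>_def)
  then have "norm (\<Phi> 0) \<le> norm (\<Phi> (cis \<alpha>))" using z(2) shiftn by simp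
  moreover have "norm (\<Phi> 0) = norm (f 0) ^ k" by (simp add: \<Phi>_def norm_power)
  ultimately show ?thesis
    using a1 a2 by (intro that[of \<alpha>]) (auto simp: \<Phi>_def prod_norm[symmetric] \<omega>j)
qed

lemma ennreal_ln_max_1: "ennreal (ln (max 1 x)) = ennreal (ln x)" if "0 \<le> x"
proof (cases "x \<le> 1")
  case True
  then have "ln x \<le> 0" using that by (cases "x = 0") auto
  then show ?thesis using True by (simp add: ennreal_neg max_def)
qed (simp add: max_def)

lemma norm_cis_minus_1_le: "norm (cis a - 1) \<le> \<bar>a\<bar>"
proof -
  have "cos a = 1 - 2 * (sin (a/2))\<^sup>2" using cos_double_sin[of "a/2"] by simp
  moreover have "(norm (cis a - 1))\<^sup>2 = 2 - 2 * cos a"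
  proof -
    have "(norm (cis a - 1))\<^sup>2 = (cos a - 1)\<^sup>2 + (sin a)\<^sup>2" by (simp add: cmod_power2)
    also have "\<dots> = ((sin a)\<^sup>2 + (cos a)\<^sup>2) + 1 - 2 * cos a"
      unfolding power2_diff by simp
    finally show ?thesis unfolding sin_cos_squared_add by simp
  qed
  ultimately have "(norm (cis a - 1))\<^sup>2 = (2 * \<bar>sin (a/2)\<bar>)\<^sup>2" by (simp add: power_mult_distrib)
  then have "norm (cis a - 1) = 2 * \<bar>sin (a/2)\<bar>"
    by (subst (asm) power2_eq_iff_nonneg) auto
  also have "\<dots> \<le> \<bar>a\<bar>" using abs_sin_x_le_abs_x[of "a/2"] by simp
  finally show ?thesis .
qed

text \<open>
  Truncation at \<open>0\<close> by \<^const>\<open>ennreal\<close> makes the integrand \<open>ln\<^sup>+ |F|\<close>, a continuous function. The integral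
  over the ball equals that of the mean of the integrand over \<open>k\<close> rotations about \<open>z\<close>. By the preceding
  lemma, applied on the complex line through \<open>z\<close> and \<open>w\<close>, this mean is at least \<open>ln |F z|\<close>, up to the
  error of a rotation by at most \<open>2\<pi>/k\<close>, which tends to \<open>0\<close> by uniform continuity.
\<close>

lemma ln_norm_le_ball_integral:
  fixes F :: "complex ^ 'n \<Rightarrow> complex"
  assumes F: "holo_on F U" "open U" "cball z r \<subseteq> U" and nz: "F z \<noteq> 0"
  shows "ennreal (ln (norm (F z))) * emeasure lborel (ball z r)
    \<le> (\<integral>\<^sup>+w\<in>ball z r. ennreal (ln (norm (F w))) \<partial>lborel)"
proof (cases "0 < r")
  case False
  then have empty: "ball z r = {}" by simp
  show ?thesis unfolding empty by simp
next
  case r: True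
  define u where "u w = ln (max 1 (norm (F (z + w))))" for w
  define L where "L = ln (norm (F z))"
  define g where "g w = ennreal (u w) * indicator (ball 0 r) w" for w
  have contF: "continuous_on (cball 0 r) (\<lambda>w. F (z + w))"
    by (intro continuous_on_compose2[OF holo_on_continuous_on[OF F(1)]] continuous_intros)
      (use F(3) in \<open>auto simp: dist_norm subset_iff\<close>)
  have contu: "continuous_on (cball 0 r) u"
    unfolding u_def
    by (intro continuous_on_ln continuous_on_max continuous_intros contF) (auto simp: max_def)
  have g_eq: "g w = ennreal (ln (norm (F (z + w)))) * indicator (ball z r) (z + w)" for w
    by (auto simp: g_def u_def ennreal_ln_max_1 indicator_def dist_norm)
  have [measurable]: "g \<in> borel_measurable borel"
  proof -
    have "continuous_on (ball 0 r) (\<lambda>w. F (z + w))" using contF continuous_on_subset ball_subset_cball by blast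
    from borel_measurable_compose_continuous_on[OF _ this, of "\<lambda>x. ennreal (ln (norm x))"]
    have "(\<lambda>w. ennreal (ln (norm (F (z + w)))) * indicator (ball 0 r) w) \<in> borel_measurable borel" by simp
    moreover have "(\<lambda>w. ennreal (ln (norm (F (z + w)))) * indicator (ball 0 r) w) = g"
      by (auto simp: g_eq indicator_def dist_norm)
    ultimately show ?thesis by simp
  qed
  have "(\<lambda>w. g (-z + w)) \<in> borel_measurable borel" by measurable
  then have int_g: "(\<integral>\<^sup>+w. g w \<partial>lborel) = (\<integral>\<^sup>+w\<in>ball z r. ennreal (ln (norm (F w))) \<partial>lborel)"
    using nn_integral_lborel_shift[of "\<lambda>w. g (-z + w)" z] by (simp add: g_eq)
  define V where "V = measure lborel (ball (0::complex ^ 'n) r)"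
  have V: "emeasure lborel (ball (0::complex ^ 'n) r) = ennreal V"
    using emeasure_lborel_ball_finite[of "0::complex ^ 'n" r]
    by (simp add: V_def emeasure_eq_ennreal_measure)
  have "0 < V" using emeasure_lborel_ball_pos[OF r, of "0::complex ^ 'n"] V by simp
  have approx: "ennreal (L - e) * ennreal V \<le> (\<integral>\<^sup>+w. g w \<partial>lborel)" if e: "0 < e" for e
  proof -
    have "uniformly_continuous_on (cball 0 r) u"
      by (rule compact_uniformly_continuous[OF contu compact_cball])
    then obtain d where d: "0 < d" "\<And>w w'. w \<in> cball 0 r \<Longrightarrow> w' \<in> cball 0 r \<Longrightarrow> dist w w' < d \<Longrightarrow> dist (u w) (u w') < e"
      unfolding uniformly_continuous_on_def using e by metis
    \<comment> \<open>With this many rotations, a further turn by at most \<open>2\<pi>/k\<close> changes \<open>u\<close> by less than \<open>e\<close>.\<close>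
    obtain k :: nat where k: "2 * pi * r / d < real k" using reals_Archimedean2 by blast
    have "0 < 2 * pi * r / d" using r d(1) by simp
    then have k0: "0 < k" using k by (cases k) auto
    define \<omega> where "\<omega> j = cis (2 * pi * real j / real k)" for j
    have n\<omega>: "norm (\<omega> j) = 1" for j by (simp add: \<omega>_def)
    have main: "real k * (L - e) \<le> (\<Sum>j<k. u (\<omega> j *s w))" if w: "w \<in> ball 0 r" for w
    proof -
      define f where "f t = F (z + t *s w)" for t
      define S where "S = {t. z + t *s w \<in> U}"
      have "open S"
      proof -
        have "continuous_on UNIV (\<lambda>t. z + t *s w)"
          using bounded_linear_scalar_mult_left by (intro continuous_intros linear_continuous_on)
        then show ?thesis using open_vimage[OF F(2)] by (auto simp: S_def vimage_def)
      qed
      moreover have "f holomorphic_on S" unfolding f_def S_def by (rule holo_on_line[OF F(1)])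
      moreover have "cball 0 1 \<subseteq> S"
      proof
        fix t :: complex assume "t \<in> cball 0 1"
        then have "norm t * norm w \<le> 1 * r" using w by (intro mult_mono) auto
        then show "t \<in> S" using F(3) by (auto simp: S_def dist_norm norm_vector_scalar_mult subset_iff)
      qed
      ultimately obtain \<alpha> where \<alpha>: "0 \<le> \<alpha>" "\<alpha> \<le> 2 * pi / k"
        "norm (f 0) ^ k \<le> (\<Prod>j<k. norm (f (\<omega> j * cis \<alpha>)))"
        using maximum_modulus_rotations[of f S k] k0 unfolding \<omega>_def by metis
      have f0: "f 0 = F z" by (simp add: f_def)
      have pos: "0 < (\<Prod>j<k. norm (f (\<omega> j * cis \<alpha>)))"
        using \<alpha>(3) nz f0 by (smt (verit) zero_less_norm_iff zero_less_power)
      have nzj: "f (\<omega> j * cis \<alpha>) \<noteq> 0" if "j < k" for j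
        using pos that by (metis finite_lessThan lessThan_iff norm_zero order_less_irrefl prod_zero_iff)
      have "real k * L = ln (norm (f 0) ^ k)" using nz by (simp add: L_def f0 ln_realpow)
      also have "\<dots> \<le> ln (\<Prod>j<k. norm (f (\<omega> j * cis \<alpha>)))"
        using \<alpha>(3) nz f0 by (subst ln_le_cancel_iff) (use pos in auto)
      also have "\<dots> = (\<Sum>j<k. ln (norm (f (\<omega> j * cis \<alpha>))))"
        using nzj by (subst ln_prod) auto
      also have "\<dots> \<le> (\<Sum>j<k. u (\<omega> j *s w) + e)"
      proof (rule sum_mono)
        fix j assume j: "j \<in> {..<k}"
        have "ln (norm (f (\<omega> j * cis \<alpha>))) \<le> u ((\<omega> j * cis \<alpha>) *s w)"
          using nzj j by (auto simp: u_def f_def intro!: ln_mono)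
        also have "\<dots> \<le> u (\<omega> j *s w) + e"
        proof -
          have "(\<omega> j * cis \<alpha>) *s w - \<omega> j *s w = (\<omega> j * (cis \<alpha> - 1)) *s w"
            by (simp add: vec_eq_iff algebra_simps)
          then have "dist ((\<omega> j * cis \<alpha>) *s w) (\<omega> j *s w) = norm (cis \<alpha> - 1) * norm w"
            by (simp add: dist_norm norm_vector_scalar_mult norm_mult n\<omega>)
          also have "\<dots> \<le> (2 * pi / k) * r"
            using norm_cis_minus_1_le[of \<alpha>] \<alpha> w by (intro mult_mono) auto
          also have "\<dots> < d" using k k0 d(1) by (simp add: field_simps)
          finally show ?thesis
            using d(2)[of "(\<omega> j * cis \<alpha>) *s w" "\<omega> j *s w"] w
            by (auto simp: norm_vector_scalar_mult norm_mult n\<omega> dist_real_def)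
        qed
        finally show "ln (norm (f (\<omega> j * cis \<alpha>))) \<le> u (\<omega> j *s w) + e" .
      qed
      finally show ?thesis by (simp add: sum.distrib algebra_simps)
    qed
    have "ennreal (real k) * (ennreal (L - e) * ennreal V)
        = (\<integral>\<^sup>+w. ennreal (real k * (L - e)) * indicator (ball (0::complex ^ 'n) r) w \<partial>lborel)"
      by (subst nn_integral_cmult_indicator) (auto simp: V ennreal_mult' mult_ac)
    also have "\<dots> \<le> (\<integral>\<^sup>+w. (\<Sum>j<k. g (\<omega> j *s w)) \<partial>lborel)"
    proof (rule nn_integral_mono)
      fix w :: "complex ^ 'n"
      show "ennreal (real k * (L - e)) * indicator (ball 0 r) w \<le> (\<Sum>j<k. g (\<omega> j *s w))"
      proof (cases "w \<in> ball 0 r")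
        case True
        have "u w \<ge> 0" for w by (simp add: u_def)
        then have "(\<Sum>j<k. g (\<omega> j *s w)) = ennreal (\<Sum>j<k. u (\<omega> j *s w))"
          using True by (simp add: g_def norm_vector_scalar_mult n\<omega> sum_ennreal)
        then show ?thesis using True main[OF True] by (simp add: ennreal_leI)
      qed simp
    qed
    also have "\<dots> = (\<Sum>j<k. \<integral>\<^sup>+w. g (\<omega> j *s w) \<partial>lborel)"
    proof (rule nn_integral_sum)
      fix j
      have "(\<lambda>x::complex ^ 'n. \<omega> j *s x) \<in> borel_measurable borel"
        by (intro borel_measurable_continuous_onI linear_continuous_on)
          (use linear_vector_scalar_mult in \<open>auto simp: linear_conv_bounded_linear\<close>)
      then show "(\<lambda>w. g (\<omega> j *s w)) \<in> borel_measurable lborel" by measurable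
    qed
    also have "\<dots> = ennreal (real k) * (\<integral>\<^sup>+w. g w \<partial>lborel)"
      by (simp add: nn_integral_lborel_rotate n\<omega> ennreal_of_nat_eq_real_of_nat)
    finally show ?thesis
      using k0 by (subst (asm) ennreal_mult_le_mult_iff) auto
  qed
  have "ennreal L * ennreal V \<le> (\<integral>\<^sup>+w. g w \<partial>lborel)"
  proof (rule ennreal_le_epsilon)
    fix e :: real assume e: "0 < e"
    have "ennreal L \<le> ennreal (L - e / V) + ennreal (e / V)"
      using \<open>0 < V\<close> e by (cases "0 \<le> L - e / V") (auto simp: ennreal_neg ennreal_leI simp flip: ennreal_plus)
    then have "ennreal L * ennreal V \<le> (ennreal (L - e / V) + ennreal (e / V)) * ennreal V"
      by (rule mult_right_mono) simp
    also have "\<dots> = ennreal (L - e / V) * ennreal V + ennreal e"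
      using \<open>0 < V\<close> e by (simp add: distrib_right flip: ennreal_mult)
    also have "\<dots> \<le> (\<integral>\<^sup>+w. g w \<partial>lborel) + ennreal e"
      using approx[of "e / V"] e \<open>0 < V\<close> by (intro add_right_mono) auto
    finally show "ennreal L * ennreal V \<le> (\<integral>\<^sup>+w. g w \<partial>lborel) + ennreal e" .
  qed
  then show ?thesis by (simp add: int_g L_def V[symmetric] emeasure_lborel_ball_center[of z r 0])
qed

section \<open>Denominators: zeros and integrability of the logarithm\<close>

text \<open>
  The identity theorem: the set of points near which \<open>q\<close> vanishes identically is open, and it is closed
  in \<open>U\<close> because vanishing on a small ball propagates along complex lines to every ball about the same
  centre that is contained in \<open>U\<close>.
\<close>

lemma holo_on_nonzero_near:
  fixes q :: "complex ^ 'n \<Rightarrow> complex"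
  assumes q: "holo_on q U" "open U" "connected U" and w: "w \<in> U" "q w \<noteq> 0"
    and a: "a \<in> U" "a \<in> V" "open V"
  shows "\<exists>w\<in>V \<inter> U. q w \<noteq> 0"
proof (rule ccontr)
  assume neg: "\<not> ?thesis"
  define E where "E = {z. \<exists>e>0. ball z e \<subseteq> U \<and> (\<forall>w\<in>ball z e. q w = 0)}"
  have "open (V \<inter> U)" "a \<in> V \<inter> U" using a q(2) by auto
  then have "a \<in> E" using neg unfolding E_def open_contains_ball by blast
  have EU: "E \<subseteq> U" unfolding E_def by (auto dest: subsetD[of "ball _ _" U])
  have "open E"
    unfolding open_contains_ball
  proof
    fix z assume "z \<in> E"
    then obtain e where e: "e > 0" "ball z e \<subseteq> U" "\<forall>w\<in>ball z e. q w = 0" unfolding E_def by blast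
    have "ball z e \<subseteq> E"
    proof
      fix y assume "y \<in> ball z e"
      then obtain e' where "e' > 0" "ball y e' \<subseteq> ball z e" using open_ball open_contains_ball by metis
      then show "y \<in> E" using e unfolding E_def by blast
    qed
    then show "\<exists>e>0. ball z e \<subseteq> E" using e by blast
  qed
  have "open (U - E)"
    unfolding open_contains_ball
  proof
    fix z assume z: "z \<in> U - E"
    then obtain r where r: "r > 0" "ball z r \<subseteq> U" using q(2) open_contains_ball by blast
    have "y \<notin> E" if y: "y \<in> ball z (r/3)" for y
    proof
      assume "y \<in> E"
      then obtain e where e: "e > 0" "\<forall>w\<in>ball y e. q w = 0" unfolding E_def by blast
      have sub: "ball y (2*r/3) \<subseteq> U"
      proof
        fix x assume "x \<in> ball y (2*r/3)"
        then have "dist z x < r" using y dist_triangle[of z x y] by simp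
        then show "x \<in> U" using r by auto
      qed
      have zero: "q x = 0" if x: "x \<in> ball y (2*r/3)" for x
      proof (cases "x = y")
        case True then show ?thesis using e by simp
      next
        case False
        define R where "R = (2*r/3) / norm (x - y)"
        have n: "norm (x - y) > 0" using False by simp
        have R: "R > 1" using x n by (simp add: R_def dist_norm norm_minus_commute field_simps)
        have on_line: "dist y (y + t *s (x - y)) = norm t * norm (x - y)" for t
          by (metis add_diff_cancel_left' dist_commute dist_norm norm_vector_scalar_mult)
        have hol: "(\<lambda>t. q (y + t *s (x - y))) holomorphic_on ball 0 R"
        proof (rule holomorphic_on_subset[OF holo_on_line[OF q(1)]])
          show "ball 0 R \<subseteq> {t. y + t *s (x - y) \<in> U}"
          proof
            fix t :: complex assume "t \<in> ball 0 R"
            then have "norm t * norm (x - y) < 2*r/3" using n by (simp add: R_def field_simps)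
            then have "y + t *s (x - y) \<in> ball y (2*r/3)" by (simp only: mem_ball on_line)
            then show "t \<in> {t. y + t *s (x - y) \<in> U}" using sub by auto
          qed
        qed
        have "(\<lambda>t. q (y + t *s (x - y))) 1 = (\<lambda>t. 0) 1"
        proof (rule analytic_continuation_open[of "ball 0 (min R (e / norm (x - y)))" "ball 0 R"
              "\<lambda>t. q (y + t *s (x - y))" "\<lambda>t. 0"])
          show "ball 0 (min R (e / norm (x - y))) \<noteq> {}"
            unfolding ball_eq_empty not_le min_less_iff_conj using R e(1) n by (intro conjI divide_pos_pos) auto
          fix t :: complex assume "t \<in> ball 0 (min R (e / norm (x - y)))"
          then have "norm t * norm (x - y) < e" using n by (simp add: field_simps)
          then have "y + t *s (x - y) \<in> ball y e" by (simp only: mem_ball on_line)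
          then show "q (y + t *s (x - y)) = 0" using e by blast
        qed (use R hol in auto)
        then show ?thesis by simp
      qed
      have "ball z (r/3) \<subseteq> ball y (2*r/3)"
      proof
        fix x assume "x \<in> ball z (r/3)"
        then show "x \<in> ball y (2*r/3)" using y dist_triangle[of y x z] by (simp add: dist_commute)
      qed
      then have "z \<in> E" using zero sub r(1) unfolding E_def by (auto intro!: exI[of _ "r/3"])
      then show False using z by simp
    qed
    then have "ball z (r/3) \<subseteq> U - E" using r by (auto simp: subset_iff)
    then show "\<exists>e>0. ball z e \<subseteq> U - E" using r(1) by (intro exI[of _ "r/3"]) auto
  qed
  have "w \<notin> E" using w unfolding E_def by auto
  have "E \<inter> U = {} \<or> (U - E) \<inter> U = {}"
    by (rule connectedD[OF q(3) \<open>open E\<close> \<open>open (U - E)\<close>]) auto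
  then show False using \<open>a \<in> E\<close> \<open>w \<notin> E\<close> w(1) EU by blast
qed

text \<open>
  The value at \<open>0\<close> matters: where \<open>ennreal (- ln (norm x))\<close> would be \<open>0\<close>, since \<open>ln 0 = 0\<close>, the pole of
  the logarithm has to be infinite, so that finiteness of an integral excludes the zeros of a
  denominator almost everywhere.
\<close>

definition neglog :: "complex \<Rightarrow> ennreal" where
  "neglog x = (if x = 0 then \<infinity> else ennreal (- ln (norm x)))"

lemma neglog_measurable [measurable]: "neglog \<in> borel_measurable borel"
  unfolding neglog_def by measurable

text \<open>
  Since \<open>|q| \<le> 1\<close>, the truncation of \<open>- ln |q|\<close> at height \<open>ln N\<close> is \<open>ln N - ln\<^sup>+ |N q|\<close>. The mean value
  inequality for \<open>N q\<close> at \<open>c\<close> bounds its integral by the volume times \<open>- ln |q c|\<close>, for every large \<open>N\<close>,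
  and monotone convergence removes the truncation.
\<close>

lemma neglog_ball_integral_finite:
  fixes q :: "complex ^ 'n \<Rightarrow> complex"
  assumes q: "holo_on q U" "open U" "cball c r \<subseteq> U" and r: "0 < r"
    and le1: "\<And>w. w \<in> ball c r \<Longrightarrow> norm (q w) \<le> 1" and nz: "q c \<noteq> 0"
  shows "(\<integral>\<^sup>+w\<in>ball c r. neglog (q w) \<partial>lborel) < \<infinity>"
proof -
  define V where "V = measure lborel (ball c r)"
  have V: "emeasure lborel (ball c r) = ennreal V"
    using emeasure_lborel_ball_finite[of c r] by (simp add: V_def emeasure_eq_ennreal_measure)
  have "0 < V" using emeasure_lborel_ball_pos[OF r, of c] V by simp
  have cont: "continuous_on (ball c r) q"
    using holo_on_continuous_on[OF q(1)] q(3) continuous_on_subset by (meson ball_subset_cball)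
  have meas: "(\<lambda>w. h (q w) * indicator (ball c r) w) \<in> borel_measurable borel"
    if "h \<in> borel_measurable borel" for h :: "complex \<Rightarrow> ennreal"
    by (rule borel_measurable_compose_continuous_on) (use cont that in auto)
  define m where "m n w = min (neglog (q w)) (ennreal (ln (real (Suc n)))) * indicator (ball c r) w" for n w
  have [measurable]: "m n \<in> borel_measurable borel" for n
    unfolding m_def by (rule meas) measurable
  define B where "B = ennreal V * ennreal (- ln (norm (q c)))"
  have bound: "(\<integral>\<^sup>+w. m n w \<partial>lborel) \<le> B" if n: "1 \<le> norm (q c) * real (Suc n)" for n
  proof -
    define N where "N = real (Suc n)"
    have N: "N \<ge> 1" by (simp add: N_def)
    define l where "l w = ennreal (ln (norm (of_real N * q w))) * indicator (ball c r) w" for w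
    have [measurable]: "l \<in> borel_measurable borel" unfolding l_def by (rule meas) measurable
    have "holo_on (\<lambda>w. of_real N * q w) U" by (intro holo_on_mult holo_on_const q)
    from ln_norm_le_ball_integral[OF this q(2,3)] nz N
    have 1: "ennreal (ln (N * norm (q c))) * ennreal V \<le> (\<integral>\<^sup>+w. l w \<partial>lborel)"
      by (simp add: l_def V norm_mult)
    have sum: "m n w + l w = ennreal (ln N) * indicator (ball c r) w" for w
    proof (cases "w \<in> ball c r")
      case w: True
      show ?thesis
      proof (cases "q w = 0")
        case True then show ?thesis by (simp add: m_def l_def neglog_def N_def)
      next
        case False
        have le: "ln (norm (q w)) \<le> 0" using le1[OF w] False by simp
        have ln: "ln (norm (of_real N * q w)) = ln N + ln (norm (q w))"
          using False N by (simp add: norm_mult ln_mult)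
        show ?thesis
        proof (cases "0 \<le> ln N + ln (norm (q w))")
          case True
          then have "min (ennreal (- ln (norm (q w)))) (ennreal (ln N)) = ennreal (- ln (norm (q w)))"
            by (simp add: min_def ennreal_leI)
          then show ?thesis using w False True le ln
            by (simp add: m_def l_def neglog_def N_def flip: ennreal_plus)
        next
          case F: False
          then have "min (ennreal (- ln (norm (q w)))) (ennreal (ln N)) = ennreal (ln N)"
            by (intro min_absorb2 ennreal_leI) simp
          then show ?thesis using w False F ln
            by (simp add: m_def l_def neglog_def N_def ennreal_neg)
        qed
      qed
    qed (simp add: m_def l_def)
    have "(\<integral>\<^sup>+w. m n w \<partial>lborel) + (\<integral>\<^sup>+w. l w \<partial>lborel) = (\<integral>\<^sup>+w. m n w + l w \<partial>lborel)"
      by (rule nn_integral_add[symmetric]) auto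
    also have "\<dots> = ennreal (ln N) * ennreal V"
      unfolding sum by (subst nn_integral_cmult_indicator) (auto simp: V)
    finally have 2: "(\<integral>\<^sup>+w. m n w \<partial>lborel) + (\<integral>\<^sup>+w. l w \<partial>lborel) = ennreal (ln N * V)"
      using N \<open>0 < V\<close> by (simp add: ennreal_mult)
    then obtain a b where ab: "(\<integral>\<^sup>+w. m n w \<partial>lborel) = ennreal a" "(\<integral>\<^sup>+w. l w \<partial>lborel) = ennreal b" "0 \<le> a" "0 \<le> b"
      by (metis ennreal_cases ennreal_add_eq_top ennreal_neq_top)
    have "a + b = ln N * V" using 2 ab N \<open>0 < V\<close> by (simp flip: ennreal_plus)
    moreover have "ln (N * norm (q c)) * V \<le> b"
    proof -
      have "0 \<le> ln (N * norm (q c))" using n by (simp add: N_def mult.commute)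
      then show ?thesis using 1 ab \<open>0 < V\<close> by (simp flip: ennreal_mult)
    qed
    moreover have "ln (N * norm (q c)) = ln N + ln (norm (q c))" using N nz by (simp add: ln_mult)
    ultimately have "a \<le> V * (- ln (norm (q c)))" by (simp add: algebra_simps)
    then have "ennreal a \<le> ennreal (V * (- ln (norm (q c))))" by (rule ennreal_leI)
    moreover have "B = ennreal (V * (- ln (norm (q c))))"
      unfolding B_def using \<open>0 < V\<close> by (intro ennreal_mult'[symmetric]) simp
    ultimately show ?thesis by (simp only: ab)
  qed
  obtain n0 :: nat where "1 / norm (q c) < real n0" using reals_Archimedean2 by blast
  then have n0: "1 \<le> norm (q c) * real (Suc n)" if "n \<ge> n0" for n
  proof -
    have "1 / norm (q c) \<le> real (Suc n)" using \<open>1 / norm (q c) < real n0\<close> that by linarith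
    then show ?thesis using nz by (simp add: field_simps)
  qed
  have inc: "incseq m"
    unfolding incseq_def m_def le_fun_def
    by (auto intro!: mult_right_mono min.mono ennreal_leI ln_mono)
  have sup: "(SUP n. m n w) = neglog (q w) * indicator (ball c r) w" for w
  proof (cases "w \<in> ball c r")
    case True
    have "(SUP n. m n w) = (SUP n. min (neglog (q w)) (ennreal (ln (real (Suc n)))))"
      using True by (simp add: m_def)
    also have "\<dots> = min (neglog (q w)) (SUP n. ennreal (ln (real (Suc n))))"
      by (simp add: inf_min[symmetric] inf_SUP)
    also have "(SUP n. ennreal (ln (real (Suc n)))) = top"
    proof (rule ennreal_SUP_eq_top)
      fix k :: nat
      obtain j :: nat where "exp (real k) < real j" using reals_Archimedean2 by blast
      then have "exp (real k) \<le> real (Suc j)" by simp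
      then have "real k \<le> ln (real (Suc j))" by (subst ln_ge_iff) auto
      then have "of_nat k \<le> ennreal (ln (real (Suc j)))"
        by (metis ennreal_leI ennreal_of_nat_eq_real_of_nat)
      then show "\<exists>i\<in>UNIV. of_nat k \<le> ennreal (ln (real (Suc i)))" by blast
    qed
    finally show ?thesis using True by simp
  qed (simp add: m_def)
  have "(\<integral>\<^sup>+w\<in>ball c r. neglog (q w) \<partial>lborel) = (\<integral>\<^sup>+w. (SUP n. m n w) \<partial>lborel)"
    by (simp add: sup)
  also have "\<dots> = (SUP n. \<integral>\<^sup>+w. m n w \<partial>lborel)"
    by (rule nn_integral_monotone_convergence_SUP) (use inc in auto)
  also have "\<dots> \<le> B"
  proof (rule SUP_least)
    fix n
    have "(\<integral>\<^sup>+w. m n w \<partial>lborel) \<le> (\<integral>\<^sup>+w. m (max n n0) w \<partial>lborel)"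
      by (intro nn_integral_mono) (use inc in \<open>auto simp: incseq_def le_fun_def\<close>)
    also have "\<dots> \<le> B" by (intro bound n0) simp
    finally show "(\<integral>\<^sup>+w. m n w \<partial>lborel) \<le> B" .
  qed
  also have "B < \<infinity>" by (simp add: B_def ennreal_mult_less_top)
  finally show ?thesis .
qed

section \<open>Ball averages\<close>

definition ball_mean :: "real \<Rightarrow> ('a::euclidean_space \<Rightarrow> ennreal) \<Rightarrow> 'a \<Rightarrow> ennreal" where
  "ball_mean r g z = (\<integral>\<^sup>+w\<in>ball 0 r. g (z + w) \<partial>lborel) / emeasure lborel (ball (0::'a) r)"

lemma ball_mean_eq:
  assumes [measurable]: "g \<in> borel_measurable borel"
  shows "ball_mean r g (z::'a::euclidean_space) = (\<integral>\<^sup>+w\<in>ball z r. g w \<partial>lborel) / emeasure lborel (ball (0::'a) r)"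
  using nn_integral_lborel_shift[of "\<lambda>w. g w * indicator (ball z r) w" z]
  by (simp add: ball_mean_def indicator_def dist_norm cong: if_cong)

lemma ball_mean_measurable [measurable]:
  fixes g :: "'a::euclidean_space \<Rightarrow> ennreal"
  assumes [measurable]: "g \<in> borel_measurable borel"
  shows "ball_mean r g \<in> borel_measurable borel"
proof -
  have [measurable]: "ball (0::'a) r \<in> sets borel" by simp
  have [measurable]: "(\<lambda>z. \<integral>\<^sup>+w\<in>ball 0 r. g (z + w) \<partial>lborel) \<in> borel_measurable borel" by measurable
  show ?thesis unfolding ball_mean_def divide_ennreal_def
    by (rule borel_measurable_times_ennreal) auto
qed

lemma nn_integral_divide_multc:
  assumes "f \<in> borel_measurable M"
  shows "(\<integral>\<^sup>+w. f w \<partial>M) / V * c = (\<integral>\<^sup>+w. f w * c \<partial>M) / V"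
  unfolding nn_integral_multc[OF assms] divide_ennreal_def by (simp add: mult_ac)

lemma ball_mean_add:
  fixes f g :: "'a::euclidean_space \<Rightarrow> ennreal"
  assumes [measurable]: "f \<in> borel_measurable borel" "g \<in> borel_measurable borel"
  shows "ball_mean r (\<lambda>z. f z + g z) z = ball_mean r f z + ball_mean r g z"
proof -
  have [measurable]: "ball (0::'a) r \<in> sets borel" by simp
  show ?thesis
    unfolding ball_mean_def distrib_right
    by (subst nn_integral_add) (auto simp: divide_ennreal_def distrib_right)
qed

lemma ball_mean_const:
  assumes "0 < r"
  shows "ball_mean r (\<lambda>z::'a::euclidean_space. c) z = c"
proof -
  have "ball_mean r (\<lambda>z::'a. c) z
    = c * emeasure lborel (ball (0::'a) r) / emeasure lborel (ball (0::'a) r)"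
    unfolding ball_mean_def by (subst nn_integral_cmult_indicator) auto
  also have "\<dots> = c"
    using emeasure_lborel_ball_pos[OF assms, of "0::'a"] emeasure_lborel_ball_finite[of "0::'a" r]
    by (intro ennreal_mult_divide_eq) auto
  finally show ?thesis .
qed

lemma ball_mean_commute:
  fixes g :: "'a::euclidean_space \<Rightarrow> ennreal"
  assumes [measurable]: "g \<in> borel_measurable borel"
  shows "ball_mean r (ball_mean s g) z = ball_mean s (ball_mean r g) z"
proof -
  have [measurable]: "ball (0::'a) r \<in> sets borel" for r by simp
  define J where "J r s = (\<integral>\<^sup>+w. \<integral>\<^sup>+w'. g (z + w + w') * indicator (ball 0 s) w' * indicator (ball 0 r) w
    \<partial>lborel \<partial>lborel)" for r s
  have J: "ball_mean r (ball_mean s g) z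
      = J r s / emeasure lborel (ball (0::'a) s) / emeasure lborel (ball (0::'a) r)" for r s
  proof -
    have "(\<integral>\<^sup>+w\<in>ball 0 r. ball_mean s g (z + w) \<partial>lborel)
      = (\<integral>\<^sup>+w. (\<integral>\<^sup>+w'. g (z + w + w') * indicator (ball 0 s) w' * indicator (ball 0 r) w \<partial>lborel)
          / emeasure lborel (ball (0::'a) s) \<partial>lborel)"
      unfolding ball_mean_def
      by (intro nn_integral_cong nn_integral_divide_multc) measurable
    also have "\<dots> = J r s / emeasure lborel (ball (0::'a) s)"
      unfolding J_def by (rule nn_integral_divide) measurable
    finally show ?thesis by (simp add: ball_mean_def[of r])
  qed
  have "J r s = (\<integral>\<^sup>+w'. \<integral>\<^sup>+w. g (z + w + w') * indicator (ball 0 s) w' * indicator (ball 0 r) w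
    \<partial>lborel \<partial>lborel)"
    unfolding J_def by (rule lborel_pair.Fubini'[symmetric]) measurable
  also have "\<dots> = J s r" by (simp add: J_def algebra_simps)
  finally show ?thesis by (simp add: J divide_ennreal_def mult_ac)
qed

section \<open>Periodic functions and their oscillation\<close>

text \<open>
  \<open>D\<close> is a bounded Borel fundamental domain of a countable translation group \<open>\<Lambda>\<close>. Integrals over \<open>D\<close> of
  periodic functions stand for integrals over the quotient torus.
\<close>

locale lattice_tile =
  fixes \<Lambda> D :: "'a::euclidean_space set"
  assumes countable_lattice: "countable \<Lambda>"
    and diff_mem: "x \<in> \<Lambda> \<Longrightarrow> y \<in> \<Lambda> \<Longrightarrow> x - y \<in> \<Lambda>"
    and borel_tile [measurable]: "D \<in> sets borel"
    and bounded_tile: "bounded D"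
    and ex1: "\<exists>!\<omega>. \<omega> \<in> \<Lambda> \<and> z - \<omega> \<in> D"
begin

definition periodic :: "('a \<Rightarrow> 'b) \<Rightarrow> bool" where
  "periodic g \<longleftrightarrow> (\<forall>z. \<forall>\<omega>\<in>\<Lambda>. g (z + \<omega>) = g z)"

lemma uminus_mem: "x \<in> \<Lambda> \<Longrightarrow> - x \<in> \<Lambda>"
  using diff_mem[of x x] diff_mem[of "x - x" x] by simp

lemma ex1_plus: "\<exists>!\<omega>. \<omega> \<in> \<Lambda> \<and> z + \<omega> \<in> D"
proof -
  obtain \<omega> where w: "\<omega> \<in> \<Lambda>" "z - \<omega> \<in> D" "\<And>\<omega>'. \<omega>' \<in> \<Lambda> \<Longrightarrow> z - \<omega>' \<in> D \<Longrightarrow> \<omega>' = \<omega>"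
    using ex1[of z] by metis
  show ?thesis
  proof (rule ex1I[of _ "- \<omega>"])
    fix x assume "x \<in> \<Lambda> \<and> z + x \<in> D"
    then have "- x = \<omega>" using w(3)[of "- x"] uminus_mem[of x] by simp
    then show "x = - \<omega>" by auto
  next
    show "- \<omega> \<in> \<Lambda> \<and> z + - \<omega> \<in> D" using w(1,2) uminus_mem[OF w(1)] by simp
  qed
qed

lemma count_space_indicator:
  assumes "\<exists>!\<omega>. \<omega> \<in> \<Lambda> \<and> P \<omega>"
  shows "(\<integral>\<^sup>+\<omega>. (if P \<omega> then 1 else 0) \<partial>count_space \<Lambda>) = 1"
proof -
  obtain \<omega> where w: "\<omega> \<in> \<Lambda>" "P \<omega>" "\<And>\<omega>'. \<omega>' \<in> \<Lambda> \<Longrightarrow> P \<omega>' \<Longrightarrow> \<omega>' = \<omega>"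
    using assms by metis
  have "(\<integral>\<^sup>+\<omega>. (if P \<omega> then 1 else 0) \<partial>count_space \<Lambda>) = (\<integral>\<^sup>+\<omega>'. indicator {\<omega>} \<omega>' \<partial>count_space \<Lambda>)"
  proof (rule nn_integral_cong)
    fix \<omega>' assume "\<omega>' \<in> space (count_space \<Lambda>)"
    then have "P \<omega>' \<longleftrightarrow> \<omega>' = \<omega>" using w by (metis space_count_space)
    then show "(if P \<omega>' then 1 else 0) = (indicator {\<omega>} \<omega>' :: ennreal)"
      by (simp add: indicator_def)
  qed
  also have "\<dots> = 1" using w(1) by (subst nn_integral_indicator) auto
  finally show ?thesis .
qed

text \<open>
  Translation invariance of the measure of the torus: the translates of \<open>D\<close> by \<open>\<Lambda>\<close> cut \<open>w + D\<close> into
  countably many pieces, which are moved back into \<open>D\<close> by periods and there make up \<open>D\<close>.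
\<close>

lemma nn_integral_tile_shift:
  fixes g :: "'a \<Rightarrow> ennreal"
  assumes [measurable]: "g \<in> borel_measurable borel" and per: "periodic g"
  shows "(\<integral>\<^sup>+z\<in>D. g (w + z) \<partial>lborel) = (\<integral>\<^sup>+z\<in>D. g z \<partial>lborel)"
proof -
  define I where "I x = (if x \<in> D then 1 else 0 :: ennreal)" for x
  have ind: "indicator D x = I x" for x by (simp add: I_def indicator_def)
  have [measurable]: "I \<in> borel_measurable borel" unfolding ind[symmetric] by measurable
  have one: "(\<integral>\<^sup>+\<omega>. I (z - \<omega>) \<partial>count_space \<Lambda>) = 1" "(\<integral>\<^sup>+\<omega>. I (z + \<omega>) \<partial>count_space \<Lambda>) = 1" for z
    unfolding I_def by (rule count_space_indicator[OF ex1] count_space_indicator[OF ex1_plus])+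
  have "(\<integral>\<^sup>+z\<in>D. g (w + z) \<partial>lborel) = (\<integral>\<^sup>+z. g z * I (z - w) \<partial>lborel)"
    using nn_integral_lborel_shift[of "\<lambda>z. g z * I (z - w)" w] by (simp add: ind)
  also have "\<dots> = (\<integral>\<^sup>+z. \<integral>\<^sup>+\<omega>. g z * I (z - w) * I (z - \<omega>) \<partial>count_space \<Lambda> \<partial>lborel)"
    by (simp add: nn_integral_cmult one)
  also have "\<dots> = (\<integral>\<^sup>+\<omega>. \<integral>\<^sup>+z. g z * I (z - w) * I (z - \<omega>) \<partial>lborel \<partial>count_space \<Lambda>)"
    by (rule nn_integral_count_space_nn_integral[OF countable_lattice]) measurable
  also have "\<dots> = (\<integral>\<^sup>+\<omega>. \<integral>\<^sup>+z. g z * I z * I ((z - w) + \<omega>) \<partial>lborel \<partial>count_space \<Lambda>)"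
  proof (rule nn_integral_cong)
    fix \<omega> assume "\<omega> \<in> space (count_space \<Lambda>)"
    then have "g (z + \<omega>) = g z" for z using per by (simp add: periodic_def)
    then have "g (\<omega> + z) = g z" for z by (metis add.commute)
    then show "(\<integral>\<^sup>+z. g z * I (z - w) * I (z - \<omega>) \<partial>lborel)
      = (\<integral>\<^sup>+z. g z * I z * I ((z - w) + \<omega>) \<partial>lborel)"
      using nn_integral_lborel_shift[of "\<lambda>z. g z * I (z - w) * I (z - \<omega>)" \<omega>]
      by (simp add: algebra_simps)
  qed
  also have "\<dots> = (\<integral>\<^sup>+z. \<integral>\<^sup>+\<omega>. g z * I z * I ((z - w) + \<omega>) \<partial>count_space \<Lambda> \<partial>lborel)"
    by (rule nn_integral_count_space_nn_integral[OF countable_lattice, symmetric]) measurable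
  also have "\<dots> = (\<integral>\<^sup>+z\<in>D. g z \<partial>lborel)"
    by (simp add: nn_integral_cmult one ind)
  finally show ?thesis .
qed

lemma nn_integral_ball_le_tile:
  fixes g :: "'a \<Rightarrow> ennreal"
  assumes [measurable]: "g \<in> borel_measurable borel" and per: "periodic g"
    and b: "ball x0 r \<subseteq> D"
  shows "(\<integral>\<^sup>+w\<in>ball z r. g w \<partial>lborel) \<le> (\<integral>\<^sup>+w\<in>D. g w \<partial>lborel)"
proof -
  have "(\<integral>\<^sup>+w\<in>ball z r. g w \<partial>lborel) = (\<integral>\<^sup>+w\<in>ball x0 r. g ((z - x0) + w) \<partial>lborel)"
  proof -
    have "indicator (ball z r) (z - x0 + w) = (indicator (ball x0 r) w :: ennreal)" for w
      by (simp add: indicator_def dist_norm)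
    moreover have "(\<integral>\<^sup>+w. g (z - x0 + w) * indicator (ball z r) (z - x0 + w) \<partial>lborel)
      = (\<integral>\<^sup>+w. g w * indicator (ball z r) w \<partial>lborel)"
      by (rule nn_integral_lborel_shift[of "\<lambda>w. g w * indicator (ball z r) w"])
        (intro borel_measurable_times_ennreal borel_measurable_indicator, auto)
    ultimately show ?thesis by (simp only:)
  qed
  also have "\<dots> \<le> (\<integral>\<^sup>+w\<in>D. g ((z - x0) + w) \<partial>lborel)"
    using b by (intro nn_integral_mono mult_left_mono) (auto simp: indicator_def)
  also have "\<dots> = (\<integral>\<^sup>+w\<in>D. g w \<partial>lborel)" by (rule nn_integral_tile_shift[OF _ per]) simp
  finally show ?thesis .
qed

lemma ball_mean_periodic: "periodic g \<Longrightarrow> periodic (ball_mean r g)"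
proof -
  assume per: "periodic g"
  have "g (z + \<omega> + w) = g (z + w)" if "\<omega> \<in> \<Lambda>" for z \<omega> w
    using per that unfolding periodic_def by (metis add.assoc add.commute)
  then show ?thesis by (simp add: periodic_def ball_mean_def)
qed

lemma nn_integral_tile_ball_mean:
  fixes g :: "'a \<Rightarrow> ennreal"
  assumes g[measurable]: "g \<in> borel_measurable borel" and per: "periodic g" and r: "0 < r"
  shows "(\<integral>\<^sup>+z\<in>D. ball_mean r g z \<partial>lborel) = (\<integral>\<^sup>+z\<in>D. g z \<partial>lborel)"
proof -
  have [measurable]: "ball (0::'a) r \<in> sets borel" by simp
  define V where "V = emeasure lborel (ball (0::'a) r)"
  have V: "V \<noteq> 0" "V \<noteq> top"
    using emeasure_lborel_ball_pos[OF r, of "0::'a"] emeasure_lborel_ball_finite[of "0::'a" r]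
    by (auto simp: V_def)
  have "(\<integral>\<^sup>+z\<in>D. ball_mean r g z \<partial>lborel)
    = (\<integral>\<^sup>+z. (\<integral>\<^sup>+w. g (z + w) * indicator (ball 0 r) w * indicator D z \<partial>lborel) / V \<partial>lborel)"
    unfolding ball_mean_def V_def
    by (intro nn_integral_cong nn_integral_divide_multc) measurable
  also have "\<dots> = (\<integral>\<^sup>+z. (\<integral>\<^sup>+w. g (z + w) * indicator (ball 0 r) w * indicator D z \<partial>lborel) \<partial>lborel) / V"
    by (rule nn_integral_divide) measurable
  also have "(\<integral>\<^sup>+z. (\<integral>\<^sup>+w. g (z + w) * indicator (ball 0 r) w * indicator D z \<partial>lborel) \<partial>lborel)
    = (\<integral>\<^sup>+w. (\<integral>\<^sup>+z. g (z + w) * indicator (ball 0 r) w * indicator D z \<partial>lborel) \<partial>lborel)"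
    by (rule lborel_pair.Fubini') measurable
  also have "\<dots> = (\<integral>\<^sup>+w. (\<integral>\<^sup>+z\<in>D. g z \<partial>lborel) * indicator (ball (0::'a) r) w \<partial>lborel)"
  proof (rule nn_integral_cong)
    fix w :: 'a
    have "(\<integral>\<^sup>+z. g (z + w) * indicator (ball 0 r) w * indicator D z \<partial>lborel)
      = (\<integral>\<^sup>+z. (g (w + z) * indicator D z) * indicator (ball 0 r) w \<partial>lborel)"
      by (simp add: mult_ac add.commute)
    also have "\<dots> = (\<integral>\<^sup>+z\<in>D. g (w + z) \<partial>lborel) * indicator (ball 0 r) w"
      by (rule nn_integral_multc) measurable
    also have "\<dots> = (\<integral>\<^sup>+z\<in>D. g z \<partial>lborel) * indicator (ball 0 r) w"
      by (simp add: nn_integral_tile_shift[OF g per])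
    finally show "(\<integral>\<^sup>+z. g (z + w) * indicator (ball 0 r) w * indicator D z \<partial>lborel)
      = (\<integral>\<^sup>+z\<in>D. g z \<partial>lborel) * indicator (ball 0 r) w" .
  qed
  also have "\<dots> = (\<integral>\<^sup>+z\<in>D. g z \<partial>lborel) * V"
    unfolding V_def by (rule nn_integral_cmult_indicator) auto
  also have "\<dots> / V = (\<integral>\<^sup>+z\<in>D. g z \<partial>lborel)" using V by (simp add: ennreal_mult_divide_eq)
  finally show ?thesis .
qed

lemma ball_mean_le_tile:
  fixes g :: "'a \<Rightarrow> ennreal"
  assumes "g \<in> borel_measurable borel" "periodic g" "ball x0 r \<subseteq> D"
  shows "ball_mean r g z \<le> (\<integral>\<^sup>+w\<in>D. g w \<partial>lborel) / emeasure lborel (ball (0::'a) r)"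
  unfolding ball_mean_eq[OF assms(1)]
  by (intro divide_right_mono_ennreal nn_integral_ball_le_tile[OF assms])

text \<open>
  Compactness of the torus, in the form needed to bound the length of Harnack chains.
\<close>

lemma bounded_representatives: "\<exists>M. \<forall>y z. \<exists>\<omega>\<in>\<Lambda>. dist y (z + \<omega>) \<le> M"
proof -
  obtain M where M: "\<And>x y. x \<in> D \<Longrightarrow> y \<in> D \<Longrightarrow> dist x y \<le> M"
    using bounded_tile bounded_two_points by metis
  have "\<exists>\<omega>\<in>\<Lambda>. dist y (z + \<omega>) \<le> M" for y z
  proof -
    obtain a b where ab: "a \<in> \<Lambda>" "y - a \<in> D" "b \<in> \<Lambda>" "z - b \<in> D" using ex1 by metis
    have "dist y (z + (a - b)) = dist (y - a) (z - b)" by (simp add: dist_norm algebra_simps)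
    then show ?thesis using M[OF ab(2,4)] diff_mem[OF ab(1,3)] by metis
  qed
  then show ?thesis by blast
qed

text \<open>
  The mean over balls preserves the integral over \<open>D\<close>. Therefore the positive and the negative part of
  \<open>g - ball_mean s g\<close> have the same integral, and a bound on one of them, as subharmonicity up to an
  error provides, is a bound on both. A further average turns the bound in the mean into one at every
  point. Since subtraction in \<^typ>\<open>ennreal\<close> truncates at \<open>0\<close>, the two parts are the two differences.
\<close>

lemma ball_mean_near_mean:
  fixes g :: "'a \<Rightarrow> ennreal"
  assumes g[measurable]: "g \<in> borel_measurable borel" and per: "periodic g"
    and fin: "(\<integral>\<^sup>+w\<in>D. g w \<partial>lborel) < \<infinity>"
    and r: "ball x0 r \<subseteq> D" and s: "0 < s"
    and T: "(\<integral>\<^sup>+w\<in>D. (g w - ball_mean s g w) \<partial>lborel) \<le> T"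
  defines "\<eta> \<equiv> T / emeasure lborel (ball (0::'a) r)"
  shows "ball_mean r g z \<le> ball_mean s (ball_mean r g) z + \<eta>"
    and "ball_mean s (ball_mean r g) z \<le> ball_mean r g z + \<eta>"
proof -
  define p where "p w = g w - ball_mean s g w" for w
  define n where "n w = ball_mean s g w - g w" for w
  have [measurable]: "p \<in> borel_measurable borel" "n \<in> borel_measurable borel"
    unfolding p_def n_def by measurable
  have pper: "periodic p" and nper: "periodic n"
    using per ball_mean_periodic[OF per, of s] by (auto simp: periodic_def p_def n_def)
  have eq: "g w + n w = ball_mean s g w + p w" for w
  proof -
    have "a + (b - a) = b + (a - b)" for a b :: ennreal
    proof (cases "a = top \<or> b = top")
      case False
      then show ?thesis
        using linear[of a b]
        by (auto simp: add_diff_inverse_ennreal diff_eq_0_ennreal less_top)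
    qed auto
    then show ?thesis by (simp add: p_def n_def)
  qed
  have "(\<integral>\<^sup>+w\<in>D. g w \<partial>lborel) + (\<integral>\<^sup>+w\<in>D. n w \<partial>lborel)
      = (\<integral>\<^sup>+w\<in>D. (g w + n w) \<partial>lborel)"
    by (simp add: distrib_right nn_integral_add)
  also have "\<dots> = (\<integral>\<^sup>+w\<in>D. ball_mean s g w \<partial>lborel) + (\<integral>\<^sup>+w\<in>D. p w \<partial>lborel)"
    unfolding eq by (simp add: distrib_right nn_integral_add)
  also have "\<dots> = (\<integral>\<^sup>+w\<in>D. g w \<partial>lborel) + (\<integral>\<^sup>+w\<in>D. p w \<partial>lborel)"
    by (simp add: nn_integral_tile_ball_mean[OF g per s])
  finally have np: "(\<integral>\<^sup>+w\<in>D. n w \<partial>lborel) = (\<integral>\<^sup>+w\<in>D. p w \<partial>lborel)"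
    using fin by (auto simp: ennreal_add_left_cancel)
  have pT: "(\<integral>\<^sup>+w\<in>D. p w \<partial>lborel) \<le> T" using T by (simp add: p_def)
  have bp: "ball_mean r p z \<le> \<eta>"
    using ball_mean_le_tile[OF _ pper r, of z] divide_right_mono_ennreal[OF pT]
    unfolding \<eta>_def by (meson \<open>p \<in> borel_measurable borel\<close> order_trans)
  have bn: "ball_mean r n z \<le> \<eta>"
    using ball_mean_le_tile[OF _ nper r, of z] divide_right_mono_ennreal[OF pT]
    unfolding \<eta>_def np[symmetric] by (meson \<open>n \<in> borel_measurable borel\<close> order_trans)
  have "ball_mean r g z + ball_mean r n z = ball_mean r (\<lambda>w. g w + n w) z"
    by (simp add: ball_mean_add)
  also have "\<dots> = ball_mean s (ball_mean r g) z + ball_mean r p z"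
    unfolding eq by (simp add: ball_mean_add ball_mean_commute[of g r s])
  finally have *: "ball_mean r g z + ball_mean r n z = ball_mean s (ball_mean r g) z + ball_mean r p z" .
  show "ball_mean r g z \<le> ball_mean s (ball_mean r g) z + \<eta>"
  proof -
    have "ball_mean r g z \<le> ball_mean r g z + ball_mean r n z" by simp
    also have "\<dots> \<le> ball_mean s (ball_mean r g) z + \<eta>" unfolding * by (intro add_left_mono bp)
    finally show ?thesis .
  qed
  show "ball_mean s (ball_mean r g) z \<le> ball_mean r g z + \<eta>"
  proof -
    have "ball_mean s (ball_mean r g) z \<le> ball_mean s (ball_mean r g) z + ball_mean r p z" by simp
    also have "\<dots> \<le> ball_mean r g z + \<eta>" unfolding *[symmetric] by (intro add_left_mono bn)
    finally show ?thesis .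
  qed
qed

text \<open>
  Harnack's inequality for almost harmonic functions: the ball of radius \<open>r/2\<close> about \<open>y\<close> lies in the ball of
  radius \<open>r\<close> about \<open>z\<close>, so the means over the two can be compared up to the ratio of the volumes.
\<close>

lemma harnack_step:
  fixes v :: "'a \<Rightarrow> ennreal"
  assumes v[measurable]: "v \<in> borel_measurable borel" and r: "0 < r"
    and up: "v y \<le> ball_mean (r/2) v y + \<eta>" and low: "ball_mean r v z \<le> v z + \<eta>"
    and yz: "dist y z \<le> r/2"
  defines "q \<equiv> emeasure lborel (ball (0::'a) r) / emeasure lborel (ball (0::'a) (r/2))"
  shows "v y + \<eta> \<le> (q + 2) * (v z + \<eta>)"
proof -
  define V where "V = emeasure lborel (ball (0::'a) r)"
  have V: "V \<noteq> 0" "V \<noteq> top"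
    using emeasure_lborel_ball_pos[OF r, of "0::'a"] emeasure_lborel_ball_finite[of "0::'a" r]
    by (auto simp: V_def)
  have Vx: "V * x / V = x" for x
    unfolding mult.commute[of V] by (rule ennreal_mult_divide_eq[OF V])
  have sub: "ball y (r/2) \<subseteq> ball z r"
  proof
    fix x assume "x \<in> ball y (r/2)"
    then show "x \<in> ball z r" using yz dist_triangle[of z x y] by (simp add: dist_commute)
  qed
  have "(\<integral>\<^sup>+w\<in>ball y (r/2). v w \<partial>lborel) \<le> (\<integral>\<^sup>+w\<in>ball z r. v w \<partial>lborel)"
    using sub by (intro nn_integral_mono mult_left_mono) (auto simp: indicator_def)
  also have "\<dots> = V * ball_mean r v z"
    by (simp add: ball_mean_eq V_def[symmetric] ennreal_times_divide Vx)
  also have "\<dots> \<le> V * (v z + \<eta>)" by (intro mult_left_mono low) simp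
  finally have "ball_mean (r/2) v y \<le> V * (v z + \<eta>) / emeasure lborel (ball (0::'a) (r/2))"
    unfolding ball_mean_eq[OF v] by (rule divide_right_mono_ennreal)
  also have "\<dots> = q * (v z + \<eta>)" by (simp add: q_def V_def divide_ennreal_def mult_ac)
  finally have "v y + \<eta> \<le> q * (v z + \<eta>) + \<eta> + \<eta>"
    using up by (meson add_right_mono order_trans)
  also have "\<dots> \<le> q * (v z + \<eta>) + (v z + \<eta>) + (v z + \<eta>)"
    by (intro add_mono) auto
  also have "\<dots> = (q + 2) * (v z + \<eta>)"
    by (simp add: distrib_right mult_2 add_ac flip: one_add_one)
  finally show ?thesis .
qed

text \<open>
  Iteration of the preceding estimate along the segment from \<open>z\<close> to \<open>y\<close> in steps of length \<open>r/2\<close>.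
\<close>

lemma harnack_chain:
  fixes v :: "'a \<Rightarrow> ennreal"
  assumes v: "v \<in> borel_measurable borel" and r: "0 < r"
    and up: "\<And>y. v y \<le> ball_mean (r/2) v y + \<eta>" and low: "\<And>z. ball_mean r v z \<le> v z + \<eta>"
  defines "q \<equiv> emeasure lborel (ball (0::'a) r) / emeasure lborel (ball (0::'a) (r/2))"
  shows "dist y z \<le> real k * (r/2) \<Longrightarrow> v y + \<eta> \<le> (q + 2) ^ k * (v z + \<eta>)"
proof (induction k arbitrary: y)
  case 0 then show ?case by simp
next
  case (Suc k)
  define x where "x = z + (real k / real (Suc k)) *\<^sub>R (y - z)"
  have "dist x z = (real k / real (Suc k)) * dist y z"
    by (simp add: x_def dist_norm)
  also have "\<dots> \<le> (real k / real (Suc k)) * (real (Suc k) * (r/2))"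
    by (intro mult_left_mono Suc.prems) auto
  finally have xz: "dist x z \<le> real k * (r/2)" by simp
  have "y - x = (1 / real (Suc k)) *\<^sub>R (y - z)"
  proof -
    have "y - x = (1 - real k / real (Suc k)) *\<^sub>R (y - z)"
      by (simp add: x_def scaleR_left_diff_distrib)
    also have "1 - real k / real (Suc k) = 1 / real (Suc k)" by (simp add: field_simps)
    finally show ?thesis .
  qed
  then have "dist y x = (1 / real (Suc k)) * dist y z" by (simp add: dist_norm)
  also have "\<dots> \<le> (1 / real (Suc k)) * (real (Suc k) * (r/2))"
    by (intro mult_left_mono Suc.prems) auto
  finally have yx: "dist y x \<le> r/2" by simp
  have "v y + \<eta> \<le> (q + 2) * (v x + \<eta>)"
    unfolding q_def by (rule harnack_step[OF v r up low yx])
  also have "\<dots> \<le> (q + 2) * ((q + 2) ^ k * (v z + \<eta>))"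
    by (intro mult_left_mono Suc.IH xz) simp
  finally show ?case by (simp add: mult.assoc)
qed

text \<open>
  Subtract from the averaged function its infimum. The difference is nonnegative, almost harmonic and
  small at some point, hence by Harnack's inequality small at all points within a bounded distance of
  that point; up to periods these are all points. The constant depends on the torus and the radius
  only. This is a quantitative form of the fact that harmonic functions on a torus are constant.
\<close>

lemma ball_mean_oscillation:
  assumes r: "0 < r" "ball x0 r \<subseteq> D"
  obtains C where "0 < C" "\<And>g T y z. \<lbrakk>g \<in> borel_measurable borel; periodic g;
     (\<integral>\<^sup>+w\<in>D. g w \<partial>lborel) < \<infinity>; 0 < T;
     \<And>s. s \<in> {r, r/2} \<Longrightarrow> (\<integral>\<^sup>+w\<in>D. (g w - ball_mean s g w) \<partial>lborel) \<le> ennreal T\<rbrakk>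
     \<Longrightarrow> ball_mean r g y \<le> ball_mean r g z + ennreal (C * T)"
proof -
  define V where "V = measure lborel (ball (0::'a) r)"
  have V: "emeasure lborel (ball (0::'a) r) = ennreal V"
    using emeasure_lborel_ball_finite[of "0::'a" r] by (simp add: V_def emeasure_eq_ennreal_measure)
  have "0 < V" using emeasure_lborel_ball_pos[OF r(1), of "0::'a"] V by simp
  define V' where "V' = measure lborel (ball (0::'a) (r/2))"
  have V': "emeasure lborel (ball (0::'a) (r/2)) = ennreal V'"
    using emeasure_lborel_ball_finite[of "0::'a" "r/2"] by (simp add: V'_def emeasure_eq_ennreal_measure)
  have "0 < V'" using emeasure_lborel_ball_pos[of "r/2" "0::'a"] r(1) V' by simp
  obtain M where M: "\<And>y z. \<exists>\<omega>\<in>\<Lambda>. dist y (z + \<omega>) \<le> M"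
    using bounded_representatives by blast
  obtain k :: nat where k: "M / (r/2) < real k" using reals_Archimedean2 by blast
  then have k: "M \<le> real k * (r/2)" using r(1) by (simp add: field_simps)
  define C where "C = 2 * (V / V' + 2) ^ k / V"
  have "0 < C" using \<open>0 < V\<close> \<open>0 < V'\<close> by (auto simp: C_def intro!: divide_pos_pos mult_pos_pos zero_less_power add_pos_pos)
  moreover have "ball_mean r g y \<le> ball_mean r g z + ennreal (C * T)"
    if g[measurable]: "g \<in> borel_measurable borel" and per: "periodic g"
    and fin: "(\<integral>\<^sup>+w\<in>D. g w \<partial>lborel) < \<infinity>" and T: "0 < T"
    and def: "\<And>s. s \<in> {r, r/2} \<Longrightarrow> (\<integral>\<^sup>+w\<in>D. (g w - ball_mean s g w) \<partial>lborel) \<le> ennreal T"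
    for g T y z
  proof -
    define a where "a = ball_mean r g"
    have [measurable]: "a \<in> borel_measurable borel" unfolding a_def by measurable
    have aper: "periodic a" unfolding a_def by (rule ball_mean_periodic[OF per])
    define \<eta> where "\<eta> = ennreal (T / V)"
    have \<eta>: "\<eta> = ennreal T / emeasure lborel (ball (0::'a) r)"
      using \<open>0 < V\<close> T by (simp add: \<eta>_def V divide_ennreal)
    have near: "a z \<le> ball_mean s a z + \<eta>" "ball_mean s a z \<le> a z + \<eta>" if "s \<in> {r, r/2}" for s z
      using ball_mean_near_mean[OF g per fin r(2) _ def[OF that], of z] that r(1)
      by (auto simp: a_def \<eta>)
    define i where "i = (INF z. a z)"
    have ile: "i \<le> a z" for z by (simp add: i_def INF_lower)
    have "a z < top" for z
    proof -
      have "a z \<le> (\<integral>\<^sup>+w\<in>D. g w \<partial>lborel) / ennreal V"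
        using ball_mean_le_tile[OF g per r(2)] by (simp add: a_def V)
      also have "\<dots> < top"
        using fin \<open>0 < V\<close> by (cases "\<integral>\<^sup>+w\<in>D. g w \<partial>lborel") (auto simp: divide_ennreal)
      finally show ?thesis .
    qed
    then have itop: "i < top" using ile by (meson le_less_trans)
    define v where "v z = a z - i" for z
    have [measurable]: "v \<in> borel_measurable borel" unfolding v_def by measurable
    have va: "a z = v z + i" for z using ile itop by (simp add: v_def diff_add_cancel_ennreal)
    have mean: "ball_mean s a z = ball_mean s v z + i" if "0 < s" for s z
    proof -
      have "ball_mean s a z = ball_mean s (\<lambda>z. v z + i) z" using va by presburger
      then show ?thesis using that by (simp add: ball_mean_add ball_mean_const)
    qed
    have cancel: "b \<le> c" if "b + i \<le> c + i" for b c :: ennreal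
      using that itop by (auto simp: add.commute[of _ i] ennreal_add_left_cancel_le)
    have up: "v y \<le> ball_mean (r/2) v y + \<eta>" for y
      by (rule cancel) (use near(1)[of "r/2" y] r(1) va[of y] in \<open>simp add: mean add_ac\<close>)
    have low: "ball_mean r v y \<le> v y + \<eta>" for y
      by (rule cancel) (use near(2)[of "r" y] r(1) mean[of r y] va[of y] in \<open>simp add: add_ac\<close>)
    \<comment> \<open>At a point where \<open>a\<close> is within \<open>\<eta>\<close> of its infimum, \<open>v\<close> is at most \<open>\<eta>\<close>.\<close>
    have "i < i + \<eta>" using itop T \<open>0 < V\<close> by (simp add: \<eta>_def)
    then obtain z0 where "a z0 < i + \<eta>" unfolding i_def by (auto simp: INF_less_iff)
    then have "v z0 + i \<le> \<eta> + i" unfolding va add.commute[of \<eta>] by (rule less_imp_le)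
    then have vz0: "v z0 \<le> \<eta>" by (rule cancel)
    obtain \<omega> where \<omega>: "\<omega> \<in> \<Lambda>" "dist y (z0 + \<omega>) \<le> M" using M by blast
    have "v (z0 + \<omega>) = v z0" using aper \<omega> by (simp add: v_def periodic_def)
    define Q where "Q = V / V' + 2"
    have Q: "ennreal V / ennreal V' + 2 = ennreal Q" "0 < Q"
      using \<open>0 < V\<close> \<open>0 < V'\<close> by (auto simp: Q_def divide_ennreal add_pos_pos)
    have "v y + \<eta> \<le> ennreal Q ^ k * (v z0 + \<eta>)"
      using harnack_chain[OF _ r(1) up low, of y "z0 + \<omega>" k] \<omega>(2) k \<open>v (z0 + \<omega>) = v z0\<close>
      by (simp add: V V' Q)
    also have "\<dots> \<le> ennreal Q ^ k * (\<eta> + \<eta>)"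
      by (intro mult_left_mono add_right_mono vz0) simp
    also have "\<dots> = ennreal (C * T)"
    proof -
      have "\<eta> + \<eta> = ennreal (2 * (T / V))"
        using \<open>0 < V\<close> T by (simp add: \<eta>_def flip: ennreal_plus)
      moreover have "ennreal Q ^ k = ennreal (Q ^ k)" using Q(2) by (simp add: ennreal_power)
      moreover have "C * T = Q ^ k * (2 * (T / V))" by (simp add: C_def Q_def)
      moreover have "ennreal (Q ^ k * (2 * (T / V))) = ennreal (Q ^ k) * ennreal (2 * (T / V))"
        using Q(2) by (intro ennreal_mult') simp
      ultimately show ?thesis by (simp only:)
    qed
    finally have "v y + \<eta> \<le> ennreal (C * T)" .
    then have "v y \<le> ennreal (C * T)" by (rule order_trans[rotated]) simp
    then have "a y \<le> ennreal (C * T) + i" unfolding va by (rule add_right_mono)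
    also have "\<dots> \<le> ennreal (C * T) + a z" by (intro add_left_mono ile)
    finally show ?thesis by (simp add: a_def add.commute)
  qed
  ultimately show ?thesis using that by blast
qed

end

section \<open>Linear systems and interpolation at roots of unity\<close>

lemma homogeneous_system_nontrivial:
  fixes M :: "'a \<Rightarrow> 'b \<Rightarrow> 'f::field"
  assumes "finite A" "finite B" "card A < card B"
  shows "\<exists>c. (\<exists>b\<in>B. c b \<noteq> 0) \<and> (\<forall>a\<in>A. (\<Sum>b\<in>B. c b * M a b) = 0)"
  using assms
proof (induction A arbitrary: B M rule: finite_induct)
  case empty
  then obtain b where "b \<in> B" by fastforce
  then show ?case by (intro exI[of _ "\<lambda>_. 1"]) auto
next
  case (insert a A)
  show ?case
  proof (cases "\<forall>b\<in>B. M a b = 0")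
    case True
    have "card A < card B" using insert by simp
    from insert.IH[OF insert.prems(1) this, of M] True show ?thesis by auto
  next
    case False
    then obtain b0 where b0: "b0 \<in> B" "M a b0 \<noteq> 0" by blast
    define B' where "B' = B - {b0}"
    have B': "finite B'" "B = insert b0 B'" "b0 \<notin> B'" "card A < card B'"
      using insert b0 by (auto simp: B'_def card_Diff_singleton)
    obtain c where c: "\<exists>b\<in>B'. c b \<noteq> 0"
      "\<And>a'. a' \<in> A \<Longrightarrow> (\<Sum>b\<in>B'. c b * (M a' b - M a' b0 * M a b / M a b0)) = 0"
      using insert.IH[OF B'(1,4), of "\<lambda>a' b. M a' b - M a' b0 * M a b / M a b0"] by blast
    \<comment> \<open>Elimination: the equation for \<open>a\<close> is solved for the unknown \<open>b0\<close>.\<close>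
    define c0 where "c0 = - (\<Sum>b\<in>B'. c b * M a b) / M a b0"
    define c' where "c' = c(b0 := c0)"
    have sum: "(\<Sum>b\<in>B. c' b * M x b) = c0 * M x b0 + (\<Sum>b\<in>B'. c b * M x b)" for x
    proof -
      have "(\<Sum>b\<in>B'. c' b * M x b) = (\<Sum>b\<in>B'. c b * M x b)"
        by (intro sum.cong) (use B'(3) in \<open>auto simp: c'_def\<close>)
      then show ?thesis using B' by (simp add: c'_def)
    qed
    have "(\<Sum>b\<in>B. c' b * M x b) = 0" if x: "x \<in> insert a A" for x
    proof (cases "x = a")
      case True
      then show ?thesis using b0(2) by (simp add: sum c0_def)
    next
      case False
      then have "(\<Sum>b\<in>B'. c b * M x b) - (\<Sum>b\<in>B'. c b * M a b) * (M x b0 / M a b0) = 0"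
        using c(2)[of x] x
        by (simp add: algebra_simps sum_subtractf sum_distrib_left sum_distrib_right)
      then show ?thesis by (simp add: sum c0_def)
    qed
    moreover have "\<exists>b\<in>B. c' b \<noteq> 0" using c(1) B' by (auto simp: c'_def)
    ultimately show ?thesis by blast
  qed
qed

text \<open>
  Orthogonality of characters, which makes interpolation at roots of unity exact in degrees below \<open>m\<close>.
\<close>

lemma sum_root_of_unity_powers:
  fixes \<omega> :: complex
  assumes m: "0 < m" and \<omega>: "\<omega> = cis (2 * pi / m)" and n: "n < m" "l < m"
  shows "(\<Sum>k<m. \<omega> ^ (k * n) / \<omega> ^ (k * l)) = (if n = l then of_nat m else 0)"
proof (cases "n = l")
  case True
  then show ?thesis by (simp add: \<omega>)
next
  case False
  define x where "x = \<omega> ^ n / \<omega> ^ l"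
  have x: "x = cis (2 * pi * (real n - real l) / m)"
    by (simp add: x_def \<omega> Complex.DeMoivre cis_divide diff_divide_distrib right_diff_distrib mult_ac)
  have xm: "x ^ m = 1"
  proof -
    have "x ^ m = cis (real m * (2 * pi * (real n - real l) / m))"
      unfolding x by (rule Complex.DeMoivre)
    also have "real m * (2 * pi * (real n - real l) / m) = 2 * pi * of_int (int n - int l)"
      using m by simp
    also have "cis (2 * pi * of_int (int n - int l)) = 1" by (rule cis_multiple_2pi) simp
    finally show ?thesis .
  qed
  have x1: "x \<noteq> 1"
  proof
    assume "x = 1"
    then have "cos (2 * pi * (real n - real l) / m) = 1" by (simp add: x complex_eq_iff)
    then obtain j :: int where "2 * pi * (real n - real l) / m = of_int j * (2 * pi)"
      by (auto simp: cos_one_2pi_int)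
    then have "2 * pi * ((real n - real l) / m) = 2 * pi * of_int j" by (simp add: mult.commute)
    then have "(real n - real l) / m = of_int j" by (subst (asm) mult_cancel_left) simp
    then have "real n - real l = of_int j * real m" using m by (simp add: field_simps)
    then have "real_of_int (int n - int l) = real_of_int (j * int m)" by simp
    then have *: "int n - int l = j * int m" by (simp only: of_int_eq_iff)
    then have "j \<noteq> 0" using False by auto
    then have "int m \<le> \<bar>j * int m\<bar>" using mult_right_mono[of 1 "\<bar>j\<bar>" "int m"] by (simp add: abs_mult)
    then show False using * n by linarith
  qed
  have "(\<Sum>k<m. \<omega> ^ (k * n) / \<omega> ^ (k * l)) = (\<Sum>k<m. x ^ k)"
    by (simp add: x_def power_divide power_mult[symmetric] mult.commute)
  also have "\<dots> = 0" using x1 xm by (simp add: geometric_sum)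
  finally show ?thesis using False by simp
qed

definition unity_nodes :: "nat \<Rightarrow> real \<Rightarrow> complex set" where
  "unity_nodes m \<epsilon> = (\<lambda>k. of_real \<epsilon> * cis (2 * pi / m) ^ k) ` {..<m}"

text \<open>
  Interpolation at the \<open>m\<close>-th roots of unity scaled by \<open>\<epsilon> = R/2\<close> uses the basis functions
  \<open>L\<^sub>k(z) = (1/m) \<Sum>\<^sub>l\<^sub><\<^sub>m (z/\<epsilon>)\<^sup>l \<omega>\<^sup>-\<^sup>k\<^sup>l\<close>, which are bounded by \<open>1\<close> on the disc of radius \<open>\<epsilon>\<close>. The terms
  \<open>a\<^sub>n z\<^sup>n\<close> of the power series with \<open>n < m\<close> are reproduced exactly. The others, with \<open>|a\<^sub>n| \<le> B / R\<^sup>n\<close>, are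
  off by at most \<open>(m + 1) B 2\<^sup>-\<^sup>n\<close>, and these bounds add up to the first summand.
\<close>

lemma interpolation_error:
  assumes f: "f holomorphic_on S" "open S" "cball 0 R \<subseteq> S"
    and R: "0 < R" and m: "0 < m"
    and bound: "\<And>t. norm t \<le> R \<Longrightarrow> norm (f t) \<le> B"
    and nodes: "\<And>t. t \<in> unity_nodes m (R/2) \<Longrightarrow> norm (f t) \<le> b"
    and z: "norm z \<le> R/2"
  shows "norm (f z) \<le> B * (2 * (real m + 1) / 2 ^ m) + real m * b"
proof -
  define \<epsilon> where "\<epsilon> = R/2"
  define \<omega> where "\<omega> = cis (2 * pi / m)"
  have \<epsilon>: "0 < \<epsilon>" using R by (simp add: \<epsilon>_def)
  have n\<omega>: "norm \<omega> = 1" by (simp add: \<omega>_def)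
  define node where "node k = of_real \<epsilon> * \<omega> ^ k" for k :: nat
  define a where "a n = (deriv ^^ n) f 0 / fact n" for n
  define L where "L k = (\<Sum>l<m. (z / of_real \<epsilon>) ^ l / \<omega> ^ (k * l)) / of_nat m" for k
  have L1: "norm (L k) \<le> 1" for k
  proof -
    have "norm (\<Sum>l<m. (z / of_real \<epsilon>) ^ l / \<omega> ^ (k * l)) \<le> (\<Sum>l<m. 1)"
    proof (rule sum_norm_le)
      fix l
      have "(norm z / \<epsilon>) ^ l \<le> 1" using z \<epsilon> by (intro power_le_one) (auto simp: \<epsilon>_def)
      then show "norm ((z / of_real \<epsilon>) ^ l / \<omega> ^ (k * l)) \<le> 1"
        using \<epsilon> by (simp add: norm_divide norm_power n\<omega>)
    qed
    then show ?thesis using m by (simp add: L_def norm_divide)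
  qed
  have hol: "f holomorphic_on cball 0 R" using f holomorphic_on_subset by blast
  have a: "norm (a n) \<le> B / R ^ n" for n
  proof -
    have "norm ((deriv ^^ n) f 0) \<le> fact n * B / R ^ n"
      by (rule Cauchy_inequality) (use hol R bound holomorphic_on_imp_continuous_on
        holomorphic_on_subset[OF hol ball_subset_cball] in auto)
    then show ?thesis by (simp add: a_def norm_divide field_simps)
  qed
  have sums: "(\<lambda>n. a n * t ^ n) sums f t" if "norm t < R" for t
    using holomorphic_power_series[OF holomorphic_on_subset[OF hol ball_subset_cball], of t] that
    by (simp add: a_def)
  have nnode: "norm (node k) = \<epsilon>" for k using \<epsilon> by (simp add: node_def norm_mult norm_power n\<omega>)
  have node_lt: "norm (node k) < R" for k unfolding nnode using R by (simp add: \<epsilon>_def)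
  define e where "e n = z ^ n - (\<Sum>k<m. L k * node k ^ n)" for n
  have "(\<lambda>n. a n * z ^ n - (\<Sum>k<m. L k * (a n * node k ^ n))) sums (f z - (\<Sum>k<m. L k * f (node k)))"
    by (intro sums_diff sums_sum sums_mult sums) (use z R node_lt in \<open>auto\<close>)
  then have sums_e: "(\<lambda>n. a n * e n) sums (f z - (\<Sum>k<m. L k * f (node k)))"
    by (simp add: e_def right_diff_distrib sum_distrib_left mult_ac)
  have e0: "e n = 0" if n: "n < m" for n
  proof -
    have "(\<Sum>k<m. L k * node k ^ n)
      = (\<Sum>k<m. \<Sum>l<m. (of_real \<epsilon> ^ n * (z / of_real \<epsilon>) ^ l / of_nat m) * (\<omega> ^ (k * n) / \<omega> ^ (k * l)))"
      by (simp add: L_def node_def sum_distrib_left sum_distrib_right sum_divide_distrib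
          power_mult_distrib power_mult[symmetric] field_simps)
    also have "\<dots> = (\<Sum>l<m. (of_real \<epsilon> ^ n * (z / of_real \<epsilon>) ^ l / of_nat m) * (\<Sum>k<m. \<omega> ^ (k * n) / \<omega> ^ (k * l)))"
      unfolding sum_distrib_left by (rule sum.swap)
    also have "\<dots> = (\<Sum>l<m. if l = n then of_real \<epsilon> ^ n * (z / of_real \<epsilon>) ^ l else 0)"
      using sum_root_of_unity_powers[OF m \<omega>_def n] m by (intro sum.cong) auto
    also have "\<dots> = z ^ n" using n \<epsilon> by (simp add: power_divide)
    finally show ?thesis by (simp add: e_def)
  qed
  have en: "norm (e n) \<le> (real m + 1) * \<epsilon> ^ n" for n
  proof -
    have "norm (e n) \<le> norm (z ^ n) + norm (\<Sum>k<m. L k * node k ^ n)"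
      unfolding e_def by (rule norm_triangle_ineq4)
    also have "\<dots> \<le> \<epsilon> ^ n + (\<Sum>k<m. \<epsilon> ^ n)"
    proof (intro add_mono sum_norm_le)
      show "norm (z ^ n) \<le> \<epsilon> ^ n" using z by (simp add: norm_power power_mono \<epsilon>_def)
      show "norm (L k * node k ^ n) \<le> \<epsilon> ^ n" for k
        using mult_right_mono[OF L1[of k], of "\<epsilon> ^ n"] \<epsilon> by (simp add: norm_mult norm_power nnode)
    qed
    finally show ?thesis by (simp add: algebra_simps)
  qed
  have "norm (f 0) \<le> B" using R by (intro bound) simp
  then have B: "0 \<le> B" by (rule order_trans[OF norm_ge_zero])
  define c where "c n = B * (real m + 1) / 2 ^ m * (1/2) ^ n" for n
  have "(\<lambda>n. a (n + m) * e (n + m)) sums (f z - (\<Sum>k<m. L k * f (node k)) - (\<Sum>n<m. a n * e n))"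
    using sums_e by (rule sums_split_initial_segment)
  then have sums2: "(\<lambda>n. a (n + m) * e (n + m)) sums (f z - (\<Sum>k<m. L k * f (node k)))"
    by (simp add: e0)
  \<comment> \<open>A geometric series with ratio \<open>1/2\<close>, starting at the exponent \<open>m\<close>.\<close>
  have "c sums (B * (real m + 1) / 2 ^ m * (1 / (1 - 1/2)))"
    unfolding c_def by (intro sums_mult geometric_sums) simp
  then have csums: "c sums (B * (2 * (real m + 1) / 2 ^ m))" by (simp add: mult_ac)
  have le: "norm (a (n + m) * e (n + m)) \<le> c n" for n
  proof -
    have "norm (a (n + m) * e (n + m)) \<le> (B / R ^ (n + m)) * ((real m + 1) * \<epsilon> ^ (n + m))"
      unfolding norm_mult by (intro mult_mono a en) (use B R in auto)
    also have "\<dots> = c n" using R by (simp add: c_def \<epsilon>_def power_divide power_add field_simps)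
    finally show ?thesis .
  qed
  have "norm (f z - (\<Sum>k<m. L k * f (node k))) \<le> B * (2 * (real m + 1) / 2 ^ m)"
  proof -
    have "norm (suminf (\<lambda>n. a (n + m) * e (n + m))) \<le> suminf c"
      by (rule norm_suminf_le[OF le]) (use csums in \<open>simp add: sums_iff\<close>)
    then show ?thesis by (simp only: sums_unique[OF sums2] sums_unique[OF csums])
  qed
  moreover have "norm (\<Sum>k<m. L k * f (node k)) \<le> real m * b"
  proof -
    have "norm (\<Sum>k<m. L k * f (node k)) \<le> (\<Sum>k<m. b)"
    proof (rule sum_norm_le)
      fix k assume "k \<in> {..<m}"
      then have "norm (f (node k)) \<le> b"
        by (intro nodes) (auto simp: unity_nodes_def node_def \<epsilon>_def \<omega>_def)
      then have "norm (L k) * norm (f (node k)) \<le> 1 * b"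
        using L1 by (intro mult_mono) auto
      then show "norm (L k * f (node k)) \<le> b" by (simp add: norm_mult)
    qed
    then show ?thesis by simp
  qed
  ultimately show ?thesis
    using norm_triangle_ineq[of "f z - (\<Sum>k<m. L k * f (node k))" "\<Sum>k<m. L k * f (node k)"] by simp
qed

lemma norm_vec_le_card:
  fixes z :: "complex ^ 'n" and R :: real
  assumes "\<And>j. norm (z $ j) \<le> R"
  shows "norm z \<le> CARD('n) * R"
proof -
  have "norm z \<le> (\<Sum>j\<in>UNIV. norm (z $ j))" unfolding norm_vec_def by (rule L2_set_le_sum) simp
  also have "\<dots> \<le> (\<Sum>j\<in>(UNIV::'n set). R)" by (intro sum_mono assms)
  finally show ?thesis by simp
qed

text \<open>
  A Schwarz lemma for grids. Free the coordinates one after the other: when the coordinates in \<open>J\<close> range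
  over the disc of radius \<open>R/2\<close> and the remaining ones over the nodes, freeing one more multiplies the
  bound by \<open>m\<close> and adds the error of interpolation in one variable.
\<close>

lemma vanishing_on_grid_small:
  fixes F :: "complex ^ 'n \<Rightarrow> complex" and R :: real
  assumes F: "holo_on F U" "open U" "cball x (CARD('n) * R) \<subseteq> U" and R: "0 < R" and m: "0 < m"
    and bound: "\<And>z. (\<And>j. norm (z $ j) \<le> R) \<Longrightarrow> norm (F (x + z)) \<le> B"
    and grid: "\<And>z. (\<And>j. z $ j \<in> unity_nodes m (R/2)) \<Longrightarrow> F (x + z) = 0"
    and z: "\<And>j. norm (z $ j) \<le> R/2"
  shows "norm (F (x + z)) \<le> B * (2 * (real m + 1) / 2 ^ m) * (CARD('n) * m ^ CARD('n))"
proof -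
  define \<tau> where "\<tau> = B * (2 * (real m + 1) / 2 ^ m)"
  have "norm (F (x + 0)) \<le> B" using R by (intro bound) simp
  then have B: "0 \<le> B" by (rule order_trans[OF norm_ge_zero])
  then have \<tau>: "0 \<le> \<tau>" by (simp add: \<tau>_def)
  have node: "norm t \<le> R/2" if "t \<in> unity_nodes m (R/2)" for t
    using that R by (auto simp: unity_nodes_def norm_mult norm_power)
  have step: "norm (F (x + z)) \<le> card J * m ^ card J * \<tau>"
    if "finite J" "\<And>j. j \<in> J \<Longrightarrow> norm (z $ j) \<le> R/2" "\<And>j. j \<notin> J \<Longrightarrow> z $ j \<in> unity_nodes m (R/2)"
    for J z
    using that
  proof (induction J arbitrary: z rule: finite_induct)
    case empty
    then show ?case using grid by simp
  next
    case (insert i J)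
    define f where "f t = F ((x + (\<chi> j. if j = i then 0 else z $ j)) + t *s axis i 1)" for t
    have line: "(\<chi> j. if j = i then 0 else z $ j) + t *s axis i 1 = (\<chi> j. if j = i then t else z $ j)" for t
      by (auto simp: vec_eq_iff axis_def)
    have f: "f t = F (x + (\<chi> j. if j = i then t else z $ j))" for t
      by (simp add: f_def add.assoc line)
    have zle: "norm (z $ j) \<le> R/2" if "j \<noteq> i" for j
      using insert.prems that node by (cases "j \<in> J") auto
    have zR: "norm (z $ j) \<le> R" if "j \<noteq> i" for j
      using zle[OF that] R by simp
    define S where "S = {t. (x + (\<chi> j. if j = i then 0 else z $ j)) + t *s axis i 1 \<in> U}"
    have "norm (f (z $ i)) \<le> B * (2 * (real m + 1) / 2 ^ m) + real m * (card J * m ^ card J * \<tau>)"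
    proof (rule interpolation_error[where f=f and S=S and R=R and z="z $ i" and m=m])
      show "f holomorphic_on S" unfolding f_def S_def by (rule holo_on_line[OF F(1)])
      have "continuous_on UNIV (\<lambda>t. (x + (\<chi> j. if j = i then 0 else z $ j)) + t *s axis i (1::complex))"
        using bounded_linear_scalar_mult_left by (intro continuous_intros linear_continuous_on)
      then show "open S" using open_vimage[OF F(2)] by (auto simp: S_def vimage_def)
      show "cball 0 R \<subseteq> S"
      proof
        fix t :: complex assume "t \<in> cball 0 R"
        then have "norm (\<chi> j. if j = i then t else z $ j) \<le> CARD('n) * R"
          using zR by (intro norm_vec_le_card) auto
        then have "x + (\<chi> j. if j = i then t else z $ j) \<in> U"
          using F(3) by (auto simp: subset_iff dist_norm)
        then show "t \<in> S" by (simp add: S_def add.assoc line)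
      qed
      show "norm (f t) \<le> B" if "norm t \<le> R" for t
        unfolding f using that zR by (intro bound) auto
      show "norm (f t) \<le> card J * m ^ card J * \<tau>" if "t \<in> unity_nodes m (R/2)" for t
        unfolding f using that insert.prems insert.hyps by (intro insert.IH) auto
      show "norm (z $ i) \<le> R/2" using insert.prems by simp
    qed (use R m in auto)
    also have "f (z $ i) = F (x + z)"
      unfolding f by (rule arg_cong[where f=F]) (auto simp: vec_eq_iff)
    also have "B * (2 * (real m + 1) / 2 ^ m) + real m * (card J * m ^ card J * \<tau>)
      \<le> real m ^ Suc (card J) * \<tau> + real m * (card J * m ^ card J * \<tau>)"
    proof -
      have "1 * \<tau> \<le> real m ^ Suc (card J) * \<tau>" using m \<tau> by (intro mult_right_mono one_le_power) auto
      then show ?thesis by (simp add: \<tau>_def)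
    qed
    also have "\<dots> = card (insert i J) * m ^ card (insert i J) * \<tau>"
      using insert.hyps by (simp add: algebra_simps)
    finally show ?case by simp
  qed
  from step[of UNIV z] z show ?thesis by (simp add: \<tau>_def mult_ac)
qed

section \<open>Local quotient representations\<close>

text \<open>
  A local representation \<open>f = p/q\<close> on \<open>ball a (2 * \<rho>)\<close>. The radius \<open>2 * \<rho>\<close> leaves room for balls of radius
  below \<open>\<rho>\<close> about the points of \<open>ball a \<rho>\<close>. The bound \<open>1\<close> on numerator and denominator gives the
  logarithms of moduli a definite sign.
\<close>

definition normalised_quotient ::
  "complex ^ 'n \<Rightarrow> real \<Rightarrow> (complex ^ 'n \<Rightarrow> complex) \<Rightarrow> (complex ^ 'n) set \<Rightarrow>
   (complex ^ 'n \<Rightarrow> complex) \<Rightarrow> (complex ^ 'n \<Rightarrow> complex) \<Rightarrow> bool" where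
  "normalised_quotient a \<rho> f G p q \<longleftrightarrow>
     holo_on p (ball a (2 * \<rho>)) \<and> holo_on q (ball a (2 * \<rho>)) \<and>
     (\<forall>w\<in>ball a (2 * \<rho>). norm (p w) \<le> 1 \<and> norm (q w) \<le> 1 \<and> (q w \<noteq> 0 \<longrightarrow> w \<in> G \<and> f w = p w / q w)) \<and>
     (\<integral>\<^sup>+w\<in>ball a (2 * \<rho>). neglog (q w) \<partial>lborel) < \<infinity>"

lemma normalised_quotient_mono:
  assumes "normalised_quotient a \<rho> f G p q" "\<rho>' \<le> \<rho>"
  shows "normalised_quotient a \<rho>' f G p q"
proof -
  have sub: "ball a (2 * \<rho>') \<subseteq> ball a (2 * \<rho>)" using assms(2) by auto
  have "(\<integral>\<^sup>+w\<in>ball a (2 * \<rho>'). neglog (q w) \<partial>lborel) \<le> (\<integral>\<^sup>+w\<in>ball a (2 * \<rho>). neglog (q w) \<partial>lborel)"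
    using sub by (intro nn_integral_mono mult_left_mono) (auto simp: indicator_def)
  moreover have "w \<in> ball a (2 * \<rho>)" if "w \<in> ball a (2 * \<rho>')" for w using sub that by blast
  ultimately show ?thesis
    using assms(1) holo_on_subset[OF _ sub] unfolding normalised_quotient_def
    by (auto intro: le_less_trans simp del: mem_ball)
qed

text \<open>
  Divide numerator and denominator by a common bound of their moduli on a compact ball about \<open>a\<close>. The
  logarithm is integrable on a smaller ball about \<open>a\<close> because this is covered by a ball centred at a
  nearby point where \<open>q\<close> does not vanish.
\<close>

lemma normalised_quotient_exists:
  fixes a :: "complex ^ 'n"
  assumes U: "open U" "a \<in> U" and p: "holo_on p U" and q: "holo_on q U"
    and nz: "\<And>V. open V \<Longrightarrow> a \<in> V \<Longrightarrow> \<exists>w\<in>V \<inter> U. q w \<noteq> 0"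
    and f: "\<And>w. w \<in> U \<Longrightarrow> q w \<noteq> 0 \<Longrightarrow> w \<in> G \<and> f w = p w / q w"
  shows "\<exists>\<rho>>0. \<exists>p q. normalised_quotient a \<rho> f G p q"
proof -
  obtain e where e: "0 < e" "cball a e \<subseteq> U" using U open_contains_cball by blast
  have bdd: "\<exists>B. \<forall>w\<in>cball a e. norm (h w) \<le> B" if "holo_on h U" for h :: "complex ^ 'n \<Rightarrow> complex"
  proof -
    have "continuous_on (cball a e) h"
      using holo_on_continuous_on[OF that] e(2) continuous_on_subset by blast
    then have "compact (h ` cball a e)" by (rule compact_continuous_image) simp
    then have "bounded (h ` cball a e)" by (rule compact_imp_bounded)
    then show ?thesis unfolding bounded_iff by blast
  qed
  obtain B where B: "\<And>w. w \<in> cball a e \<Longrightarrow> norm (p w) \<le> B" using bdd[OF p] by blast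
  obtain B' where B': "\<And>w. w \<in> cball a e \<Longrightarrow> norm (q w) \<le> B'" using bdd[OF q] by blast
  define M where "M = max 1 (max B B')"
  have M: "M > 0" "B \<le> M" "B' \<le> M" by (auto simp: M_def)
  define p' where "p' w = (1 / of_real M) * p w" for w
  define q' where "q' w = (1 / of_real M) * q w" for w
  have hol: "holo_on p' U" "holo_on q' U"
    unfolding p'_def q'_def by (intro holo_on_mult holo_on_const p q)+
  have le1: "norm (p' w) \<le> 1" "norm (q' w) \<le> 1" if "w \<in> cball a e" for w
    using B[OF that] B'[OF that] M by (auto simp: p'_def q'_def norm_mult norm_divide)
  define \<rho> where "\<rho> = e / 8"
  have \<rho>: "0 < \<rho>" using e by (simp add: \<rho>_def)
  have "\<exists>w\<in>ball a \<rho> \<inter> U. q w \<noteq> 0" using \<rho> by (intro nz) auto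
  then obtain w where w: "w \<in> ball a \<rho>" "q' w \<noteq> 0" using M by (auto simp: q'_def)
  have sub1: "ball a (2 * \<rho>) \<subseteq> ball w (3 * \<rho>)"
  proof
    fix x assume "x \<in> ball a (2 * \<rho>)"
    then show "x \<in> ball w (3 * \<rho>)" using w(1) dist_triangle[of w x a] by (simp add: dist_commute)
  qed
  have sub2: "cball w (3 * \<rho>) \<subseteq> cball a e"
  proof
    fix x assume "x \<in> cball w (3 * \<rho>)"
    then show "x \<in> cball a e" using w(1) dist_triangle[of a x w] \<rho> by (simp add: \<rho>_def)
  qed
  have "(\<integral>\<^sup>+w\<in>ball a (2 * \<rho>). neglog (q' w) \<partial>lborel) \<le> (\<integral>\<^sup>+x\<in>ball w (3 * \<rho>). neglog (q' x) \<partial>lborel)"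
    using sub1 by (intro nn_integral_mono mult_left_mono) (auto simp: indicator_def)
  also have "\<dots> < \<infinity>"
  proof (rule neglog_ball_integral_finite[OF hol(2) U(1)])
    show "cball w (3 * \<rho>) \<subseteq> U" using sub2 e(2) by blast
    show "norm (q' x) \<le> 1" if "x \<in> ball w (3 * \<rho>)" for x
      using that sub2 ball_subset_cball by (intro le1) blast
  qed (use \<rho> w in auto)
  finally have int: "(\<integral>\<^sup>+w\<in>ball a (2 * \<rho>). neglog (q' w) \<partial>lborel) < \<infinity>" .
  have sub3: "ball a (2 * \<rho>) \<subseteq> cball a e" using \<rho> by (auto simp: \<rho>_def)
  have sub4: "ball a (2 * \<rho>) \<subseteq> U" using sub3 e(2) by blast
  have "normalised_quotient a \<rho> f G p' q'"
    unfolding normalised_quotient_def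
  proof (intro conjI ballI impI)
    show "holo_on p' (ball a (2 * \<rho>))" "holo_on q' (ball a (2 * \<rho>))"
      using hol sub4 holo_on_subset by blast+
    fix x assume x: "x \<in> ball a (2 * \<rho>)"
    then have xe: "x \<in> cball a e" and xU: "x \<in> U" using sub3 sub4 by blast+
    show "norm (p' x) \<le> 1" "norm (q' x) \<le> 1" using le1[OF xe] by auto
    assume nz': "q' x \<noteq> 0"
    then have "q x \<noteq> 0" by (auto simp: q'_def)
    from f[OF xU this] show "x \<in> G" "f x = p' x / q' x" using M by (auto simp: p'_def q'_def)
  qed (rule int)
  then show ?thesis using \<rho> by blast
qed

lemma neglog_indicator_measurable:
  assumes "normalised_quotient a \<rho> f G p q" "0 < \<rho>" "B \<subseteq> ball a (2 * \<rho>)" "B \<in> sets borel"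
  shows "(\<lambda>w. neglog (q w) * indicator B w) \<in> borel_measurable borel"
  using assms(1,3) holo_on_continuous_on[of q "ball a (2 * \<rho>)"] unfolding normalised_quotient_def
  by (intro borel_measurable_compose_continuous_on assms(4)) (auto intro: continuous_on_subset)

lemma normalised_quotient_AE:
  assumes nq: "normalised_quotient a \<rho> f G p q" "0 < \<rho>"
  shows "AE w in lborel. w \<in> ball a (2 * \<rho>) \<longrightarrow> q w \<noteq> 0"
proof -
  have "AE w in lborel. neglog (q w) * indicator (ball a (2 * \<rho>)) w \<noteq> \<infinity>"
    using nq neglog_indicator_measurable[OF nq, of "ball a (2 * \<rho>)"]
    by (intro nn_integral_PInf_AE) (auto simp: normalised_quotient_def)
  then show ?thesis
    by eventually_elim (auto simp: neglog_def)
qed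

text \<open>
  The factor by which \<open>vanishing_on_grid_small\<close> decreases the maximum decays exponentially in \<open>m\<close>; half
  of the exponent \<open>ln 2\<close> is given away for the polynomial factors.
\<close>

lemma eventually_grid_bound:
  "\<exists>M. \<forall>m::nat\<ge>M. 2 * (real m + 1) / 2 ^ m * (real N * real m ^ N) \<le> exp (- (ln 2 / 2 * real m))"
proof -
  define c where "c = ln (2::real) / 2"
  have c: "0 < c" by (simp add: c_def)
  have "filterlim (\<lambda>m::nat. c * real m) at_top sequentially"
    using c by (intro filterlim_tendsto_pos_mult_at_top[OF tendsto_const] filterlim_real_sequentially)
  from filterlim_compose[OF tendsto_power_div_exp_0[of "Suc N"] this]
  have "(\<lambda>m. (c * real m) ^ Suc N / exp (c * real m)) \<longlonglongrightarrow> 0" by simp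
  moreover define b where "b = c ^ Suc N / (4 * (real N + 1))"
  have "0 < b" using c by (auto simp: b_def)
  ultimately have "eventually (\<lambda>m. (c * real m) ^ Suc N / exp (c * real m) < b) sequentially"
    by (rule order_tendstoD(2))
  then obtain M0 where M0: "\<And>m. m \<ge> M0 \<Longrightarrow> (c * real m) ^ Suc N / exp (c * real m) < b"
    by (auto simp: eventually_sequentially)
  have "2 * (real m + 1) / 2 ^ m * (real N * real m ^ N) \<le> exp (- (c * real m))" if m: "m \<ge> max 1 M0" for m
  proof -
    have m1: "1 \<le> m" "M0 \<le> m" using m by auto
    have E: "0 < exp (c * real m)" by simp
    have e2: "2 ^ m = exp (c * real m) * exp (c * real m)"
    proof -
      have "exp (c * real m) * exp (c * real m) = exp (real m * ln 2)"
        by (simp add: c_def mult_exp_exp algebra_simps)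
      also have "\<dots> = 2 ^ m" by (simp add: exp_of_nat_mult)
      finally show ?thesis by simp
    qed
    have "(c * real m) ^ Suc N < b * exp (c * real m)" using M0[OF m1(2)] E by (simp add: field_simps)
    then have "c ^ Suc N * (real m ^ Suc N * (4 * (real N + 1))) < c ^ Suc N * exp (c * real m)"
      by (simp add: b_def power_mult_distrib field_simps)
    then have 1: "real m ^ Suc N * (4 * (real N + 1)) < exp (c * real m)"
      by (rule mult_less_cancel_left_pos[THEN iffD1, rotated]) (use c in simp)
    have "2 * (real m + 1) * (real N * real m ^ N) \<le> (4 * real m) * ((real N + 1) * real m ^ N)"
    proof (rule mult_mono)
      show "2 * (real m + 1) \<le> 4 * real m" using m1 by simp
      show "real N * real m ^ N \<le> (real N + 1) * real m ^ N" by (intro mult_right_mono) auto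
    qed auto
    also have "\<dots> = real m ^ Suc N * (4 * (real N + 1))" by (simp add: algebra_simps)
    finally have 2: "2 * (real m + 1) * (real N * real m ^ N) \<le> exp (c * real m)" using 1 by linarith
    have "2 * (real m + 1) / 2 ^ m * (real N * real m ^ N)
      = (2 * (real m + 1) * (real N * real m ^ N)) / (exp (c * real m) * exp (c * real m))"
      unfolding e2 by simp
    also have "\<dots> \<le> exp (c * real m) / (exp (c * real m) * exp (c * real m))"
      by (intro divide_right_mono 2) auto
    also have "\<dots> = exp (- (c * real m))" by (simp add: exp_minus field_simps)
    finally show ?thesis .
  qed
  then show ?thesis unfolding c_def by blast
qed

section \<open>Polynomials in meromorphic functions on a torus\<close>

text \<open>
  Meromorphic functions \<open>f i\<close> on the torus, with \<open>G i\<close> the set of points where \<open>f i\<close> is regular.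
\<close>

locale torus_functions = lattice_tile \<Lambda> D
  for \<Lambda> D :: "(complex ^ 'n) set" +
  fixes I :: "'i set" and f :: "'i \<Rightarrow> complex ^ 'n \<Rightarrow> complex" and G :: "'i \<Rightarrow> (complex ^ 'n) set"
  assumes finite_I: "finite I"
    and open_G: "i \<in> I \<Longrightarrow> open (G i)"
    and holo_f: "i \<in> I \<Longrightarrow> holo_on (f i) (G i)"
    and periodic_f: "i \<in> I \<Longrightarrow> z \<in> G i \<Longrightarrow> \<omega> \<in> \<Lambda> \<Longrightarrow> z + \<omega> \<in> G i \<and> f i (z + \<omega>) = f i z"
    and quotient_f: "i \<in> I \<Longrightarrow> \<exists>\<rho>>0. \<exists>p q. normalised_quotient a \<rho> (f i) (G i) p q"
begin

definition common_domain :: "(complex ^ 'n) set" where "common_domain = (\<Inter>i\<in>I. G i)"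

text \<open>
  Exponents bounded by \<open>d\<close> in each variable, so that \<open>(\<Prod>i\<in>I. q i ^ d)\<close> clears all denominators.
\<close>

definition monomials :: "nat \<Rightarrow> ('i \<Rightarrow> nat) set" where "monomials d = I \<rightarrow>\<^sub>E {..d}"

definition poly_val :: "nat \<Rightarrow> (('i \<Rightarrow> nat) \<Rightarrow> complex) \<Rightarrow> complex ^ 'n \<Rightarrow> complex" where
  "poly_val d c z = (\<Sum>\<beta>\<in>monomials d. c \<beta> * (\<Prod>i\<in>I. f i z ^ \<beta> i))"

text \<open>
  This is \<open>ln\<^sup>+ (|P(f)| / \<delta>)\<close>, continued by \<open>0\<close> to the points where some \<open>f i\<close> is not regular. Cutting off
  at height \<open>ln \<delta>\<close> makes the function nonnegative and removes the zeros of \<open>P(f)\<close>, which includes the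
  case that \<open>P(f)\<close> vanishes identically.
\<close>

definition log_level :: "nat \<Rightarrow> (('i \<Rightarrow> nat) \<Rightarrow> complex) \<Rightarrow> real \<Rightarrow> complex ^ 'n \<Rightarrow> ennreal" where
  "log_level d c \<delta> z = ennreal (ln (norm (poly_val d c z) / \<delta>)) * indicator common_domain z"

lemma finite_monomials: "finite (monomials d)"
  unfolding monomials_def using finite_I by (rule finite_PiE) simp

lemma open_common_domain: "open common_domain"
  unfolding common_domain_def using finite_I open_G by blast

lemma holo_poly_val: "holo_on (poly_val d c) common_domain"
  unfolding poly_val_def
  by (intro holo_on_sum holo_on_mult holo_on_const holo_on_prod holo_on_power holo_on_subset[OF holo_f])
    (auto simp: common_domain_def)

lemma common_domain_shift: "z + \<omega> \<in> common_domain \<longleftrightarrow> z \<in> common_domain" if "\<omega> \<in> \<Lambda>"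
proof
  show "z \<in> common_domain \<Longrightarrow> z + \<omega> \<in> common_domain" using periodic_f that by (auto simp: common_domain_def)
  assume "z + \<omega> \<in> common_domain"
  then have "(z + \<omega>) + - \<omega> \<in> G i" if "i \<in> I" for i
    using periodic_f[OF that, of "z + \<omega>" "- \<omega>"] uminus_mem[OF \<open>\<omega> \<in> \<Lambda>\<close>] that by (auto simp: common_domain_def)
  then show "z \<in> common_domain" by (auto simp: common_domain_def)
qed

lemma log_level_periodic: "periodic (log_level d c \<delta>)"
  unfolding periodic_def
proof (intro allI ballI)
  fix z \<omega> assume \<omega>: "\<omega> \<in> \<Lambda>"
  show "log_level d c \<delta> (z + \<omega>) = log_level d c \<delta> z"
  proof (cases "z \<in> common_domain")
    case True
    then have "poly_val d c (z + \<omega>) = poly_val d c z"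
      unfolding poly_val_def using periodic_f \<omega>
      by (intro sum.cong prod.cong refl arg_cong2[of _ _ _ _ "(*)"] arg_cong2[of _ _ _ _ "(^)"]) (auto simp: common_domain_def)
    then show ?thesis using common_domain_shift[OF \<omega>] by (simp add: log_level_def indicator_def)
  next
    case False
    then show ?thesis using common_domain_shift[OF \<omega>] by (simp add: log_level_def)
  qed
qed

lemma log_level_measurable [measurable]: "log_level d c \<delta> \<in> borel_measurable borel"
proof -
  have "(\<lambda>z. ennreal (ln (norm (poly_val d c z) / \<delta>)) * indicator common_domain z) \<in> borel_measurable borel"
    by (rule borel_measurable_compose_continuous_on[of common_domain _ "\<lambda>x. ennreal (ln (norm x / \<delta>))"])
      (use open_common_domain holo_on_continuous_on[OF holo_poly_val] in auto)
  then show ?thesis by (simp add: log_level_def[abs_def])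
qed

text \<open>
  Near any point the denominators are nonzero almost everywhere, hence simultaneously so at some point.
\<close>

lemma common_domain_nonempty: "common_domain \<noteq> {}"
proof -
  obtain \<rho> p q where q: "\<And>i. i \<in> I \<Longrightarrow> 0 < \<rho> i" "\<And>i. i \<in> I \<Longrightarrow> normalised_quotient 0 (\<rho> i) (f i) (G i) (p i) (q i)"
    using quotient_f[of _ 0] by metis
  define \<rho>0 where "\<rho>0 = Min (insert 1 (\<rho> ` I))"
  have \<rho>0: "0 < \<rho>0" "\<And>i. i \<in> I \<Longrightarrow> \<rho>0 \<le> \<rho> i"
    using q(1) finite_I by (auto simp: \<rho>0_def)
  have AE: "AE w in lborel. \<forall>i\<in>I. w \<in> ball 0 (2 * \<rho> i) \<longrightarrow> q i w \<noteq> 0"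
    by (intro AE_finite_allI finite_I normalised_quotient_AE[OF q(2) q(1)])
  have "\<exists>w. w \<in> ball 0 \<rho>0 \<and> (\<forall>i\<in>I. w \<in> ball 0 (2 * \<rho> i) \<longrightarrow> q i w \<noteq> 0)"
  proof (rule ccontr)
    assume neg: "\<not> ?thesis"
    have "AE w in lborel. w \<notin> ball (0::complex ^ 'n) \<rho>0"
      using AE by eventually_elim (use neg in blast)
    then have "emeasure lborel (ball (0::complex ^ 'n) \<rho>0) = 0"
      by (subst (asm) AE_iff_measurable[of "ball 0 \<rho>0"]) auto
    then show False using emeasure_lborel_ball_pos[OF \<rho>0(1), of "0::complex ^ 'n"] by simp
  qed
  then obtain w where w: "w \<in> ball 0 \<rho>0" "\<forall>i\<in>I. w \<in> ball 0 (2 * \<rho> i) \<longrightarrow> q i w \<noteq> 0"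
    by blast
  have "w \<in> G i" if i: "i \<in> I" for i
  proof -
    have "w \<in> ball 0 (2 * \<rho> i)" using w(1) \<rho>0(2)[OF i] q(1)[OF i] by auto
    then show ?thesis using w(2) i q(2)[OF i] unfolding normalised_quotient_def by blast
  qed
  then show ?thesis by (auto simp: common_domain_def)
qed

end

lemma ennreal_le_add:
  assumes "a \<le> b + c" "0 \<le> c"
  shows "ennreal a \<le> ennreal b + ennreal c"
proof (cases "0 \<le> b")
  case True
  then show ?thesis using assms ennreal_leI[OF assms(1)] by (simp add: ennreal_plus)
next
  case False
  then show ?thesis using assms by (simp add: ennreal_neg ennreal_leI)
qed

lemma sum_neglog_eq_top:
  assumes "finite I" "i \<in> I" "x i = 0"
  shows "(\<Sum>i\<in>I. neglog (x i)) = top"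
proof -
  have "neglog (x i) \<le> (\<Sum>i\<in>I. neglog (x i))" by (rule member_le_sum) (use assms in auto)
  then show ?thesis using assms by (simp add: neglog_def top_unique)
qed

lemma sum_neglog_eq:
  assumes "\<And>i. i \<in> I \<Longrightarrow> x i \<noteq> 0" "\<And>i. i \<in> I \<Longrightarrow> norm (x i) \<le> 1"
  shows "of_nat d * (\<Sum>i\<in>I. neglog (x i)) = ennreal (d * (\<Sum>i\<in>I. - ln (norm (x i))))"
proof -
  have "(\<Sum>i\<in>I. neglog (x i)) = (\<Sum>i\<in>I. ennreal (- ln (norm (x i))))"
    using assms by (intro sum.cong) (auto simp: neglog_def)
  also have "\<dots> = ennreal (\<Sum>i\<in>I. - ln (norm (x i)))"
    using assms by (intro sum_ennreal) auto
  finally show ?thesis by (simp add: ennreal_mult' ennreal_of_nat_eq_real_of_nat)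
qed

context torus_functions
begin

lemma clear_denominators:
  assumes "\<And>i. i \<in> I \<Longrightarrow> q i \<noteq> 0 \<and> f i w = p i / q i"
  shows "(\<Sum>\<beta>\<in>monomials d. c \<beta> * (\<Prod>i\<in>I. p i ^ \<beta> i * q i ^ (d - \<beta> i)))
    = poly_val d c w * (\<Prod>i\<in>I. q i ^ d)"
  unfolding poly_val_def sum_distrib_right
proof (rule sum.cong)
  fix \<beta> assume \<beta>: "\<beta> \<in> monomials d"
  have "(\<Prod>i\<in>I. p i ^ \<beta> i * q i ^ (d - \<beta> i)) = (\<Prod>i\<in>I. f i w ^ \<beta> i * q i ^ d)"
  proof (rule prod.cong)
    fix i assume i: "i \<in> I"
    then have "\<beta> i \<le> d" using \<beta> by (auto simp: monomials_def)
    then have "q i ^ d = q i ^ \<beta> i * q i ^ (d - \<beta> i)" by (simp flip: power_add)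
    then show "p i ^ \<beta> i * q i ^ (d - \<beta> i) = f i w ^ \<beta> i * q i ^ d"
      using assms[OF i] by (simp add: power_divide)
  qed simp
  then show "c \<beta> * (\<Prod>i\<in>I. p i ^ \<beta> i * q i ^ (d - \<beta> i)) = c \<beta> * (\<Prod>i\<in>I. f i w ^ \<beta> i) * (\<Prod>i\<in>I. q i ^ d)"
    by (simp add: prod.distrib)
qed simp

text \<open>
  The mean value inequality applies to \<open>F = P(f) \<cdot> (\<Prod>i\<in>I. q i ^ d) / \<delta>\<close>. As \<open>|q i| \<le> 1\<close>, the function \<open>ln\<^sup>+ |F|\<close> is
  bounded by \<open>log_level\<close> almost everywhere, while at \<open>z\<close> the passage from \<open>F\<close> to \<open>P(f) / \<delta>\<close> costs
  \<open>- d \<Sum>\<^sub>i ln |q i z|\<close>.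
\<close>

lemma log_level_le_mean:
  assumes d: "0 < d" and \<delta>: "0 < \<delta>" and s: "0 < s" "s < \<rho>" and z: "z \<in> ball a \<rho>"
    and nq: "\<And>i. i \<in> I \<Longrightarrow> normalised_quotient a \<rho> (f i) (G i) (p i) (q i)"
  shows "log_level d c \<delta> z \<le> ball_mean s (log_level d c \<delta>) z + of_nat d * (\<Sum>i\<in>I. neglog (q i z))"
proof (cases "z \<in> common_domain \<and> (\<forall>i\<in>I. q i z \<noteq> 0) \<and> poly_val d c z \<noteq> 0")
  case False
  then consider "z \<notin> common_domain \<or> poly_val d c z = 0" | i where "i \<in> I" "q i z = 0" by blast
  then show ?thesis
  proof cases
    case 1 then show ?thesis by (auto simp: log_level_def)
  next
    case 2
    then show ?thesis using d by (simp add: sum_neglog_eq_top[OF finite_I] ennreal_mult_top)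
  qed
next
  case True
  define U where "U = ball a (2 * \<rho>)"
  have zU: "cball z s \<subseteq> U"
  proof
    fix x assume "x \<in> cball z s"
    then show "x \<in> U" using z s dist_triangle[of a x z] by (simp add: U_def)
  qed
  have "z \<in> U" using zU s by auto
  define F where "F w = (1 / of_real \<delta>) *
    (\<Sum>\<beta>\<in>monomials d. c \<beta> * (\<Prod>i\<in>I. p i w ^ \<beta> i * q i w ^ (d - \<beta> i)))" for w
  have F: "holo_on F U"
    unfolding F_def using nq
    by (intro holo_on_mult holo_on_const holo_on_sum holo_on_prod holo_on_power)
      (auto simp: normalised_quotient_def U_def)
  have F_eq: "F w = (1 / of_real \<delta>) * (poly_val d c w * (\<Prod>i\<in>I. q i w ^ d))"
    if "w \<in> U" "\<And>i. i \<in> I \<Longrightarrow> q i w \<noteq> 0" for w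
  proof -
    have "\<And>i. i \<in> I \<Longrightarrow> q i w \<noteq> 0 \<and> f i w = p i w / q i w"
      using nq that unfolding normalised_quotient_def U_def by blast
    then show ?thesis unfolding F_def by (subst clear_denominators) auto
  qed
  have Fz: "F z \<noteq> 0" using True \<open>z \<in> U\<close> \<delta> finite_I by (simp add: F_eq)
  have AE: "AE w in lborel. \<forall>i\<in>I. w \<in> ball a (2 * \<rho>) \<longrightarrow> q i w \<noteq> 0"
    using s by (intro AE_finite_allI finite_I normalised_quotient_AE[OF nq]) auto
  have "ennreal (ln (norm (F z))) * emeasure lborel (ball z s)
      \<le> (\<integral>\<^sup>+w\<in>ball z s. ennreal (ln (norm (F w))) \<partial>lborel)"
    by (rule ln_norm_le_ball_integral[OF F _ zU Fz]) (simp add: U_def)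
  also have "\<dots> \<le> (\<integral>\<^sup>+w\<in>ball z s. log_level d c \<delta> w \<partial>lborel)"
  proof (rule nn_integral_mono_AE)
    show "AE w in lborel. ennreal (ln (norm (F w))) * indicator (ball z s) w
      \<le> log_level d c \<delta> w * indicator (ball z s) w"
      using AE
    proof eventually_elim
      case (elim w)
      show ?case
      proof (cases "w \<in> ball z s")
        case True
        then have w: "w \<in> U" using zU by auto
        have qnz: "\<And>i. i \<in> I \<Longrightarrow> q i w \<noteq> 0" using elim w by (auto simp: U_def)
        have "w \<in> common_domain" using qnz w nq unfolding common_domain_def normalised_quotient_def U_def by blast
        have "norm (\<Prod>i\<in>I. q i w ^ d) \<le> 1"
          unfolding prod_norm[symmetric] norm_power
          using nq w by (intro prod_le_1 conjI power_le_one) (auto simp: normalised_quotient_def U_def)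
        then have "norm (F w) \<le> norm (poly_val d c w) / \<delta>"
          using \<delta> mult_left_mono[of "norm (\<Prod>i\<in>I. q i w ^ d)" 1 "norm (poly_val d c w)"]
          by (subst F_eq[OF w]) (auto simp: qnz norm_mult norm_divide divide_right_mono)
        then have "ennreal (ln (norm (F w))) \<le> ennreal (ln (norm (poly_val d c w) / \<delta>))"
          by (cases "F w = 0") (auto intro!: ennreal_leI ln_mono)
        then show ?thesis using \<open>w \<in> common_domain\<close> True by (simp add: log_level_def)
      qed simp
    qed
  qed
  finally have "ennreal (ln (norm (F z))) * emeasure lborel (ball (0::complex ^ 'n) s)
      \<le> (\<integral>\<^sup>+w\<in>ball z s. log_level d c \<delta> w \<partial>lborel)"
    by (simp add: emeasure_lborel_ball_center[of z s 0])
  from divide_right_mono_ennreal[OF this, of "emeasure lborel (ball (0::complex ^ 'n) s)"]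
  have mean: "ennreal (ln (norm (F z))) \<le> ball_mean s (log_level d c \<delta>) z"
    using emeasure_lborel_ball_pos[OF s(1), of "0::complex ^ 'n"] emeasure_lborel_ball_finite[of "0::complex ^ 'n" s]
    by (subst (asm) ennreal_mult_divide_eq) (auto simp: ball_mean_eq)
  have q1: "norm (q i z) \<le> 1" if "i \<in> I" for i
    using nq[OF that] \<open>z \<in> U\<close> by (auto simp: normalised_quotient_def U_def)
  have "norm (F z) = norm (poly_val d c z) / \<delta> * (\<Prod>i\<in>I. norm (q i z) ^ d)"
    using \<open>z \<in> U\<close> True \<delta> by (simp add: F_eq norm_mult norm_divide prod_norm[symmetric] norm_power)
  then have "ln (norm (F z)) = ln (norm (poly_val d c z) / \<delta>) + ln (\<Prod>i\<in>I. norm (q i z) ^ d)"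
  proof -
    assume eq: "norm (F z) = norm (poly_val d c z) / \<delta> * (\<Prod>i\<in>I. norm (q i z) ^ d)"
    have "0 < norm (poly_val d c z) / \<delta>" "0 < (\<Prod>i\<in>I. norm (q i z) ^ d)"
      using True \<delta> by (auto intro!: prod_pos)
    then show ?thesis unfolding eq by (rule ln_mult_pos)
  qed
  also have "ln (\<Prod>i\<in>I. norm (q i z) ^ d) = (\<Sum>i\<in>I. d * ln (norm (q i z)))"
    using True finite_I by (subst ln_prod) (auto simp: ln_realpow)
  finally have "ln (norm (poly_val d c z) / \<delta>) = ln (norm (F z)) + d * (\<Sum>i\<in>I. - ln (norm (q i z)))"
    by (simp add: sum_distrib_left sum_negf)
  then have "ennreal (ln (norm (poly_val d c z) / \<delta>))
    \<le> ennreal (ln (norm (F z))) + ennreal (d * (\<Sum>i\<in>I. - ln (norm (q i z))))"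
    using q1 True by (intro ennreal_le_add mult_nonneg_nonneg sum_nonneg) auto
  also have "ennreal (d * (\<Sum>i\<in>I. - ln (norm (q i z)))) = of_nat d * (\<Sum>i\<in>I. neglog (q i z))"
    using q1 True by (intro sum_neglog_eq[symmetric]) auto
  finally show ?thesis using mean True by (auto simp: log_level_def intro: order_trans add_right_mono)
qed

text \<open>
  A crude bound, whose right-hand side is integrable; it shows that the integral over \<open>D\<close> is finite.
\<close>

lemma log_level_le_neglog:
  assumes d: "0 < d" and \<delta>: "0 < \<delta>" and \<rho>: "0 < \<rho>" and z: "z \<in> ball a \<rho>"
    and nq: "\<And>i. i \<in> I \<Longrightarrow> normalised_quotient a \<rho> (f i) (G i) (p i) (q i)"
  shows "log_level d c \<delta> z
    \<le> ennreal (ln ((1 + (\<Sum>\<beta>\<in>monomials d. norm (c \<beta>))) / \<delta>)) + of_nat d * (\<Sum>i\<in>I. neglog (q i z))"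
proof (cases "z \<in> common_domain \<and> (\<forall>i\<in>I. q i z \<noteq> 0) \<and> poly_val d c z \<noteq> 0")
  case False
  then consider "z \<notin> common_domain \<or> poly_val d c z = 0" | i where "i \<in> I" "q i z = 0" by blast
  then show ?thesis
  proof cases
    case 1 then show ?thesis by (auto simp: log_level_def)
  next
    case 2
    then show ?thesis using d by (simp add: sum_neglog_eq_top[OF finite_I] ennreal_mult_top)
  qed
next
  case True
  define B where "B = 1 + (\<Sum>\<beta>\<in>monomials d. norm (c \<beta>))"
  have B: "B \<ge> 1" by (simp add: B_def sum_nonneg)
  have z2: "z \<in> ball a (2 * \<rho>)" using z \<rho> by auto
  have pq: "norm (p i z) \<le> 1" "norm (q i z) \<le> 1" "f i z = p i z / q i z" if "i \<in> I" for i
    using nq[OF that] z2 True that unfolding normalised_quotient_def by blast+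
  define Q where "Q = (\<Prod>i\<in>I. q i z ^ d)"
  have Q: "Q \<noteq> 0" using True finite_I by (simp add: Q_def)
  have "norm (poly_val d c z * Q)
    = norm (\<Sum>\<beta>\<in>monomials d. c \<beta> * (\<Prod>i\<in>I. p i z ^ \<beta> i * q i z ^ (d - \<beta> i)))"
    unfolding Q_def using True pq(3) by (subst clear_denominators) auto
  also have "\<dots> \<le> (\<Sum>\<beta>\<in>monomials d. norm (c \<beta>))"
  proof (rule sum_norm_le)
    fix \<beta>
    have "norm (\<Prod>i\<in>I. p i z ^ \<beta> i * q i z ^ (d - \<beta> i)) \<le> 1"
      unfolding prod_norm[symmetric] norm_power norm_mult
      using pq by (intro prod_le_1 conjI mult_le_one power_le_one) auto
    then show "norm (c \<beta> * (\<Prod>i\<in>I. p i z ^ \<beta> i * q i z ^ (d - \<beta> i))) \<le> norm (c \<beta>)"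
      by (simp add: norm_mult mult_left_le)
  qed
  finally have "norm (poly_val d c z) * norm Q \<le> B" by (simp add: norm_mult B_def)
  then have "norm (poly_val d c z) \<le> B / norm Q" using Q by (simp add: field_simps)
  then have "ln (norm (poly_val d c z) / \<delta>) \<le> ln (B / norm Q / \<delta>)"
    using True \<delta> B Q by (intro ln_mono divide_right_mono) auto
  also have "\<dots> = ln (B / \<delta>) - ln (norm Q)" using Q B \<delta> by (simp add: ln_div ln_mult)
  also have "ln (norm Q) = (\<Sum>i\<in>I. d * ln (norm (q i z)))"
    unfolding Q_def prod_norm[symmetric] norm_power
    using True finite_I by (subst ln_prod) (auto simp: ln_realpow)
  finally have "ln (norm (poly_val d c z) / \<delta>) \<le> ln (B / \<delta>) + d * (\<Sum>i\<in>I. - ln (norm (q i z)))"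
    by (simp add: sum_distrib_left sum_negf)
  then have "ennreal (ln (norm (poly_val d c z) / \<delta>))
    \<le> ennreal (ln (B / \<delta>)) + ennreal (d * (\<Sum>i\<in>I. - ln (norm (q i z))))"
    using pq True by (intro ennreal_le_add mult_nonneg_nonneg sum_nonneg) auto
  also have "ennreal (d * (\<Sum>i\<in>I. - ln (norm (q i z)))) = of_nat d * (\<Sum>i\<in>I. neglog (q i z))"
    using pq True by (intro sum_neglog_eq[symmetric]) auto
  finally show ?thesis using True by (simp add: log_level_def B_def)
qed

text \<open>
  Finitely many balls on which the \<open>f i\<close> are normalised quotients cover the closure of \<open>D\<close>. The sum \<open>\<kappa>\<close> of
  all the corresponding \<^const>\<open>neglog\<close> terms is integrable, and \<open>K\<close> bounds its integral. It depends
  neither on the polynomial nor on \<open>\<delta>\<close>.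
\<close>

lemma log_level_defect:
  obtains K \<rho>0 where "0 < K" "0 < \<rho>0"
    "\<And>d c \<delta>. 0 < d \<Longrightarrow> 0 < \<delta> \<Longrightarrow> (\<integral>\<^sup>+w\<in>D. log_level d c \<delta> w \<partial>lborel) < \<infinity>"
    "\<And>d c \<delta> s. 0 < d \<Longrightarrow> 0 < \<delta> \<Longrightarrow> 0 < s \<Longrightarrow> s < \<rho>0 \<Longrightarrow>
      (\<integral>\<^sup>+w\<in>D. (log_level d c \<delta> w - ball_mean s (log_level d c \<delta>) w) \<partial>lborel) \<le> ennreal (K * real d)"
proof -
  have "\<exists>\<rho>>0. \<exists>p q. \<forall>i\<in>I. normalised_quotient a \<rho> (f i) (G i) (p i) (q i)" for a
  proof -
    obtain \<rho> p q where q: "\<And>i. i \<in> I \<Longrightarrow> 0 < \<rho> i"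
      "\<And>i. i \<in> I \<Longrightarrow> normalised_quotient a (\<rho> i) (f i) (G i) (p i) (q i)"
      using quotient_f[of _ a] by metis
    define \<rho>0 where "\<rho>0 = Min (insert 1 (\<rho> ` I))"
    have \<rho>0: "0 < \<rho>0" "\<And>i. i \<in> I \<Longrightarrow> \<rho>0 \<le> \<rho> i"
      using q(1) finite_I by (auto simp: \<rho>0_def)
    then show ?thesis using normalised_quotient_mono[OF q(2)] by blast
  qed
  then obtain \<rho> p q where \<rho>: "\<And>a. 0 < \<rho> a"
    and nq: "\<And>a i. i \<in> I \<Longrightarrow> normalised_quotient a (\<rho> a) (f i) (G i) (p a i) (q a i)"
    by metis
  have "compact (closure D)" using bounded_tile by (simp add: compact_eq_bounded_closed bounded_closure)
  moreover have "closure D \<subseteq> (\<Union>a\<in>UNIV. ball a (\<rho> a))"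
    using \<rho> centre_in_ball by blast
  ultimately obtain A where A: "finite A" "closure D \<subseteq> (\<Union>a\<in>A. ball a (\<rho> a))"
    by (metis compactE_image[of "closure D" UNIV "\<lambda>a. ball a (\<rho> a)"] open_ball)
  define \<rho>0 where "\<rho>0 = Min (insert 1 (\<rho> ` A))"
  have \<rho>0: "0 < \<rho>0" "\<And>a. a \<in> A \<Longrightarrow> \<rho>0 \<le> \<rho> a"
    using \<rho> A by (auto simp: \<rho>0_def)
  define \<kappa> where "\<kappa> w = (\<Sum>a\<in>A. \<Sum>i\<in>I. neglog (q a i w) * indicator (ball a (\<rho> a)) w)" for w
  have sub: "ball a (\<rho> a) \<subseteq> ball a (2 * \<rho> a)" for a using \<rho>[of a] by auto
  have meas: "(\<lambda>w. neglog (q a i w) * indicator (ball a (\<rho> a)) w) \<in> borel_measurable borel" if "i \<in> I" for a i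
    by (rule neglog_indicator_measurable[OF nq[OF that] \<rho> sub]) auto
  have [measurable]: "\<kappa> \<in> borel_measurable borel"
    unfolding \<kappa>_def by (intro borel_measurable_sum meas)
  have "(\<integral>\<^sup>+w. \<kappa> w \<partial>lborel) = (\<Sum>a\<in>A. \<Sum>i\<in>I. \<integral>\<^sup>+w\<in>ball a (\<rho> a). neglog (q a i w) \<partial>lborel)"
    unfolding \<kappa>_def using meas by (simp add: nn_integral_sum)
  also have "\<dots> < \<infinity>"
  proof -
    have "(\<integral>\<^sup>+w\<in>ball a (\<rho> a). neglog (q a i w) \<partial>lborel) < \<infinity>" if "i \<in> I" for a i
    proof -
      have "(\<integral>\<^sup>+w\<in>ball a (\<rho> a). neglog (q a i w) \<partial>lborel) \<le> (\<integral>\<^sup>+w\<in>ball a (2 * \<rho> a). neglog (q a i w) \<partial>lborel)"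
        using sub by (intro nn_integral_mono mult_left_mono) (auto simp: indicator_def simp del: mem_ball)
      then show ?thesis using nq[OF that] unfolding normalised_quotient_def by (meson le_less_trans)
    qed
    then show ?thesis using finite_I A by simp
  qed
  finally have \<kappa>fin: "(\<integral>\<^sup>+w. \<kappa> w \<partial>lborel) < \<infinity>" .
  define K where "K = enn2real (\<integral>\<^sup>+w. \<kappa> w \<partial>lborel) + 1"
  have K: "0 < K" "(\<integral>\<^sup>+w. \<kappa> w \<partial>lborel) \<le> ennreal K"
  proof -
    obtain k where k: "(\<integral>\<^sup>+w. \<kappa> w \<partial>lborel) = ennreal k" "0 \<le> k"
      using \<kappa>fin by (cases "\<integral>\<^sup>+w. \<kappa> w \<partial>lborel") auto
    then show "0 < K" "(\<integral>\<^sup>+w. \<kappa> w \<partial>lborel) \<le> ennreal K"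
      by (auto simp: K_def intro: ennreal_leI)
  qed
  have near: "\<exists>a\<in>A. w \<in> ball a (\<rho> a) \<and> (\<Sum>i\<in>I. neglog (q a i w)) \<le> \<kappa> w" if "w \<in> D" for w
  proof -
    have "w \<in> (\<Union>a\<in>A. ball a (\<rho> a))"
      by (rule subsetD[OF A(2) subsetD[OF closure_subset that]])
    then obtain a where a: "a \<in> A" "w \<in> ball a (\<rho> a)" by (rule UN_E)
    have "(\<Sum>i\<in>I. neglog (q a i w) * indicator (ball a (\<rho> a)) w) \<le> \<kappa> w"
      unfolding \<kappa>_def by (rule member_le_sum[OF a(1)]) (simp_all add: A(1))
    then show ?thesis using a by (intro bexI[of _ a]) simp_all
  qed
  have D_fin: "emeasure lborel D < \<infinity>" using bounded_tile by (rule emeasure_bounded_finite)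
  have fin: "(\<integral>\<^sup>+w\<in>D. log_level d c \<delta> w \<partial>lborel) < \<infinity>" if d: "0 < d" and \<delta>: "0 < \<delta>" for d c \<delta>
  proof -
    define L where "L = ennreal (ln ((1 + (\<Sum>\<beta>\<in>monomials d. norm (c \<beta>))) / \<delta>))"
    have "(\<integral>\<^sup>+w\<in>D. log_level d c \<delta> w \<partial>lborel) \<le> (\<integral>\<^sup>+w. L * indicator D w + of_nat d * \<kappa> w \<partial>lborel)"
    proof (rule nn_integral_mono)
      fix w
      show "log_level d c \<delta> w * indicator D w \<le> L * indicator D w + of_nat d * \<kappa> w"
      proof (cases "w \<in> D")
        case True
        then obtain a where a: "a \<in> A" "w \<in> ball a (\<rho> a)" "(\<Sum>i\<in>I. neglog (q a i w)) \<le> \<kappa> w" using near by blast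
        have "log_level d c \<delta> w \<le> L + of_nat d * (\<Sum>i\<in>I. neglog (q a i w))"
          unfolding L_def by (rule log_level_le_neglog[OF d \<delta> \<rho> a(2) nq])
        also have "\<dots> \<le> L + of_nat d * \<kappa> w" by (intro add_left_mono mult_left_mono a(3)) simp
        finally show ?thesis using True by simp
      qed simp
    qed
    also have "\<dots> = L * emeasure lborel D + of_nat d * (\<integral>\<^sup>+w. \<kappa> w \<partial>lborel)"
      by (simp add: nn_integral_add nn_integral_cmult nn_integral_cmult_indicator)
    also have "\<dots> < \<infinity>"
      using D_fin \<kappa>fin by (simp add: L_def ennreal_mult_less_top ennreal_of_nat_eq_real_of_nat)
    finally show ?thesis .
  qed
  have defect: "(\<integral>\<^sup>+w\<in>D. (log_level d c \<delta> w - ball_mean s (log_level d c \<delta>) w) \<partial>lborel) \<le> ennreal (K * real d)"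
    if d: "0 < d" and \<delta>: "0 < \<delta>" and s: "0 < s" "s < \<rho>0" for d c \<delta> s
  proof -
    have "(\<integral>\<^sup>+w\<in>D. (log_level d c \<delta> w - ball_mean s (log_level d c \<delta>) w) \<partial>lborel)
      \<le> (\<integral>\<^sup>+w. of_nat d * \<kappa> w \<partial>lborel)"
    proof (rule nn_integral_mono)
      fix w
      show "(log_level d c \<delta> w - ball_mean s (log_level d c \<delta>) w) * indicator D w \<le> of_nat d * \<kappa> w"
      proof (cases "w \<in> D")
        case True
        then obtain a where a: "a \<in> A" "w \<in> ball a (\<rho> a)" "(\<Sum>i\<in>I. neglog (q a i w)) \<le> \<kappa> w" using near by blast
        have "log_level d c \<delta> w \<le> ball_mean s (log_level d c \<delta>) w + of_nat d * (\<Sum>i\<in>I. neglog (q a i w))"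
          by (rule log_level_le_mean[OF d \<delta> s(1) _ a(2) nq]) (use s(2) \<rho>0(2)[OF a(1)] in auto)
        also have "\<dots> \<le> ball_mean s (log_level d c \<delta>) w + of_nat d * \<kappa> w"
          by (intro add_left_mono mult_left_mono a(3)) simp
        finally have "log_level d c \<delta> w \<le> ball_mean s (log_level d c \<delta>) w + of_nat d * \<kappa> w" .
        moreover have "log_level d c \<delta> w \<noteq> top" by (simp add: log_level_def indicator_def)
        ultimately show ?thesis using True by (simp add: ennreal_minus_le_iff add.commute)
      qed simp
    qed
    also have "\<dots> = of_nat d * (\<integral>\<^sup>+w. \<kappa> w \<partial>lborel)" by (simp add: nn_integral_cmult)
    also have "\<dots> \<le> of_nat d * ennreal K" by (intro mult_left_mono K(2)) simp
    also have "\<dots> = ennreal (K * real d)"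
      using K(1) by (simp add: ennreal_of_nat_eq_real_of_nat mult.commute flip: ennreal_mult)
    finally show ?thesis .
  qed
  show ?thesis using that[OF K(1) \<rho>0(1) fin defect] .
qed

lemma ln_poly_val_le_ball_integral:
  assumes y: "cball y r \<subseteq> common_domain" and r: "0 < r" and \<delta>: "0 < \<delta>" and nz: "poly_val d c y \<noteq> 0"
  shows "ennreal (ln (norm (poly_val d c y) / \<delta>)) * emeasure lborel (ball y r)
    \<le> (\<integral>\<^sup>+w\<in>ball y r. log_level d c \<delta> w \<partial>lborel)"
proof -
  define F where "F w = (1 / of_real \<delta>) * poly_val d c w" for w
  have F: "holo_on F common_domain" unfolding F_def by (intro holo_on_mult holo_on_const holo_poly_val)
  have norm_F: "norm (F w) = norm (poly_val d c w) / \<delta>" for w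
    using \<delta> by (simp add: F_def norm_mult norm_divide)
  have "F y \<noteq> 0" using nz \<delta> by (simp add: F_def)
  from ln_norm_le_ball_integral[OF F open_common_domain y this]
  have "ennreal (ln (norm (poly_val d c y) / \<delta>)) * emeasure lborel (ball y r)
    \<le> (\<integral>\<^sup>+w\<in>ball y r. ennreal (ln (norm (poly_val d c w) / \<delta>)) \<partial>lborel)"
    by (simp add: norm_F)
  also have "\<dots> = (\<integral>\<^sup>+w\<in>ball y r. log_level d c \<delta> w \<partial>lborel)"
    using y by (intro nn_integral_cong) (auto simp: log_level_def indicator_def subset_iff)
  finally show ?thesis .
qed

section \<open>Algebraic dependence\<close>

text \<open>
  The grid has fewer points than there are monomials, so some nonzero polynomial vanishes on it. The
  exponential smallness that results near \<open>x\<close> exceeds the oscillation that is possible for degree \<open>d\<close>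
  unless \<open>P\<close> vanishes near \<open>x\<close>; and the bound on the oscillation, being uniform in \<open>\<delta>\<close>, then spreads
  the vanishing over the whole domain.
\<close>

theorem algebraic_dependence:
  assumes D: "ball x0 r0 \<subseteq> D" "0 < r0" and card_I: "CARD('n) < card I"
  obtains d c where "\<exists>\<beta>\<in>monomials d. c \<beta> \<noteq> 0" "\<And>z. z \<in> common_domain \<Longrightarrow> poly_val d c z = 0"
proof -
  define N where "N = CARD('n)"
  obtain x where x: "x \<in> common_domain" using common_domain_nonempty by blast
  obtain e where e: "0 < e" "cball x e \<subseteq> common_domain" using open_common_domain x open_contains_cball by blast
  define R where "R = e / (real N + 1)"
  have R: "0 < R" using e by (simp add: R_def)
  have xR: "cball x ((real N + 1) * R) \<subseteq> common_domain" using e by (simp add: R_def)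
  obtain K \<rho>0 where K: "0 < K" "0 < \<rho>0"
    and fin: "\<And>d c \<delta>. 0 < d \<Longrightarrow> 0 < \<delta> \<Longrightarrow> (\<integral>\<^sup>+w\<in>D. log_level d c \<delta> w \<partial>lborel) < \<infinity>"
    and defect: "\<And>d c \<delta> s. 0 < d \<Longrightarrow> 0 < \<delta> \<Longrightarrow> 0 < s \<Longrightarrow> s < \<rho>0 \<Longrightarrow>
      (\<integral>\<^sup>+w\<in>D. (log_level d c \<delta> w - ball_mean s (log_level d c \<delta>) w) \<partial>lborel) \<le> ennreal (K * real d)"
    using log_level_defect by blast
  \<comment> \<open>One radius serves all purposes: the means in the oscillation bound, and balls inside \<open>common_domain\<close>.\<close>
  define r where "r = min r0 (min \<rho>0 R) / 2"
  have r: "0 < r" "r \<le> r0" "r < \<rho>0" "r \<le> R / 2"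
    using D K R by (auto simp: r_def)
  have "ball x0 r \<subseteq> D" using D r by (meson order_trans subset_ball)
  then obtain C0 where C0: "0 < C0" "\<And>g T y z. \<lbrakk>g \<in> borel_measurable borel; periodic g;
     (\<integral>\<^sup>+w\<in>D. g w \<partial>lborel) < \<infinity>; 0 < T;
     \<And>s. s \<in> {r, r/2} \<Longrightarrow> (\<integral>\<^sup>+w\<in>D. (g w - ball_mean s g w) \<partial>lborel) \<le> ennreal T\<rbrakk>
     \<Longrightarrow> ball_mean r g y \<le> ball_mean r g z + ennreal (C0 * T)"
    using ball_mean_oscillation[OF r(1)] by blast
  define C where "C = C0 * K"
  have C: "0 < C" using C0 K by (simp add: C_def)
  have osc: "ball_mean r (log_level d c \<delta>) y \<le> ball_mean r (log_level d c \<delta>) z + ennreal (C * real d)"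
    if "0 < d" "0 < \<delta>" for d c \<delta> y z
  proof -
    have "ball_mean r (log_level d c \<delta>) y \<le> ball_mean r (log_level d c \<delta>) z + ennreal (C0 * (K * real d))"
      by (rule C0(2)) (use that K r in \<open>auto intro!: log_level_periodic fin[unfolded infinity_ennreal_def] defect\<close>)
    then show ?thesis by (simp add: C_def mult.assoc)
  qed
  define \<gamma> where "\<gamma> = ln (2::real) / 2"
  have \<gamma>: "0 < \<gamma>" by (simp add: \<gamma>_def)
  obtain M where M: "\<And>m::nat. m \<ge> M \<Longrightarrow>
      2 * (real m + 1) / 2 ^ m * (real N * real m ^ N) \<le> exp (- (\<gamma> * real m))"
    using eventually_grid_bound[of N] unfolding \<gamma>_def by blast
  obtain Q0 :: nat where Q0: "C / \<gamma> < real Q0" using reals_Archimedean2 by blast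
  \<comment> \<open>The \<open>m\<^sup>N = d (d + 1)\<^sup>N\<close> conditions are fewer than \<open>(d + 1)\<^sup>N\<^sup>+\<^sup>1\<close>, yet \<open>m \<ge> Q d\<close> with \<open>Q\<close> as large as desired.\<close>
  define Q where "Q = max 1 (max M Q0)"
  define d where "d = Q ^ N"
  define m where "m = Q * (d + 1)"
  have Q: "1 \<le> Q" "M \<le> Q" "Q0 \<le> Q" by (auto simp: Q_def)
  have d: "0 < d" using Q by (simp add: d_def)
  have m: "0 < m" "M \<le> m" using Q by (auto simp: m_def)
  have Cm: "C * real d < \<gamma> * real m"
  proof -
    have "C < \<gamma> * real Q"
      using Q0 Q(3) \<gamma> by (simp add: field_simps) (smt (verit) mult_left_mono of_nat_mono)
    then have "C * real d \<le> \<gamma> * real Q * real d" by (intro mult_right_mono) auto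
    also have "\<dots> < \<gamma> * real m" using \<gamma> Q by (simp add: m_def algebra_simps)
    finally show ?thesis .
  qed
  define grid where "grid = (\<lambda>k. x + (\<chi> j. k j)) ` (PiE UNIV (\<lambda>_::'n. unity_nodes m (R/2)))"
  have fin_nodes: "finite (unity_nodes m (R/2))" "card (unity_nodes m (R/2)) \<le> m"
    unfolding unity_nodes_def using card_image_le[of "{..<m}"] by auto
  have grid: "finite grid" "card grid \<le> m ^ N"
  proof -
    have fin: "finite (PiE UNIV (\<lambda>_::'n. unity_nodes m (R/2)))" using fin_nodes by (intro finite_PiE) auto
    then show "finite grid" by (simp add: grid_def)
    have "card grid \<le> card (PiE UNIV (\<lambda>_::'n. unity_nodes m (R/2)))"
      unfolding grid_def by (rule card_image_le[OF fin])
    also have "\<dots> = card (unity_nodes m (R/2)) ^ N" by (simp add: card_PiE N_def)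
    also have "\<dots> \<le> m ^ N" using fin_nodes by (intro power_mono) auto
    finally show "card grid \<le> m ^ N" .
  qed
  have "card grid < card (monomials d)"
  proof -
    have "card grid \<le> m ^ N" by (rule grid)
    also have "\<dots> = d * (d + 1) ^ N" by (simp only: m_def power_mult_distrib d_def[symmetric])
    also have "\<dots> < (d + 1) ^ Suc N" by simp
    also have "\<dots> \<le> (d + 1) ^ card I" using card_I by (intro power_increasing) (auto simp: N_def)
    also have "\<dots> = card (monomials d)" using finite_I by (simp add: monomials_def card_PiE)
    finally show ?thesis .
  qed
  from homogeneous_system_nontrivial[OF grid(1) finite_monomials this, of "\<lambda>z \<beta>. \<Prod>i\<in>I. f i z ^ \<beta> i"]
  obtain c where c: "\<exists>\<beta>\<in>monomials d. c \<beta> \<noteq> 0" "\<And>z. z \<in> grid \<Longrightarrow> poly_val d c z = 0"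
    unfolding poly_val_def by blast
  define P where "P = poly_val d c"
  have holoP: "holo_on P common_domain" unfolding P_def by (rule holo_poly_val)
  define W where "W = {w::complex ^ 'n. \<forall>j. norm (w $ j) \<le> R}"
  have W_norm: "norm w \<le> real N * R" if "w \<in> W" for w
    using norm_vec_le_card[of w R] that by (auto simp: W_def N_def)
  have W_sub: "x + w \<in> common_domain" if "w \<in> W" for w
  proof -
    have "norm w \<le> (real N + 1) * R" using W_norm[OF that] R by (simp add: algebra_simps)
    then show ?thesis using xR by (auto simp: subset_iff dist_norm)
  qed
  have small_W: "w \<in> W" if "norm w \<le> r" for w
    using that r(4) R unfolding W_def
    by (auto intro!: order_trans[OF Finite_Cartesian_Product.norm_nth_le])
  have zero_W: "P (x + w) = 0" if w: "w \<in> W" for w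
  proof (rule ccontr)
    assume nz: "P (x + w) \<noteq> 0"
    have "compact W"
    proof -
      have "closed W" unfolding W_def by (intro closed_Collect_all closed_Collect_le continuous_intros)
      moreover have "bounded W" using W_norm by (auto simp: bounded_iff)
      ultimately show ?thesis by (simp add: compact_eq_bounded_closed)
    qed
    moreover have "continuous_on W (\<lambda>w. norm (P (x + w)))"
      using W_sub by (intro continuous_intros continuous_on_compose2[OF holo_on_continuous_on[OF holoP]]) auto
    ultimately obtain y where y: "y \<in> W" "\<And>w. w \<in> W \<Longrightarrow> norm (P (x + w)) \<le> norm (P (x + y))"
      using continuous_attains_sup[of W "\<lambda>w. norm (P (x + w))"] w by blast
    define S where "S = norm (P (x + y))"
    have S: "0 < S" using y(2)[OF w] nz unfolding S_def by (smt (verit) zero_less_norm_iff)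
    \<comment> \<open>For this \<open>\<delta>\<close> the mean of \<open>log_level\<close> is \<open>0\<close> at \<open>x\<close>, but at least \<open>\<gamma> m\<close> at the maximum point \<open>x + y\<close>.\<close>
    define \<delta> where "\<delta> = S * exp (- (\<gamma> * real m))"
    have \<delta>: "0 < \<delta>" using S by (simp add: \<delta>_def)
    have small: "norm (P (x + z)) \<le> \<delta>" if z: "\<And>j. norm (z $ j) \<le> R/2" for z
    proof -
      have "norm (P (x + z)) \<le> S * (2 * (real m + 1) / 2 ^ m) * (CARD('n) * m ^ CARD('n))"
      proof (rule vanishing_on_grid_small[OF holoP open_common_domain _ R m(1)])
        have "real CARD('n) * R \<le> (real N + 1) * R" using R by (simp add: N_def)
        then show "cball x (real CARD('n) * R) \<subseteq> common_domain" using xR by (meson order_trans subset_cball)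
        show "norm (P (x + z)) \<le> S" if "\<And>j. norm (z $ j) \<le> R" for z
          unfolding S_def using that by (intro y(2)) (simp add: W_def)
        show "P (x + z) = 0" if "\<And>j. z $ j \<in> unity_nodes m (R/2)" for z
        proof -
          have "x + z \<in> grid" unfolding grid_def
            by (rule image_eqI[of _ _ "\<lambda>j. z $ j"]) (use that in \<open>auto simp: vec_eq_iff\<close>)
          then show ?thesis using c(2) by (simp add: P_def)
        qed
      qed (use z in auto)
      also have "\<dots> = S * (2 * (real m + 1) / 2 ^ m * (real N * real m ^ N))" by (simp add: N_def)
      also have "\<dots> \<le> \<delta>" unfolding \<delta>_def using S M[OF m(2)] by (intro mult_left_mono) auto
      finally show ?thesis .
    qed
    have "ball_mean r (log_level d c \<delta>) x = 0"
    proof -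
      have "log_level d c \<delta> (x + w) * indicator (ball 0 r) w = 0" for w
      proof (cases "w \<in> ball 0 r")
        case True
        then have "norm (w $ j) \<le> R/2" for j
          using r(4) Finite_Cartesian_Product.norm_nth_le[of w j] by simp
        then have "norm (P (x + w)) / \<delta> \<le> 1" using small \<delta> by simp
        then have "ln (norm (P (x + w)) / \<delta>) \<le> 0"
          using \<delta> by (cases "P (x + w) = 0") auto
        then show ?thesis by (simp add: log_level_def P_def ennreal_neg)
      qed simp
      then show ?thesis unfolding ball_mean_def by (simp only:) simp
    qed
    moreover have "ennreal (\<gamma> * real m) \<le> ball_mean r (log_level d c \<delta>) (x + y)"
    proof -
      have sub: "cball (x + y) r \<subseteq> common_domain"
      proof
        fix z assume "z \<in> cball (x + y) r"
        then have "dist x z \<le> norm y + r"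
          using dist_triangle[of x z "x + y"] by (simp add: dist_norm)
        also have "\<dots> \<le> real N * R + R" using W_norm[OF y(1)] r(4) R by simp
        also have "\<dots> = (real N + 1) * R" by (simp add: algebra_simps)
        finally show "z \<in> common_domain" using xR by auto
      qed
      have "ln (norm (P (x + y)) / \<delta>) = \<gamma> * real m"
        using S by (simp add: \<delta>_def S_def[symmetric] ln_mult ln_div exp_minus field_simps)
      then have "ennreal (\<gamma> * real m) * emeasure lborel (ball (0::complex ^ 'n) r)
        \<le> (\<integral>\<^sup>+w\<in>ball (x + y) r. log_level d c \<delta> w \<partial>lborel)"
        using ln_poly_val_le_ball_integral[OF sub r(1) \<delta>, of d c] S
        by (simp add: P_def S_def emeasure_lborel_ball_center[of "x + y" r 0])
      from divide_right_mono_ennreal[OF this, of "emeasure lborel (ball (0::complex ^ 'n) r)"]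
      show ?thesis
        using emeasure_lborel_ball_pos[OF r(1), of "0::complex ^ 'n"] emeasure_lborel_ball_finite[of "0::complex ^ 'n" r]
        by (subst (asm) ennreal_mult_divide_eq) (auto simp: ball_mean_eq)
    qed
    ultimately have "ennreal (\<gamma> * real m) \<le> ennreal (C * real d)"
      using osc[OF d \<delta>, of c "x + y" x] by (metis add_0 order_trans)
    then show False using Cm C by (simp add: ennreal_le_iff)
  qed
  have "P z0 = 0" if z0: "z0 \<in> common_domain" for z0
  proof (rule ccontr)
    assume nz: "P z0 \<noteq> 0"
    obtain e where e: "0 < e" "cball z0 e \<subseteq> common_domain" using open_common_domain z0 open_contains_cball by blast
    define \<tau> where "\<tau> = min e r"
    have \<tau>: "0 < \<tau>" "\<tau> \<le> r" "cball z0 \<tau> \<subseteq> common_domain" using e r by (auto simp: \<tau>_def)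
    define V where "V s = measure lborel (ball (0::complex ^ 'n) s)" for s
    have V: "emeasure lborel (ball (0::complex ^ 'n) s) = ennreal (V s)" for s
      using emeasure_lborel_ball_finite[of "0::complex ^ 'n" s]
      by (simp add: V_def emeasure_eq_ennreal_measure)
    have Vpos: "0 < V s" if "0 < s" for s
      using emeasure_lborel_ball_pos[OF that, of "0::complex ^ 'n"] V[of s] by simp
    \<comment> \<open>The least mean that \<open>|P z0|\<close> forces is a fixed fraction of \<open>ln (norm (P z0) / \<delta>)\<close>; here it exceeds \<open>C d\<close>.\<close>
    define L where "L = V r * (C * real d) / V \<tau> + 1"
    define \<delta> where "\<delta> = norm (P z0) / exp L"
    have \<delta>: "0 < \<delta>" using nz by (simp add: \<delta>_def)
    have L: "ln (norm (P z0) / \<delta>) = L" using nz by (simp add: \<delta>_def)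
    have "ball_mean r (log_level d c \<delta>) x = 0"
    proof -
      have "log_level d c \<delta> (x + w) * indicator (ball 0 r) w = 0" for w
      proof (cases "w \<in> ball 0 r")
        case True
        then show ?thesis using zero_W[OF small_W, of w] by (simp add: log_level_def P_def)
      qed simp
      then show ?thesis unfolding ball_mean_def by (simp only:) simp
    qed
    then have "ball_mean r (log_level d c \<delta>) z0 \<le> ennreal (C * real d)"
      using osc[OF d \<delta>, of c z0 x] by simp
    then have "(\<integral>\<^sup>+w\<in>ball z0 r. log_level d c \<delta> w \<partial>lborel) / ennreal (V r) \<le> ennreal (C * real d)"
      by (simp add: ball_mean_eq V)
    then have "(\<integral>\<^sup>+w\<in>ball z0 r. log_level d c \<delta> w \<partial>lborel) / ennreal (V r) * ennreal (V r)
      \<le> ennreal (C * real d) * ennreal (V r)"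
      by (rule mult_right_mono) simp
    moreover have "X / ennreal (V r) * ennreal (V r) = X" for X
      using Vpos[OF r(1)] by (simp add: ennreal_divide_times)
    ultimately have up: "(\<integral>\<^sup>+w\<in>ball z0 r. log_level d c \<delta> w \<partial>lborel) \<le> ennreal (V r * (C * real d))"
      using Vpos[OF r(1)] by (simp only: ennreal_mult' mult.commute less_imp_le)
    have "ennreal L * ennreal (V \<tau>) \<le> (\<integral>\<^sup>+w\<in>ball z0 \<tau>. log_level d c \<delta> w \<partial>lborel)"
      using ln_poly_val_le_ball_integral[OF \<tau>(3,1) \<delta>, of d c] nz L
      by (simp add: P_def V emeasure_lborel_ball_center[of z0 \<tau> 0])
    also have "\<dots> \<le> (\<integral>\<^sup>+w\<in>ball z0 r. log_level d c \<delta> w \<partial>lborel)"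
      using \<tau>(2) by (intro nn_integral_mono mult_left_mono) (auto simp: indicator_def)
    also have "\<dots> \<le> ennreal (V r * (C * real d))" by (rule up)
    finally have "L * V \<tau> \<le> V r * (C * real d)"
      using Vpos[OF \<tau>(1)] Vpos[OF r(1)] C by (simp flip: ennreal_mult'')
    moreover have "L * V \<tau> = V r * (C * real d) + V \<tau>"
      using Vpos[OF \<tau>(1)] by (simp add: L_def distrib_right)
    ultimately show False using Vpos[OF \<tau>(1)] by simp
  qed
  then show ?thesis using that[OF c(1)] by (simp add: P_def)
qed

end

section \<open>Fundamental domains of lattices\<close>

text \<open>
  The half-open period parallelepiped spanned by the generators of the lattice. The count \<open>2n\<close> of the
  generators makes them a real basis, and integer parts of coordinates give the representatives.
\<close>

lemma full_lattice_tile: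
  fixes \<Omega> :: "(complex ^ 'n) set"
  assumes "full_lattice \<Omega>"
  obtains D x0 r0 where "lattice_tile \<Omega> D" "0 < r0" "ball x0 r0 \<subseteq> D"
proof -
  obtain B :: "(complex ^ 'n) set" where B: "independent B" "card B = 2 * CARD('n)"
    and \<Omega>: "\<Omega> = range (\<lambda>k :: complex ^ 'n \<Rightarrow> int. \<Sum>b\<in>B. of_int (k b) *\<^sub>R b)"
    using assms unfolding full_lattice_def by blast
  have finB: "finite B" using B(1) independent_bound by blast
  have "UNIV \<subseteq> span B"
    by (rule card_ge_dim_independent) (use B in \<open>auto simp: dim_UNIV\<close>)
  then have span: "z \<in> span B" for z by blast
  define rep where "rep b z = representation B z b" for b z
  have lin: "linear (rep b)" for b
    unfolding rep_def by (intro linearI) (simp_all add: representation_add representation_scale B(1) span)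
  have rep_sum: "(\<Sum>b\<in>B. rep b z *\<^sub>R b) = z" for z
    unfolding rep_def by (rule sum_representation_eq) (use B finB span in auto)
  have rep_comb: "rep b (\<Sum>b\<in>B. c b *\<^sub>R b) = c b" if "b \<in> B" for b c
  proof -
    have "rep b (\<Sum>b\<in>B. c b *\<^sub>R b) = (\<Sum>b'\<in>B. c b' * rep b b')"
      by (simp add: linear_sum[OF lin] linear_cmul[OF lin])
    also have "\<dots> = (\<Sum>b'\<in>B. if b' = b then c b else 0)"
      by (intro sum.cong) (auto simp: rep_def representation_basis[OF B(1)])
    also have "\<dots> = c b" using that finB by simp
    finally show ?thesis .
  qed
  have cont: "continuous_on S (rep b)" for S b
    using lin by (intro linear_continuous_on) (simp add: linear_conv_bounded_linear)
  have [measurable]: "rep b \<in> borel_measurable borel" for b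
    by (intro borel_measurable_continuous_onI cont)
  define D where "D = {z. \<forall>b\<in>B. 0 \<le> rep b z \<and> rep b z < 1}"
  have tile: "lattice_tile \<Omega> D"
  proof
    have "\<Omega> \<subseteq> (\<lambda>k. \<Sum>b\<in>B. of_int (k b) *\<^sub>R b) ` (PiE B (\<lambda>_. UNIV :: int set))"
      unfolding \<Omega>
    proof (rule image_subsetI)
      fix k :: "complex ^ 'n \<Rightarrow> int"
      show "(\<Sum>b\<in>B. of_int (k b) *\<^sub>R b) \<in> (\<lambda>k. \<Sum>b\<in>B. of_int (k b) *\<^sub>R b) ` (PiE B (\<lambda>_. UNIV :: int set))"
        by (rule image_eqI[of _ _ "restrict k B"]) auto
    qed
    moreover have "countable (PiE B (\<lambda>_. UNIV :: int set))" using finB by (intro countable_PiE) auto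
    ultimately show "countable \<Omega>" by (rule countable_subset[OF _ countable_image])
    show "x - y \<in> \<Omega>" if "x \<in> \<Omega>" "y \<in> \<Omega>" for x y
    proof -
      obtain k l :: "complex ^ 'n \<Rightarrow> int"
        where "x = (\<Sum>b\<in>B. of_int (k b) *\<^sub>R b)" "y = (\<Sum>b\<in>B. of_int (l b) *\<^sub>R b)"
        using \<open>x \<in> \<Omega>\<close> \<open>y \<in> \<Omega>\<close> unfolding \<Omega> by blast
      then have "x - y = (\<Sum>b\<in>B. of_int ((\<lambda>b. k b - l b) b) *\<^sub>R b)"
        by (simp add: sum_subtractf scaleR_left_diff_distrib)
      then show ?thesis unfolding \<Omega> by (rule range_eqI[where x = "\<lambda>b. k b - l b"])
    qed
    have "D = {z \<in> space borel. \<forall>b\<in>B. 0 \<le> rep b z \<and> rep b z < 1}" by (simp add: D_def)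
    also have "\<dots> \<in> sets borel" using finB by measurable
    finally show "D \<in> sets borel" .
    show "bounded D"
      unfolding bounded_iff
    proof (intro exI ballI)
      fix z assume z: "z \<in> D"
      have "norm (\<Sum>b\<in>B. rep b z *\<^sub>R b) \<le> (\<Sum>b\<in>B. norm b)"
      proof (rule sum_norm_le)
        fix b assume "b \<in> B"
        then have "\<bar>rep b z\<bar> \<le> 1" using z by (auto simp: D_def)
        then show "norm (rep b z *\<^sub>R b) \<le> norm b" by (simp add: mult_left_le_one_le)
      qed
      then show "norm z \<le> (\<Sum>b\<in>B. norm b)" by (simp add: rep_sum)
    qed
    show "\<exists>!\<omega>. \<omega> \<in> \<Omega> \<and> z - \<omega> \<in> D" for z
    proof (rule ex1I[of _ "\<Sum>b\<in>B. of_int \<lfloor>rep b z\<rfloor> *\<^sub>R b"])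
      have "z - (\<Sum>b\<in>B. of_int \<lfloor>rep b z\<rfloor> *\<^sub>R b) \<in> D"
        unfolding D_def
      proof (intro CollectI ballI)
        fix b assume b: "b \<in> B"
        have "rep b (z - (\<Sum>b\<in>B. of_int \<lfloor>rep b z\<rfloor> *\<^sub>R b)) = rep b z - of_int \<lfloor>rep b z\<rfloor>"
          using rep_comb[OF b, of "\<lambda>b. of_int \<lfloor>rep b z\<rfloor>"] by (simp add: linear_diff[OF lin])
        then show "0 \<le> rep b (z - (\<Sum>b\<in>B. of_int \<lfloor>rep b z\<rfloor> *\<^sub>R b))
          \<and> rep b (z - (\<Sum>b\<in>B. of_int \<lfloor>rep b z\<rfloor> *\<^sub>R b)) < 1" by linarith
      qed
      then show "(\<Sum>b\<in>B. of_int \<lfloor>rep b z\<rfloor> *\<^sub>R b) \<in> \<Omega> \<and> z - (\<Sum>b\<in>B. of_int \<lfloor>rep b z\<rfloor> *\<^sub>R b) \<in> D"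
        unfolding \<Omega> by auto
      fix \<omega> assume \<omega>: "\<omega> \<in> \<Omega> \<and> z - \<omega> \<in> D"
      then obtain k :: "complex ^ 'n \<Rightarrow> int" where k: "\<omega> = (\<Sum>b\<in>B. of_int (k b) *\<^sub>R b)"
        unfolding \<Omega> by blast
      have "k b = \<lfloor>rep b z\<rfloor>" if b: "b \<in> B" for b
      proof -
        have "0 \<le> rep b (z - \<omega>)" "rep b (z - \<omega>) < 1" using \<omega> b by (auto simp: D_def)
        moreover have "rep b (z - \<omega>) = rep b z - of_int (k b)"
          using rep_comb[OF b, of "\<lambda>b. of_int (k b)"] by (simp add: linear_diff[OF lin] k)
        ultimately show ?thesis by linarith
      qed
      then show "\<omega> = (\<Sum>b\<in>B. of_int \<lfloor>rep b z\<rfloor> *\<^sub>R b)" unfolding k by (intro sum.cong) auto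
    qed
  qed
  define T where "T = (\<Inter>b\<in>B. {z. 0 < rep b z} \<inter> {z. rep b z < 1})"
  have "open T"
    unfolding T_def using finB
    by (intro open_INT open_Int ballI open_Collect_less cont continuous_on_const) auto
  moreover have "(\<Sum>b\<in>B. (1/2) *\<^sub>R b) \<in> T"
    unfolding T_def
  proof (intro INT_I IntI CollectI)
    fix b assume "b \<in> B"
    from rep_comb[OF this, of "\<lambda>_. 1/2"]
    show "0 < rep b (\<Sum>b\<in>B. (1/2) *\<^sub>R b)" "rep b (\<Sum>b\<in>B. (1/2) *\<^sub>R b) < 1" by linarith+
  qed
  ultimately obtain r0 where "0 < r0" "ball (\<Sum>b\<in>B. (1/2) *\<^sub>R b) r0 \<subseteq> T"
    using open_contains_ball by blast
  moreover have "T \<subseteq> D" by (auto simp: T_def D_def less_imp_le)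
  ultimately show ?thesis using tile that by blast
qed

text \<open>
  Pairs \<open>(u, v)\<close> are encoded as vectors indexed by a disjoint sum, so that \<^const>\<open>holo_on\<close> applies to them.
\<close>

definition fst_vec :: "complex ^ ('n + 'n) \<Rightarrow> complex ^ 'n" where "fst_vec z = (\<chi> i. z $ Inl i)"
definition snd_vec :: "complex ^ ('n + 'n) \<Rightarrow> complex ^ 'n" where "snd_vec z = (\<chi> i. z $ Inr i)"
definition pair_vec :: "complex ^ 'n \<Rightarrow> complex ^ 'n \<Rightarrow> complex ^ ('n + 'n)" where
  "pair_vec u v = (\<chi> s. case s of Inl i \<Rightarrow> u $ i | Inr i \<Rightarrow> v $ i)"

lemma fst_snd_pair_vec [simp]:
  "fst_vec (pair_vec u v) = u" "snd_vec (pair_vec u v) = v" "pair_vec (fst_vec z) (snd_vec z) = z"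
  by (auto simp: fst_vec_def snd_vec_def pair_vec_def vec_eq_iff split: sum.splits)

lemma linear_fst_vec: "linear fst_vec" "fst_vec (c *s z) = c *s fst_vec z"
  by (auto intro!: linearI simp: fst_vec_def vec_eq_iff)

lemma linear_snd_vec: "linear snd_vec" "snd_vec (c *s z) = c *s snd_vec z"
  by (auto intro!: linearI simp: snd_vec_def vec_eq_iff)

lemma continuous_fst_snd_vec: "continuous_on S fst_vec" "continuous_on S snd_vec"
  using linear_fst_vec(1) linear_snd_vec(1)
  by (auto intro!: linear_continuous_on simp: linear_conv_bounded_linear)

lemma lattice_tile_product:
  fixes \<Omega> D :: "(complex ^ 'n) set"
  assumes "lattice_tile \<Omega> D" and b: "0 < r0" "ball x0 r0 \<subseteq> D"
  defines "\<Omega>2 \<equiv> {z. fst_vec z \<in> \<Omega> \<and> snd_vec z \<in> \<Omega>}" and "D2 \<equiv> {z. fst_vec z \<in> D \<and> snd_vec z \<in> D}"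
  shows "lattice_tile \<Omega>2 D2" and "\<exists>x r. 0 < r \<and> ball x r \<subseteq> D2"
proof -
  interpret lattice_tile \<Omega> D by fact
  have [measurable]: "fst_vec \<in> borel_measurable borel" "snd_vec \<in> borel_measurable borel"
    by (intro borel_measurable_continuous_onI continuous_fst_snd_vec)+
  show "lattice_tile \<Omega>2 D2"
  proof
    have "\<Omega>2 \<subseteq> (\<lambda>(u, v). pair_vec u v) ` (\<Omega> \<times> \<Omega>)"
    proof
      fix z assume "z \<in> \<Omega>2"
      then show "z \<in> (\<lambda>(u, v). pair_vec u v) ` (\<Omega> \<times> \<Omega>)"
        by (intro image_eqI[of _ _ "(fst_vec z, snd_vec z)"]) (auto simp: \<Omega>2_def)
    qed
    moreover have "countable (\<Omega> \<times> \<Omega>)" using countable_lattice by (intro countable_SIGMA) auto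
    ultimately show "countable \<Omega>2" by (rule countable_subset[OF _ countable_image])
    show "x - y \<in> \<Omega>2" if "x \<in> \<Omega>2" "y \<in> \<Omega>2" for x y
      using that diff_mem unfolding \<Omega>2_def
      by (auto simp: linear_diff[OF linear_fst_vec(1)] linear_diff[OF linear_snd_vec(1)])
    have "D2 = {z \<in> space borel. fst_vec z \<in> D \<and> snd_vec z \<in> D}" by (simp add: D2_def)
    also have "\<dots> \<in> sets borel" by measurable
    finally show "D2 \<in> sets borel" .
    show "bounded D2"
    proof -
      obtain M where M: "\<And>u. u \<in> D \<Longrightarrow> norm u \<le> M" using bounded_tile unfolding bounded_iff by blast
      have "norm z \<le> CARD('n + 'n) * M" if z: "z \<in> D2" for z
      proof (rule norm_vec_le_card)
        fix s :: "'n + 'n"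
        show "norm (z $ s) \<le> M"
        proof (cases s)
          case (Inl i)
          have "norm (fst_vec z $ i) \<le> norm (fst_vec z)" by (rule Finite_Cartesian_Product.norm_nth_le)
          also have "\<dots> \<le> M" using z M by (simp add: D2_def)
          finally show ?thesis by (simp add: Inl fst_vec_def)
        next
          case (Inr i)
          have "norm (snd_vec z $ i) \<le> norm (snd_vec z)" by (rule Finite_Cartesian_Product.norm_nth_le)
          also have "\<dots> \<le> M" using z M by (simp add: D2_def)
          finally show ?thesis by (simp add: Inr snd_vec_def)
        qed
      qed
      then show ?thesis unfolding bounded_iff by blast
    qed
    show "\<exists>!\<omega>. \<omega> \<in> \<Omega>2 \<and> z - \<omega> \<in> D2" for z
    proof -
      obtain a where a: "a \<in> \<Omega>" "fst_vec z - a \<in> D" "\<And>\<omega>. \<omega> \<in> \<Omega> \<Longrightarrow> fst_vec z - \<omega> \<in> D \<Longrightarrow> \<omega> = a"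
        using ex1[of "fst_vec z"] by metis
      obtain b where b: "b \<in> \<Omega>" "snd_vec z - b \<in> D" "\<And>\<omega>. \<omega> \<in> \<Omega> \<Longrightarrow> snd_vec z - \<omega> \<in> D \<Longrightarrow> \<omega> = b"
        using ex1[of "snd_vec z"] by metis
      have diff_vec: "fst_vec (z - \<omega>) = fst_vec z - fst_vec \<omega>" "snd_vec (z - \<omega>) = snd_vec z - snd_vec \<omega>" for \<omega>
        by (simp_all add: linear_diff[OF linear_fst_vec(1)] linear_diff[OF linear_snd_vec(1)])
      show ?thesis
      proof (rule ex1I[of _ "pair_vec a b"])
        show "pair_vec a b \<in> \<Omega>2 \<and> z - pair_vec a b \<in> D2"
          using a(1,2) b(1,2) by (simp add: \<Omega>2_def D2_def diff_vec)
        fix \<omega> assume "\<omega> \<in> \<Omega>2 \<and> z - \<omega> \<in> D2"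
        then have "fst_vec \<omega> = a" "snd_vec \<omega> = b"
          by (auto simp: \<Omega>2_def D2_def diff_vec intro: a(3) b(3))
        then show "\<omega> = pair_vec a b" by (metis fst_snd_pair_vec(3))
      qed
    qed
  qed
  have "open (fst_vec -` ball x0 r0 \<inter> snd_vec -` ball x0 r0)"
    using continuous_fst_snd_vec by (intro open_Int) (auto intro!: open_vimage)
  moreover have "pair_vec x0 x0 \<in> fst_vec -` ball x0 r0 \<inter> snd_vec -` ball x0 r0" using b(1) by simp
  ultimately obtain r where "0 < r" "ball (pair_vec x0 x0) r \<subseteq> fst_vec -` ball x0 r0 \<inter> snd_vec -` ball x0 r0"
    using open_contains_ball by blast
  moreover have "fst_vec -` ball x0 r0 \<inter> snd_vec -` ball x0 r0 \<subseteq> D2" using b(2) by (auto simp: D2_def)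
  ultimately show "\<exists>x r. 0 < r \<and> ball x r \<subseteq> D2" by blast
qed

section \<open>Abelian functions\<close>

lemma holo_on_inverse:
  assumes f: "holo_on f U" and nz: "\<And>z. z \<in> U \<Longrightarrow> f z \<noteq> 0"
  shows "holo_on (\<lambda>z. inverse (f z)) U"
  unfolding holo_on_def
proof
  fix z assume z: "z \<in> U"
  then obtain D where D: "(f has_derivative D) (at z)" "\<forall>c x. D (c *s x) = c * D x"
    using f unfolding holo_on_def by blast
  show "\<exists>D. ((\<lambda>z. inverse (f z)) has_derivative D) (at z) \<and> (\<forall>c x. D (c *s x) = c * D x)"
    by (rule exI[of _ "\<lambda>x. - (inverse (f z) * D x * inverse (f z))"], intro conjI)
      (rule Deriv.has_derivative_inverse[OF nz[OF z] D(1)], simp add: D(2))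
qed

lemma holo_on_cong_open:
  assumes "open U" "holo_on g U" "\<And>z. z \<in> U \<Longrightarrow> f z = g z"
  shows "holo_on f U"
  unfolding holo_on_def
proof
  fix z assume z: "z \<in> U"
  then obtain D where D: "(g has_derivative D) (at z)" "\<forall>c x. D (c *s x) = c * D x"
    using assms(2) unfolding holo_on_def by blast
  have "(f has_derivative D) (at z)"
    by (rule has_derivative_transform_within_open[OF D(1) assms(1) z]) (simp add: assms(3))
  then show "\<exists>D. (f has_derivative D) (at z) \<and> (\<forall>c x. D (c *s x) = c * D x)" using D(2) by blast
qed

lemma open_defined: "open {z. defined_at f z}"
proof -
  have "{z. defined_at f z} = \<Union> {U. open U \<and> holo_on f U}" by (auto simp: defined_at_def)
  then show ?thesis by auto
qed

lemma holo_on_defined: "holo_on f {z. defined_at f z}"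
  by (auto simp: defined_at_def holo_on_def)

text \<open>
  Periodicity of the domain of definition comes from the removal of removable singularities in
  \<^const>\<open>meromorphic_fun\<close>: near \<open>u + \<omega>\<close> the function agrees, where defined, with the holomorphic function
  \<open>w \<mapsto> f (w - \<omega>)\<close>, hence it agrees with it everywhere there.
\<close>

lemma abelian_fun_shift:
  assumes ab: "abelian_fun \<Omega> f" and \<omega>: "\<omega> \<in> \<Omega>" and u: "defined_at f u"
  shows "defined_at f (u + \<omega>) \<and> f (u + \<omega>) = f u"
proof -
  obtain U where U: "open U" "u \<in> U" "holo_on f U" using u unfolding defined_at_def by blast
  define V where "V = {w. - \<omega> + w \<in> U}"
  have "open ((\<lambda>w. - \<omega> + w) -` U)" by (intro open_vimage U continuous_intros)
  then have openV: "open V" by (simp add: V_def vimage_def)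
  have holo: "holo_on (\<lambda>w. f (- \<omega> + w)) V"
    unfolding V_def by (rule holo_on_compose_affine[OF U(3), of "\<lambda>w. w"]) (auto intro: linearI)
  have "\<forall>w\<in>V. defined_at f w \<longrightarrow> f w = f (- \<omega> + w)"
  proof (intro ballI impI)
    fix w assume w: "w \<in> V" "defined_at f w"
    have "defined_at f (- \<omega> + w)" using w(1) U unfolding V_def defined_at_def by blast
    then have "f ((- \<omega> + w) + \<omega>) = f (- \<omega> + w)" 
      using ab[unfolded abelian_fun_def, THEN conjunct2, rule_format, OF \<omega>, of "- \<omega> + w"] w(2) by simp
    then show "f w = f (- \<omega> + w)" by simp
  qed
  then have eq: "\<forall>w\<in>V. f w = f (- \<omega> + w)"
    using ab openV holo unfolding abelian_fun_def meromorphic_fun_def by blast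
  have uV: "u + \<omega> \<in> V" using U(2) by (simp add: V_def)
  have "holo_on f V" by (rule holo_on_cong_open[OF openV holo]) (use eq in blast)
  then show ?thesis using eq[rule_format, OF uV] openV uV unfolding defined_at_def by auto
qed

lemma meromorphic_fun_local_quotient:
  assumes "meromorphic_fun f"
  obtains U g h where "open U" "connected U" "z \<in> U" "holo_on g U" "holo_on h U" "\<exists>w\<in>U. h w \<noteq> 0"
    "\<And>w. w \<in> U \<Longrightarrow> h w \<noteq> 0 \<Longrightarrow> defined_at f w \<and> f w = g w / h w"
proof -
  obtain U g h where U: "open U" "connected U" "z \<in> U" "holo_on g U" "holo_on h U" "\<exists>w\<in>U. h w \<noteq> 0"
    and f: "\<forall>w\<in>U. h w \<noteq> 0 \<longrightarrow> f w = g w / h w"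
    using assms[unfolded meromorphic_fun_def, THEN conjunct1, rule_format, of z] by (elim exE conjE) (rule that)
  define W where "W = {w \<in> U. h w \<noteq> 0}"
  have "open W"
  proof -
    have "open (h -` (- {0}) \<inter> U)"
      using continuous_open_preimage[OF holo_on_continuous_on[OF U(5)] U(1), of "- {0}"]
      by (simp add: Int_commute open_Compl)
    moreover have "h -` (- {0}) \<inter> U = W" by (auto simp: W_def)
    ultimately show ?thesis by simp
  qed
  have WU: "W \<subseteq> U" by (auto simp: W_def)
  have "holo_on (\<lambda>w. g w * inverse (h w)) W"
    by (intro holo_on_mult holo_on_inverse holo_on_subset[OF U(4) WU] holo_on_subset[OF U(5) WU])
      (simp add: W_def)
  then have "holo_on f W"
    by (rule holo_on_cong_open[OF \<open>open W\<close>]) (use f in \<open>auto simp: W_def divide_inverse\<close>)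
  then have "defined_at f w" if "w \<in> U" "h w \<noteq> 0" for w
    using that \<open>open W\<close> unfolding defined_at_def W_def by blast
  then show ?thesis using that[OF U] f by blast
qed

section \<open>The addition theorem\<close>

lemma UNIV_add_var: "(UNIV :: 'n add_var set) = insert Var_Sum (range Var_Fst \<union> range Var_Snd)"
proof -
  have "x \<in> insert Var_Sum (range Var_Fst \<union> range Var_Snd)" for x :: "'n add_var" by (cases x) auto
  then show ?thesis by blast
qed

lemma finite_add_var: "finite (UNIV :: 'n::finite add_var set)"
  unfolding UNIV_add_var by simp

lemma card_add_var: "card (UNIV :: 'n::finite add_var set) = 2 * CARD('n) + 1"
proof -
  have "card (range (Var_Fst :: 'n \<Rightarrow> _) \<union> range Var_Snd) = CARD('n) + CARD('n)"
    by (subst card_Un_disjoint) (auto simp: card_image inj_on_def)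
  moreover have "Var_Sum \<notin> range (Var_Fst :: 'n \<Rightarrow> _) \<union> range Var_Snd" by auto
  ultimately show ?thesis unfolding UNIV_add_var by simp
qed

text \<open>
  Over finitely many variables every exponent function has finite support, so that
  \<^const>\<open>Poly_Mapping.lookup\<close> identifies exponent vectors with functions.
\<close>

lemma cpoly_of_coefficients:
  fixes c :: "('x \<Rightarrow> nat) \<Rightarrow> complex"
  assumes fin: "finite (UNIV :: 'x set)" and nz: "\<exists>\<beta>\<in>UNIV \<rightarrow>\<^sub>E {..d}. c \<beta> \<noteq> 0"
  shows "\<exists>P :: 'x cpoly. P \<noteq> 0 \<and>
    (\<forall>a. cpoly_eval P a = (\<Sum>\<beta>\<in>UNIV \<rightarrow>\<^sub>E {..d}. c \<beta> * (\<Prod>x\<in>UNIV. a x ^ \<beta> x)))"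
proof -
  define S where "S = {m :: 'x \<Rightarrow>\<^sub>0 nat. Poly_Mapping.lookup m \<in> UNIV \<rightarrow>\<^sub>E {..d}}"
  have finE: "finite (UNIV \<rightarrow>\<^sub>E {..d} :: ('x \<Rightarrow> nat) set)" using fin by (intro finite_PiE) auto
  have lookup_surj: "Poly_Mapping.lookup (Abs_poly_mapping \<beta>) = \<beta>" for \<beta> :: "'x \<Rightarrow> nat"
    using fin by (intro Abs_poly_mapping_inverse) (auto intro: finite_subset)
  have bij: "bij_betw Poly_Mapping.lookup S (UNIV \<rightarrow>\<^sub>E {..d})"
  proof (rule bij_betw_imageI)
    show "inj_on Poly_Mapping.lookup S" by (intro inj_onI) (simp only: lookup_inject)
    show "Poly_Mapping.lookup ` S = UNIV \<rightarrow>\<^sub>E {..d}"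
    proof
      show "UNIV \<rightarrow>\<^sub>E {..d} \<subseteq> Poly_Mapping.lookup ` S"
      proof
        fix \<beta> :: "'x \<Rightarrow> nat" assume "\<beta> \<in> UNIV \<rightarrow>\<^sub>E {..d}"
        then show "\<beta> \<in> Poly_Mapping.lookup ` S"
          by (intro image_eqI[of _ _ "Abs_poly_mapping \<beta>"]) (simp_all only: lookup_surj S_def mem_Collect_eq)
      qed
    qed (simp add: S_def image_subset_iff)
  qed
  have finS: "finite S" using bij finE bij_betw_finite by blast
  define P :: "'x cpoly" where
    "P = Abs_poly_mapping (\<lambda>m. if m \<in> S then c (Poly_Mapping.lookup m) else 0)"
  have P: "Poly_Mapping.lookup P m = (if m \<in> S then c (Poly_Mapping.lookup m) else 0)" for m
  proof -
    have "finite {m. (if m \<in> S then c (Poly_Mapping.lookup m) else 0) \<noteq> 0}"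
      by (rule finite_subset[OF _ finS]) auto
    then show ?thesis unfolding P_def by (subst Abs_poly_mapping_inverse) auto
  qed
  have keysP: "Poly_Mapping.keys P \<subseteq> S" by (auto simp: in_keys_iff P split: if_splits)
  have "cpoly_eval P a = (\<Sum>\<beta>\<in>UNIV \<rightarrow>\<^sub>E {..d}. c \<beta> * (\<Prod>x\<in>UNIV. a x ^ \<beta> x))" for a
  proof -
    have mono: "(\<Prod>x\<in>Poly_Mapping.keys m. a x ^ Poly_Mapping.lookup m x)
      = (\<Prod>x\<in>UNIV. a x ^ Poly_Mapping.lookup m x)" for m :: "'x \<Rightarrow>\<^sub>0 nat"
      by (rule prod.mono_neutral_left[OF fin]) (auto simp: in_keys_iff)
    have "cpoly_eval P a = (\<Sum>m\<in>S. Poly_Mapping.lookup P m * (\<Prod>x\<in>UNIV. a x ^ Poly_Mapping.lookup m x))"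
      unfolding cpoly_eval_def mono
      by (rule sum.mono_neutral_left[OF finS keysP]) (auto simp: in_keys_iff)
    also have "\<dots> = (\<Sum>m\<in>S. c (Poly_Mapping.lookup m) * (\<Prod>x\<in>UNIV. a x ^ Poly_Mapping.lookup m x))"
      by (intro sum.cong) (auto simp: P)
    also have "\<dots> = (\<Sum>\<beta>\<in>UNIV \<rightarrow>\<^sub>E {..d}. c \<beta> * (\<Prod>x\<in>UNIV. a x ^ \<beta> x))"
      by (rule sum.reindex_bij_betw[OF bij])
    finally show ?thesis .
  qed
  moreover have "P \<noteq> 0"
  proof -
    obtain \<beta> where \<beta>: "\<beta> \<in> UNIV \<rightarrow>\<^sub>E {..d}" "c \<beta> \<noteq> 0" using nz by blast
    have "Poly_Mapping.lookup P (Abs_poly_mapping \<beta>) = c \<beta>" using \<beta>(1) by (simp add: P S_def lookup_surj)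
    then show ?thesis using \<beta>(2) by (metis lookup_zero)
  qed
  ultimately show ?thesis by blast
qed

text \<open>
  Each of the \<open>2n + 1\<close> functions is an abelian function composed with one of the surjective linear maps
  \<open>(u, v) \<mapsto> u + v\<close>, \<open>u\<close> or \<open>v\<close>, which send \<open>\<Omega> \<times> \<Omega>\<close> into \<open>\<Omega>\<close>. Surjectivity keeps the denominators from
  vanishing identically after the composition.
\<close>

lemma abelian_addition_polynomial:
  fixes \<Omega> :: "(complex ^ 'n) set" and \<phi> :: "'n \<Rightarrow> complex ^ 'n \<Rightarrow> complex"
  assumes \<Omega>: "full_lattice \<Omega>" and ab: "\<And>i. abelian_fun \<Omega> (\<phi> i)"
  shows "\<exists>P :: 'n add_var cpoly. P \<noteq> 0 \<and>
    (\<forall>u v. defined_at (\<phi> k) (u + v) \<and> (\<forall>i. defined_at (\<phi> i) u) \<and> (\<forall>i. defined_at (\<phi> i) v) \<longrightarrow>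
       cpoly_eval P
         (\<lambda>x. case x of Var_Sum \<Rightarrow> \<phi> k (u + v) | Var_Fst i \<Rightarrow> \<phi> i u | Var_Snd i \<Rightarrow> \<phi> i v) = 0)"
proof -
  obtain D x0 r0 where D: "lattice_tile \<Omega> D" "0 < r0" "ball x0 r0 \<subseteq> D"
    by (rule full_lattice_tile[OF \<Omega>])
  define \<Omega>2 where "\<Omega>2 = {z. fst_vec z \<in> \<Omega> \<and> snd_vec z \<in> \<Omega>}"
  define D2 where "D2 = {z. fst_vec z \<in> D \<and> snd_vec z \<in> D}"
  define L :: "'n add_var \<Rightarrow> complex ^ ('n + 'n) \<Rightarrow> complex ^ 'n" where
    "L x = (case x of Var_Sum \<Rightarrow> (\<lambda>z. fst_vec z + snd_vec z) | Var_Fst i \<Rightarrow> fst_vec | Var_Snd i \<Rightarrow> snd_vec)" for x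
  define F where "F x = (case x of Var_Sum \<Rightarrow> \<phi> k | Var_Fst i \<Rightarrow> \<phi> i | Var_Snd i \<Rightarrow> \<phi> i)" for x
  define G where "G x = {z. defined_at (F x) (L x z)}" for x
  have linL: "linear (L x)" for x
    using linear_fst_vec(1) linear_snd_vec(1) linear_compose_add[of fst_vec snd_vec]
    by (cases x) (auto simp: L_def)
  have scaleL: "L x (c *s z) = c *s L x z" for x c z
    by (cases x) (auto simp: L_def linear_fst_vec(2) linear_snd_vec(2) vector_add_ldistrib)
  have surjL: "surj (L x)" for x
  proof (rule surjI)
    show "L x (case x of Var_Snd i \<Rightarrow> pair_vec 0 w | _ \<Rightarrow> pair_vec w 0) = w" for w
      by (cases x) (auto simp: L_def)
  qed
  have contL: "continuous_on S (L x)" for S x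
    using linL by (intro linear_continuous_on) (simp add: linear_conv_bounded_linear)
  have abF: "abelian_fun \<Omega> (F x)" for x using ab by (cases x) (auto simp: F_def)
  have L\<Omega>: "L x \<omega> \<in> \<Omega>" if "\<omega> \<in> \<Omega>2" for x \<omega>
  proof -
    interpret lattice_tile \<Omega> D by fact
    have "a + b \<in> \<Omega>" if "a \<in> \<Omega>" "b \<in> \<Omega>" for a b
      using diff_mem[OF that(1) uminus_mem[OF that(2)]] by simp
    then show ?thesis using that by (cases x) (auto simp: L_def \<Omega>2_def)
  qed
  interpret T: torus_functions \<Omega>2 D2 UNIV "\<lambda>x z. F x (L x z)" G
  proof (intro torus_functions.intro torus_functions_axioms.intro)
    show "lattice_tile \<Omega>2 D2" unfolding \<Omega>2_def D2_def by (rule lattice_tile_product[OF D])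
    show "finite (UNIV :: 'n add_var set)" by (rule finite_add_var)
    show "open (G x)" for x
      using open_vimage[OF open_defined[of "F x"] contL[of UNIV x]] by (simp add: G_def vimage_def)
    show "holo_on (\<lambda>z. F x (L x z)) (G x)" for x
      using holo_on_compose_affine[OF holo_on_defined[of "F x"] linL[of x] scaleL, of 0] by (simp add: G_def)
    show "z + \<omega> \<in> G x \<and> F x (L x (z + \<omega>)) = F x (L x z)" if "z \<in> G x" "\<omega> \<in> \<Omega>2" for x z \<omega>
      using abelian_fun_shift[OF abF L\<Omega>[OF that(2)]] that(1)
      by (simp add: G_def linear_add[OF linL])
    show "\<exists>\<rho>>0. \<exists>p q. normalised_quotient a \<rho> (\<lambda>z. F x (L x z)) (G x) p q" for x a
    proof -
      have "meromorphic_fun (F x)" using abF by (simp add: abelian_fun_def)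
      then obtain U g h where U: "open U" "connected U" "L x a \<in> U" "holo_on g U" "holo_on h U"
        "\<exists>w\<in>U. h w \<noteq> 0" "\<And>w. w \<in> U \<Longrightarrow> h w \<noteq> 0 \<Longrightarrow> defined_at (F x) w \<and> F x w = g w / h w"
        by (rule meromorphic_fun_local_quotient[where z = "L x a"]) blast
      obtain w0 where w0: "w0 \<in> U" "h w0 \<noteq> 0" using U(6) by blast
      show ?thesis
      proof (rule normalised_quotient_exists)
        show "open {z. L x z \<in> U}" using open_vimage[OF U(1) contL] by (simp add: vimage_def)
        show "a \<in> {z. L x z \<in> U}" using U(3) by simp
        show "holo_on (\<lambda>z. g (L x z)) {z. L x z \<in> U}"
          using holo_on_compose_affine[OF U(4) linL[of x] scaleL, of 0] by simp
        show "holo_on (\<lambda>z. h (L x z)) {z. L x z \<in> U}"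
          using holo_on_compose_affine[OF U(5) linL[of x] scaleL, of 0] by simp
        show "\<exists>w\<in>V \<inter> {z. L x z \<in> U}. h (L x w) \<noteq> 0" if V: "open V" "a \<in> V" for V
        proof -
          have "open (L x ` V)" by (rule open_surjective_linear_image[OF V(1) linL surjL])
          then obtain w where "w \<in> L x ` V \<inter> U" "h w \<noteq> 0"
            using holo_on_nonzero_near[OF U(5,1,2) w0 U(3), of "L x ` V"] V(2) by blast
          then show ?thesis by auto
        qed
        show "w \<in> G x \<and> F x (L x w) = g (L x w) / h (L x w)"
          if "w \<in> {z. L x z \<in> U}" "h (L x w) \<noteq> 0" for w
          using U(7)[of "L x w"] that by (simp add: G_def)
      qed
    qed
  qed
  obtain x r where ball: "0 < r" "ball x r \<subseteq> D2"
    using lattice_tile_product(2)[OF D] unfolding D2_def by blast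
  have "CARD('n + 'n) < card (UNIV :: 'n add_var set)" by (simp add: card_add_var)
  then obtain d c where c: "\<exists>\<beta>\<in>T.monomials d. c \<beta> \<noteq> 0" "\<And>z. z \<in> T.common_domain \<Longrightarrow> T.poly_val d c z = 0"
    using T.algebraic_dependence[OF ball(2,1)] by blast
  obtain P :: "'n add_var cpoly" where P: "P \<noteq> 0"
    "\<And>a. cpoly_eval P a = (\<Sum>\<beta>\<in>UNIV \<rightarrow>\<^sub>E {..d}. c \<beta> * (\<Prod>x\<in>UNIV. a x ^ \<beta> x))"
    using cpoly_of_coefficients[OF finite_add_var, of d c] c(1) unfolding T.monomials_def by blast
  show ?thesis
  proof (intro exI[of _ P] conjI allI impI P(1))
    fix u v
    assume defd: "defined_at (\<phi> k) (u + v) \<and> (\<forall>i. defined_at (\<phi> i) u) \<and> (\<forall>i. defined_at (\<phi> i) v)"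
    let ?a = "\<lambda>x. case x of Var_Sum \<Rightarrow> \<phi> k (u + v) | Var_Fst i \<Rightarrow> \<phi> i u | Var_Snd i \<Rightarrow> \<phi> i v"
    have a: "?a = (\<lambda>x. F x (L x (pair_vec u v)))"
      by (auto simp: fun_eq_iff F_def L_def split: add_var.splits)
    have "pair_vec u v \<in> G x" for x
      using defd by (cases x) (auto simp: G_def F_def L_def)
    then have "pair_vec u v \<in> T.common_domain" by (auto simp: T.common_domain_def)
    from c(2)[OF this] show "cpoly_eval P ?a = 0"
      unfolding a by (simp add: P(2) T.poly_val_def T.monomials_def)
  qed
qed

theorem theorem1:
  fixes \<Omega> :: "(complex ^ 'n) set" and \<phi> :: "'n \<Rightarrow> complex ^ 'n \<Rightarrow> complex"
  assumes "full_lattice \<Omega>"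
    and "\<And>i. abelian_fun \<Omega> (\<phi> i)"
    and "analytically_independent \<phi>"
  shows "\<exists>G :: 'n \<Rightarrow> 'n add_var cpoly. \<forall>k. G k \<noteq> 0 \<and>
    (\<forall>u v. defined_at (\<phi> k) (u + v) \<and> (\<forall>i. defined_at (\<phi> i) u) \<and> (\<forall>i. defined_at (\<phi> i) v) \<longrightarrow>
       cpoly_eval (G k)
         (\<lambda>x. case x of Var_Sum \<Rightarrow> \<phi> k (u + v) | Var_Fst i \<Rightarrow> \<phi> i u | Var_Snd i \<Rightarrow> \<phi> i v) = 0)"
  by (rule choice[OF allI[OF abelian_addition_polynomial[OF assms(1,2)]]])

end
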